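(* Let $M$ be a complete fine Jordan locally multiplicatively-convex algebra. Then $M$ is a locally JB-algebra if and only if $M$ contains a Jordan subalgebra $N$ such that: 1. $N$ is a JB-algebra with some norm $\|\cdot\|_N$; and 2. the inclusion $(N,\|\cdot\|_N)\to M$ is a continuous embedding (i.e. it is continuous and injective) with dense range. Further, if $N\subseteq M$ is a Jordan subalgebra satisfying 1 and 2 and the unit ball $N_{\mathbf 1}=\{x\in N:\|x\|_N\le 1\}$ is closed in $M$ in the projective topology of $M$, then $N=M_b$, where $M_b$ denotes the bounded part of $M$.
   Context: All algebras are real and are assumed unital. A Jordan algebra is an algebra with product $\circ$ satisfying $x\circ y=y\circ x$ and $x^2\circ(y\circ x)=(x^2\circ y)\circ x$. A Banach-Jordan algebra is a Jordan algebra that is also a Banach algebra, so that its norm is complete and satisfies $\|x\circ y\|\le\|x\|\,\|y\|$. A seminorm $p$ on a Jordan algebra is submultiplicative if $p(x\circ y)\le p(x)p(y)$ for all $x,y$; fine if $p(x^2+y^2)\ge p(x^2)$ for all $x,y$; and regular if $p(x^2)=p(x)^2$ for all $x$. A Banach-Jordan algebra is fine if its norm is fine. A JB-algebra is a real Banach-Jordan algebra satisfying $\|x^2+y^2\|\ge\|x\|^2$ and $\|x^2\|=\|x\|^2$ for all $x,y$. Projective limits: let $\Lambda$ be an upward directed set, $(E_\alpha)_{\alpha\in\Lambda}$ a family of Jordan algebras with locally convex Hausdorff topologies, and for $\alpha\le\beta$ let $g_\alpha^\beta:E_\beta\to E_\alpha$ be continuous Jordan homomorphisms with $g_\alpha^\alpha=\mathrm{Id}$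 and $g_\alpha^\gamma=g_\alpha^\beta\circ g_\beta^\gamma$ for $\alpha\le\beta\le\gamma$ (a projective family). The projective limit $\varprojlim E_\alpha$ is the subalgebra of $\prod_\alpha E_\alpha$ of all $(x_\alpha)$ with $x_\alpha=g_\alpha^\beta(x_\beta)$ for all $\alpha\le\beta$, with the projective topology, i.e. the topology induced by the restrictions of the coordinate projections. A complete fine Jordan locally multiplicatively-convex algebra (also called a complete fine locally Banach-Jordan algebra) is a topological Jordan algebra that is a projective limit of a projective family of fine Banach-Jordan algebras; it is a complete Hausdorff space whose topology (called its projective topology) is defined by a saturated family of continuous fine submultiplicative seminorms (saturated means closed under taking maxima of finite subfamilies). A locally JB-algebra is a topological Jordan algebra that is a projective limit of a projective family of JB-algebras; equivalently, it is complete and its topology is defined by a saturated family $\Gamma(M)$ of continuous submultiplicative seminorms that are fine and regular. The bounded part of a locally JB-algebra $M$ is $M_b=\{x\in M:\ \|x\|_\infty=\sup_{p\in\Gamma(M)}p(x)<\infty\}$. *)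

theory Defs
  imports "HOL-Analysis.Analysis" "HOL-Algebra.Module"
begin

section \<open>Real Jordan algebras\<close>

definition real_ring :: "real ring" where
  "real_ring = \<lparr>carrier = UNIV, monoid.mult = (*), one = 1, zero = 0, add = (+)\<rparr>"

text \<open>
  The record of HOL-Algebra modules also carries the multiplicative operation and the unit.
  The library locale \<open>algebra\<close> is not applicable because Jordan products are not associative.
  The zero algebra is admitted.
\<close>

locale jordan_algebra = Module.module real_ring A for A (structure) +
  assumes mult_closed: "\<lbrakk>x \<in> carrier A; y \<in> carrier A\<rbrakk> \<Longrightarrow> x \<otimes> y \<in> carrier A"
    and unit_closed: "\<one> \<in> carrier A"
    and mult_comm: "\<lbrakk>x \<in> carrier A; y \<in> carrier A\<rbrakk> \<Longrightarrow> x \<otimes> y = y \<otimes> x"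
    and mult_distrib: "\<lbrakk>x \<in> carrier A; y \<in> carrier A; z \<in> carrier A\<rbrakk>
      \<Longrightarrow> (x \<oplus> y) \<otimes> z = x \<otimes> z \<oplus> y \<otimes> z"
    and mult_smult: "\<lbrakk>x \<in> carrier A; y \<in> carrier A\<rbrakk> \<Longrightarrow> (c \<odot> x) \<otimes> y = c \<odot> (x \<otimes> y)"
    and mult_unit: "x \<in> carrier A \<Longrightarrow> \<one> \<otimes> x = x"
    and jordan_identity: "\<lbrakk>x \<in> carrier A; y \<in> carrier A\<rbrakk>
      \<Longrightarrow> (x \<otimes> x) \<otimes> (y \<otimes> x) = ((x \<otimes> x) \<otimes> y) \<otimes> x"

definition jordan_hom :: "(real, 'a) module \<Rightarrow> (real, 'b) module \<Rightarrow> ('a \<Rightarrow> 'b) set" where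
  "jordan_hom A B =
    {h \<in> ring_hom A B. \<forall>c. \<forall>x\<in>carrier A. h (c \<odot>\<^bsub>A\<^esub> x) = c \<odot>\<^bsub>B\<^esub> h x}"

section \<open>Seminorms and Banach-Jordan algebras\<close>

definition alg_seminorm :: "(real, 'a) module \<Rightarrow> ('a \<Rightarrow> real) \<Rightarrow> bool" where
  "alg_seminorm A p \<longleftrightarrow>
    (\<forall>x\<in>carrier A. 0 \<le> p x) \<and>
    (\<forall>x\<in>carrier A. \<forall>y\<in>carrier A. p (x \<oplus>\<^bsub>A\<^esub> y) \<le> p x + p y) \<and>
    (\<forall>c. \<forall>x\<in>carrier A. p (c \<odot>\<^bsub>A\<^esub> x) = \<bar>c\<bar> * p x)"

definition alg_norm :: "(real, 'a) module \<Rightarrow> ('a \<Rightarrow> real) \<Rightarrow> bool" where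
  "alg_norm A p \<longleftrightarrow> alg_seminorm A p \<and> (\<forall>x\<in>carrier A. p x = 0 \<longrightarrow> x = \<zero>\<^bsub>A\<^esub>)"

definition submultiplicative :: "(real, 'a) module \<Rightarrow> ('a \<Rightarrow> real) \<Rightarrow> bool" where
  "submultiplicative A p \<longleftrightarrow>
    (\<forall>x\<in>carrier A. \<forall>y\<in>carrier A. p (x \<otimes>\<^bsub>A\<^esub> y) \<le> p x * p y)"

definition fine_seminorm :: "(real, 'a) module \<Rightarrow> ('a \<Rightarrow> real) \<Rightarrow> bool" where
  "fine_seminorm A p \<longleftrightarrow>
    (\<forall>x\<in>carrier A. \<forall>y\<in>carrier A. p (x \<otimes>\<^bsub>A\<^esub> x \<oplus>\<^bsub>A\<^esub> y \<otimes>\<^bsub>A\<^esub> y) \<ge> p (x \<otimes>\<^bsub>A\<^esub> x))"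

definition regular_seminorm :: "(real, 'a) module \<Rightarrow> ('a \<Rightarrow> real) \<Rightarrow> bool" where
  "regular_seminorm A p \<longleftrightarrow> (\<forall>x\<in>carrier A. p (x \<otimes>\<^bsub>A\<^esub> x) = (p x)\<^sup>2)"

text \<open>
  The value 0 off the carrier is needed because \<^locale>\<open>Metric_space\<close> requires
  nonnegativity and symmetry of the distance on the whole type.
\<close>

definition norm_dist :: "(real, 'a) module \<Rightarrow> ('a \<Rightarrow> real) \<Rightarrow> 'a \<Rightarrow> 'a \<Rightarrow> real" where
  "norm_dist A p x y = (if x \<in> carrier A \<and> y \<in> carrier A then p (x \<ominus>\<^bsub>A\<^esub> y) else 0)"

definition norm_topology :: "(real, 'a) module \<Rightarrow> ('a \<Rightarrow> real) \<Rightarrow> 'a topology" where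
  "norm_topology A p = Metric_space.mtopology (carrier A) (norm_dist A p)"

definition banach_jordan_algebra :: "(real, 'a) module \<Rightarrow> ('a \<Rightarrow> real) \<Rightarrow> bool" where
  "banach_jordan_algebra A p \<longleftrightarrow>
    jordan_algebra A \<and> alg_norm A p \<and> submultiplicative A p \<and>
    Metric_space.mcomplete (carrier A) (norm_dist A p)"

definition fine_banach_jordan_algebra :: "(real, 'a) module \<Rightarrow> ('a \<Rightarrow> real) \<Rightarrow> bool" where
  "fine_banach_jordan_algebra A p \<longleftrightarrow> banach_jordan_algebra A p \<and> fine_seminorm A p"

definition JB_algebra :: "(real, 'a) module \<Rightarrow> ('a \<Rightarrow> real) \<Rightarrow> bool" where
  "JB_algebra A p \<longleftrightarrow>
    banach_jordan_algebra A p \<and>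
    (\<forall>x\<in>carrier A. \<forall>y\<in>carrier A. p (x \<otimes>\<^bsub>A\<^esub> x \<oplus>\<^bsub>A\<^esub> y \<otimes>\<^bsub>A\<^esub> y) \<ge> (p x)\<^sup>2) \<and>
    (\<forall>x\<in>carrier A. p (x \<otimes>\<^bsub>A\<^esub> x) = (p x)\<^sup>2)"

section \<open>Projective limits of Banach-Jordan algebras\<close>

text \<open>
  \<open>I\<close> is the index set, \<open>leq\<close> its (pre)order, \<open>E \<alpha>\<close> and \<open>\<nu> \<alpha>\<close> the algebras and their norms,
  and \<open>g \<alpha> \<beta>\<close> the map from \<open>E \<beta>\<close> to \<open>E \<alpha>\<close> for \<open>\<alpha>\<close> below \<open>\<beta>\<close>.
\<close>

definition projective_family ::
    "'i set \<Rightarrow> ('i \<Rightarrow> 'i \<Rightarrow> bool) \<Rightarrow> ('i \<Rightarrow> (real, 'e) module) \<Rightarrow> ('i \<Rightarrow> 'e \<Rightarrow> real) \<Rightarrow>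
     ('i \<Rightarrow> 'i \<Rightarrow> 'e \<Rightarrow> 'e) \<Rightarrow> bool" where
  "projective_family I leq E \<nu> g \<longleftrightarrow>
    I \<noteq> {} \<and> reflp_on I leq \<and> transp_on I leq \<and>
    (\<forall>\<alpha>\<in>I. \<forall>\<beta>\<in>I. \<exists>\<gamma>\<in>I. leq \<alpha> \<gamma> \<and> leq \<beta> \<gamma>) \<and>
    (\<forall>\<alpha>\<in>I. banach_jordan_algebra (E \<alpha>) (\<nu> \<alpha>)) \<and>
    (\<forall>\<alpha>\<in>I. \<forall>\<beta>\<in>I. leq \<alpha> \<beta> \<longrightarrow>
      g \<alpha> \<beta> \<in> jordan_hom (E \<beta>) (E \<alpha>) \<and>
      continuous_map (norm_topology (E \<beta>) (\<nu> \<beta>)) (norm_topology (E \<alpha>) (\<nu> \<alpha>)) (g \<alpha> \<beta>)) \<and>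
    (\<forall>\<alpha>\<in>I. \<forall>x\<in>carrier (E \<alpha>). g \<alpha> \<alpha> x = x) \<and>
    (\<forall>\<alpha>\<in>I. \<forall>\<beta>\<in>I. \<forall>\<gamma>\<in>I. leq \<alpha> \<beta> \<and> leq \<beta> \<gamma> \<longrightarrow>
      (\<forall>x\<in>carrier (E \<gamma>). g \<alpha> \<gamma> x = g \<alpha> \<beta> (g \<beta> \<gamma> x)))"

definition proj_lim ::
    "'i set \<Rightarrow> ('i \<Rightarrow> 'i \<Rightarrow> bool) \<Rightarrow> ('i \<Rightarrow> (real, 'e) module) \<Rightarrow> ('i \<Rightarrow> 'i \<Rightarrow> 'e \<Rightarrow> 'e) \<Rightarrow>
     (real, 'i \<Rightarrow> 'e) module" where
  "proj_lim I leq E g =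
    \<lparr>carrier = {x \<in> \<Pi>\<^sub>E \<alpha>\<in>I. carrier (E \<alpha>). \<forall>\<alpha>\<in>I. \<forall>\<beta>\<in>I. leq \<alpha> \<beta> \<longrightarrow> x \<alpha> = g \<alpha> \<beta> (x \<beta>)},
     monoid.mult = (\<lambda>x y. \<lambda>\<alpha>\<in>I. x \<alpha> \<otimes>\<^bsub>E \<alpha>\<^esub> y \<alpha>),
     one = (\<lambda>\<alpha>\<in>I. \<one>\<^bsub>E \<alpha>\<^esub>),
     zero = (\<lambda>\<alpha>\<in>I. \<zero>\<^bsub>E \<alpha>\<^esub>),
     add = (\<lambda>x y. \<lambda>\<alpha>\<in>I. x \<alpha> \<oplus>\<^bsub>E \<alpha>\<^esub> y \<alpha>),
     module.smult = (\<lambda>c x. \<lambda>\<alpha>\<in>I. c \<odot>\<^bsub>E \<alpha>\<^esub> x \<alpha>)\<rparr>"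

definition proj_lim_topology ::
    "'i set \<Rightarrow> ('i \<Rightarrow> 'i \<Rightarrow> bool) \<Rightarrow> ('i \<Rightarrow> (real, 'e) module) \<Rightarrow> ('i \<Rightarrow> 'e \<Rightarrow> real) \<Rightarrow>
     ('i \<Rightarrow> 'i \<Rightarrow> 'e \<Rightarrow> 'e) \<Rightarrow> ('i \<Rightarrow> 'e) topology" where
  "proj_lim_topology I leq E \<nu> g =
    subtopology (product_topology (\<lambda>\<alpha>. norm_topology (E \<alpha>) (\<nu> \<alpha>)) I)
      (carrier (proj_lim I leq E g))"

section \<open>Topological Jordan algebras\<close>

text \<open>
  The ambient algebra is a whole type; its linear structure and topology come from type classes,
  while the Jordan product \<open>m\<close> and its unit \<open>e\<close> are explicit.
\<close>

definition type_algebra :: "('a \<Rightarrow> 'a \<Rightarrow> 'a) \<Rightarrow> 'a \<Rightarrow> (real, 'a::real_vector) module" where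
  "type_algebra m e =
    \<lparr>carrier = UNIV, monoid.mult = m, one = e, zero = 0, add = (+), module.smult = (*\<^sub>R)\<rparr>"

definition topological_jordan_algebra ::
    "('a \<Rightarrow> 'a \<Rightarrow> 'a) \<Rightarrow> 'a::{real_vector, topological_space} \<Rightarrow> bool" where
  "topological_jordan_algebra m e \<longleftrightarrow>
    jordan_algebra (type_algebra m e) \<and>
    continuous_on UNIV (\<lambda>(x :: 'a, y). x + y) \<and>
    continuous_on UNIV (\<lambda>(c :: real, x :: 'a). c *\<^sub>R x) \<and>
    continuous_on UNIV (\<lambda>(x, y). m x y)"

text \<open>
  Being a projective limit is understood up to a homeomorphic Jordan isomorphism. HOL cannot
  quantify existentially over types, so the type \<open>'i\<close> of indices and the type \<open>'e\<close> containing the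
  carriers of the factors are parameters.
\<close>

definition projective_limit_of ::
    "'i itself \<Rightarrow> ((real, 'e) module \<Rightarrow> ('e \<Rightarrow> real) \<Rightarrow> bool) \<Rightarrow>
     ('a \<Rightarrow> 'a \<Rightarrow> 'a) \<Rightarrow> 'a::{real_vector, topological_space} \<Rightarrow> bool" where
  "projective_limit_of _ P m e \<longleftrightarrow>
    (\<exists>(I :: 'i set) leq E \<nu> g.
      projective_family I leq E \<nu> g \<and> (\<forall>\<alpha>\<in>I. P (E \<alpha>) (\<nu> \<alpha>)) \<and>
      (\<exists>\<phi> \<in> jordan_hom (type_algebra m e) (proj_lim I leq E g).
        homeomorphic_map euclidean (proj_lim_topology I leq E \<nu> g) \<phi>))"

definition complete_fine_lmc_jordan_algebra ::
    "'i itself \<Rightarrow> 'e itself \<Rightarrow>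
     ('a \<Rightarrow> 'a \<Rightarrow> 'a) \<Rightarrow> 'a::{real_vector, topological_space} \<Rightarrow> bool" where
  "complete_fine_lmc_jordan_algebra _ _ m e \<longleftrightarrow>
    topological_jordan_algebra m e \<and>
    projective_limit_of TYPE('i)
      (fine_banach_jordan_algebra :: (real, 'e) module \<Rightarrow> _) m e"

definition locally_JB_algebra ::
    "'i itself \<Rightarrow> 'e itself \<Rightarrow>
     ('a \<Rightarrow> 'a \<Rightarrow> 'a) \<Rightarrow> 'a::{real_vector, topological_space} \<Rightarrow> bool" where
  "locally_JB_algebra _ _ m e \<longleftrightarrow>
    topological_jordan_algebra m e \<and>
    projective_limit_of TYPE('i) (JB_algebra :: (real, 'e) module \<Rightarrow> _) m e"

text \<open>
  Every projective limit \<open>M\<close> of JB-algebras, over whatever types, is also one whose indices are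
  seminorms on \<open>M\<close> and whose factors are the completions of the quotients of \<open>M\<close> by their kernels,
  realised as classes of Cauchy sequences in \<open>M\<close>. The types \<open>'a \<Rightarrow> real\<close> and \<open>(nat \<Rightarrow> 'a) set\<close> are
  therefore always large enough for \<open>'i\<close> and \<open>'e\<close>, and so are all types into which they embed.
\<close>

definition jordan_subalgebra ::
    "('a \<Rightarrow> 'a \<Rightarrow> 'a) \<Rightarrow> 'a \<Rightarrow> 'a::real_vector set \<Rightarrow> bool" where
  "jordan_subalgebra m e N \<longleftrightarrow> subspace N \<and> e \<in> N \<and> (\<forall>x\<in>N. \<forall>y\<in>N. m x y \<in> N)"

text \<open>
  The inclusion of a subset is injective, so its being a continuous embedding (in the sense of a
  continuous injection, not of a homeomorphism onto the image) amounts to continuity.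
\<close>

definition densely_included_JB ::
    "('a \<Rightarrow> 'a \<Rightarrow> 'a) \<Rightarrow> 'a::{real_vector, topological_space} \<Rightarrow> 'a set \<Rightarrow> ('a \<Rightarrow> real) \<Rightarrow> bool"
  where
  "densely_included_JB m e N p \<longleftrightarrow>
    jordan_subalgebra m e N \<and>
    JB_algebra ((type_algebra m e)\<lparr>carrier := N\<rparr>) p \<and>
    continuous_map (norm_topology ((type_algebra m e)\<lparr>carrier := N\<rparr>) p) euclidean (\<lambda>x. x) \<and>
    closure N = UNIV"

section \<open>Defining families of seminorms and the bounded part\<close>

definition saturated :: "('a \<Rightarrow> real) set \<Rightarrow> bool" where
  "saturated \<Gamma> \<longleftrightarrow> (\<forall>F. finite F \<and> F \<noteq> {} \<and> F \<subseteq> \<Gamma> \<longrightarrow> (\<lambda>x. MAX p\<in>F. p x) \<in> \<Gamma>)"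

definition defines_topology :: "('a::{real_vector, topological_space} \<Rightarrow> real) set \<Rightarrow> bool" where
  "defines_topology \<Gamma> \<longleftrightarrow>
    (\<forall>U :: 'a set. open U \<longleftrightarrow>
      generate_topology {{y. p (y - x) < r} | p x r. p \<in> \<Gamma> \<and> 0 < r} U)"

definition JB_seminorm_family ::
    "('a \<Rightarrow> 'a \<Rightarrow> 'a) \<Rightarrow> 'a::{real_vector, topological_space} \<Rightarrow> ('a \<Rightarrow> real) set \<Rightarrow> bool" where
  "JB_seminorm_family m e \<Gamma> \<longleftrightarrow>
    saturated \<Gamma> \<and> defines_topology \<Gamma> \<and>
    (\<forall>p\<in>\<Gamma>. continuous_on UNIV p \<and> alg_seminorm (type_algebra m e) p \<and>
      submultiplicative (type_algebra m e) p \<and> fine_seminorm (type_algebra m e) p \<and>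
      regular_seminorm (type_algebra m e) p)"

definition bounded_part :: "('a \<Rightarrow> real) set \<Rightarrow> 'a set" where
  "bounded_part \<Gamma> = {x. (SUP p\<in>\<Gamma>. ereal (p x)) < \<infinity>}"

end

theory Submission
  imports Defs "HOL-Computational_Algebra.Polynomial"
begin

text \<open>
  The proof rests on a functional calculus in one element. For a fine, regular, submultiplicative
  seminorm \<open>p\<close> on a Jordan algebra, evaluation of polynomials at \<open>x\<close> pulls \<open>p\<close> back to a seminorm on
  \<open>\<real>[t]\<close>, because powers of one element associate. Such a seminorm is at most the supremum of the
  polynomial over \<open>[-r, r]\<close> whenever \<open>r > p x\<close> (\<open>fine_poly_seminorm_le_sup\<close>). In an algebra that is
  complete for a family of such seminorms, Weierstrass approximation then defines \<open>f(x)\<close> for every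
  continuous \<open>f\<close>, with the same bound (\<open>fcalc_ex\<close>). The proof applies it to the truncations
  \<open>t \<mapsto> max (-s) (min s t)\<close>. The truncation \<open>y\<close> of \<open>x\<close> satisfies \<open>p y \<le> s\<close> for all \<open>p\<close> in the family,
  and it equals \<open>x\<close> modulo the kernel of each submultiplicative seminorm \<open>q\<close>, dominated by the
  family, in which \<open>x\<close> has spectral radius below \<open>s\<close> (\<open>clamp_eq_of_spectral_radius\<close>).

  If \<open>M\<close> is a locally JB-algebra, the bounded part with the supremum norm is the required \<open>N\<close>: it is
  dense because for \<open>s > p x\<close> the truncation of \<open>x\<close> is bounded and equals \<open>x\<close> modulo the kernel of
  \<open>p\<close>.

  Conversely, let \<open>N\<close> be a dense JB-algebra and \<open>q\<close> a defining seminorm of \<open>M\<close>. The infimum of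
  \<open>\<parallel>z\<parallel> + q (x - z)\<close> over \<open>z \<in> N\<close> is a seminorm on \<open>M\<close> equivalent to \<open>q\<close>. On \<open>N\<close> it is the quotient norm
  modulo the kernel of \<open>q\<close>, since truncation provides representatives of almost minimal norm.
  Truncation also shows that it is regular and fine on \<open>N\<close>, and both properties pass to \<open>M\<close> by
  density (\<open>JB_hat\<close>). So the topology of \<open>M\<close> is defined by fine regular seminorms \<open>p\<close>. The quotients
  \<open>M / ker p\<close> are already complete: a rapidly convergent series in the quotient lifts, by truncation
  of its terms, to a series that converges in \<open>M\<close> (\<open>quotient_complete\<close>). Hence these quotients are
  JB-algebras, and \<open>M\<close> is their projective limit.

  For the last claim, regularity forces every \<open>\<gamma> \<in> \<Gamma>\<close> to be at most the norm on \<open>N\<close>. In the other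
  direction, let all seminorms of \<open>x\<close> be below \<open>1\<close>. Near \<open>x\<close> with respect to \<open>\<gamma>\<close> there is \<open>z \<in> N\<close> with
  \<open>\<gamma> z < 1\<close>. The truncation of \<open>z\<close> at \<open>1\<close> lies in the unit ball of \<open>N\<close> and is as close to \<open>x\<close>. So \<open>x\<close>
  lies in the closure of the unit ball.
\<close>

section \<open>Fine regular seminorms on real polynomials\<close>

text \<open>
  A crude bound that grows only linearly along the powers \<open>2^k\<close> becomes sharp after taking roots.
\<close>

lemma le_of_power_le_linear_mult_power:
  fixes a b A B :: real
  assumes "0 \<le> a" "0 \<le> b" "\<And>k::nat. a ^ (2 ^ k) \<le> (A * 2 ^ k + B) * b ^ (2 ^ k)"
  shows "a \<le> b"
proof (rule ccontr)
  assume "\<not> a \<le> b"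
  then have ab: "b < a" by simp
  define c where "c = (a + b) / 2"
  have c: "b < c" "c < a" "0 < c" using ab assms(2) by (auto simp: c_def)
  have lim: "(\<lambda>n. (A * real n + B) * (c / a) ^ n) \<longlonglongrightarrow> 0"
  proof -
    have r: "norm (c / a) < 1" using c by auto
    have "(\<lambda>n. A * (real n * (c / a) ^ n) + B * (c / a) ^ n) \<longlonglongrightarrow> A * 0 + B * 0"
      by (intro tendsto_add tendsto_mult tendsto_const powser_times_n_limit_0[OF r] LIMSEQ_power_zero[OF r])
    then show ?thesis by (simp add: algebra_simps)
  qed
  have "(\<lambda>k. (A * real (2 ^ k) + B) * (c / a) ^ (2 ^ k)) \<longlonglongrightarrow> 0"
    using LIMSEQ_subseq_LIMSEQ[OF lim, of "\<lambda>k. 2 ^ k"] by (simp add: strict_mono_def o_def)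
  then have "\<forall>\<^sub>F k in sequentially. (A * real (2 ^ k) + B) * (c / a) ^ (2 ^ k) < 1"
    by (rule order_tendstoD) simp
  then obtain k where k: "(A * 2 ^ k + B) * (c / a) ^ (2 ^ k) < 1"
    by (auto simp: eventually_sequentially)
  have "a ^ (2 ^ k) \<le> (A * 2 ^ k + B) * c ^ (2 ^ k)"
  proof (cases "A * 2 ^ k + B \<ge> 0")
    case True
    then show ?thesis using assms(3)[of k] c assms(2)
      by (meson less_imp_le mult_left_mono order_trans power_mono)
  next
    case False
    then have "(A * 2 ^ k + B) * b ^ (2 ^ k) \<le> 0" using assms(2)
      by (simp add: mult_nonpos_nonneg)
    moreover have "0 < a ^ (2 ^ k)" using c by auto
    ultimately show ?thesis using assms(3)[of k] by linarith
  qed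
  moreover have "(A * 2 ^ k + B) * c ^ (2 ^ k) < a ^ (2 ^ k)"
    using k c by (simp add: power_divide field_simps)
  ultimately show False by simp
qed

text \<open>
  The Chebyshev polynomials of the first kind and, shifted by one index, of the second kind. The
  recursion is the addition theorem for cosine and sine; it makes the Pell equation immediate.
\<close>

fun chebT chebU :: "nat \<Rightarrow> real poly" where
  "chebT 0 = 1"
| "chebT (Suc n) = [:0, 1:] * chebT n - (1 - [:0, 1:] * [:0, 1:]) * chebU n"
| "chebU 0 = 0"
| "chebU (Suc n) = [:0, 1:] * chebU n + chebT n"

lemma cheb_pell:
  "chebT n * chebT n + (1 - [:0, 1:] * [:0, 1:]) * (chebU n * chebU n) = 1"
proof (induction n)
  case (Suc n)
  have "chebT (Suc n) * chebT (Suc n)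
      + (1 - [:0, 1:] * [:0, 1:]) * (chebU (Suc n) * chebU (Suc n))
    = chebT n * chebT n + (1 - [:0, 1:] * [:0, 1:]) * (chebU n * chebU n)"
  proof -
    have "(x * a - (1 - x * x) * b) * (x * a - (1 - x * x) * b)
        + (1 - x * x) * ((x * b + a) * (x * b + a)) = a * a + (1 - x * x) * (b * b)"
      for x a b :: "real poly" by (simp add: algebra_simps)
    then show ?thesis by (simp only: chebT.simps chebU.simps)
  qed
  then show ?case using Suc by simp
qed simp

lemma cheb_cos:
  "poly (chebT n) (cos t) = cos (real n * t) \<and> sin t * poly (chebU n) (cos t) = sin (real n * t)"
proof (induction n)
  case (Suc n)
  have s: "1 - cos t * cos t = sin t * sin t"
    using sin_cos_squared_add[of t] by (simp add: power2_eq_square algebra_simps)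
  have "poly (chebT (Suc n)) (cos t)
      = cos t * poly (chebT n) (cos t) - (1 - cos t * cos t) * poly (chebU n) (cos t)"
    by simp
  also have "\<dots> = cos t * poly (chebT n) (cos t) - sin t * (sin t * poly (chebU n) (cos t))"
    unfolding s by (simp add: mult.assoc)
  also have "\<dots> = cos (real (Suc n) * t)"
    using Suc by (simp add: cos_add algebra_simps)
  finally have 1: "poly (chebT (Suc n)) (cos t) = cos (real (Suc n) * t)" .
  have "sin t * poly (chebU (Suc n)) (cos t)
      = cos t * (sin t * poly (chebU n) (cos t)) + sin t * poly (chebT n) (cos t)"
    by (simp add: algebra_simps)
  also have "\<dots> = sin (real (Suc n) * t)"
    using Suc by (simp add: sin_add algebra_simps)
  finally show ?case using 1 by blast
qed simp

lemma X_chebT: "[:0, 1:] * chebT (Suc n) = Polynomial.smult (1/2) (chebT n) + Polynomial.smult (1/2) (chebT (Suc (Suc n)))"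
proof -
  have "[:0, 2:] * chebT (Suc n) = chebT n + chebT (Suc (Suc n))"
  proof -
    have "[:0, 2::real:] = 2 * [:0, 1:]" by (simp add: numeral_poly)
    moreover have "2 * x * (x * a - (1 - x * x) * b)
        = a + (x * (x * a - (1 - x * x) * b) - (1 - x * x) * (x * b + a))" for x a b :: "real poly"
      by (simp add: algebra_simps mult_2)
    ultimately show ?thesis by (simp only: chebT.simps chebU.simps)
  qed
  then have "Polynomial.smult (1/2) ([:0, 2:] * chebT (Suc n)) = Polynomial.smult (1/2) (chebT n + chebT (Suc (Suc n)))"
    by simp
  then show ?thesis by (simp add: smult_add_right del: chebT.simps)
qed

lemma cheb_expansion: "\<exists>c. P = (\<Sum>n\<le>degree P. Polynomial.smult (c n) (chebT n))"
proof -
  define S where "S d = {P. \<exists>c. P = (\<Sum>n\<le>d. Polynomial.smult (c n) (chebT n))}" for d :: nat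
  have add: "P + Q \<in> S d" if "P \<in> S d" "Q \<in> S d" for P Q d
  proof -
    from that obtain a b where "P = (\<Sum>n\<le>d. Polynomial.smult (a n) (chebT n))"
      "Q = (\<Sum>n\<le>d. Polynomial.smult (b n) (chebT n))" by (auto simp: S_def)
    then have "P + Q = (\<Sum>n\<le>d. Polynomial.smult (a n + b n) (chebT n))"
      by (simp add: sum.distrib smult_add_left)
    then show ?thesis by (auto simp: S_def intro: exI[of _ "\<lambda>n. a n + b n"])
  qed
  have T: "Polynomial.smult a (chebT k) \<in> S d" if "k \<le> d" for a k d
  proof -
    have "Polynomial.smult a (chebT k) = (\<Sum>n\<le>d. Polynomial.smult (if n = k then a else 0) (chebT n))"
      using that by (simp add: if_distrib[of "\<lambda>c. Polynomial.smult c _"] sum.delta cong: if_cong)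
    then show ?thesis by (auto simp: S_def intro: exI[of _ "\<lambda>n. if n = k then a else 0"])
  qed
  have sum: "(\<Sum>n\<in>F. f n) \<in> S d" if "finite F" "\<And>n. n \<in> F \<Longrightarrow> f n \<in> S d"
    for F :: "nat set" and f d
    using that
  proof (induction F rule: finite_induct)
    case empty
    show ?case using T[of 0 d 0] by simp
  qed (auto intro: add)
  have XT: "Polynomial.smult a ([:0, 1:] * chebT n) \<in> S (Suc d)" if "n \<le> d" for a n d
  proof (cases n)
    case 0
    then have "Polynomial.smult a ([:0, 1:] * chebT n) = Polynomial.smult a (chebT 1)" by simp
    then show ?thesis using T[of 1 "Suc d" a] by simp
  next
    case (Suc k)
    then show ?thesis unfolding Suc X_chebT smult_add_right smult_smult
      using that Suc by (intro add T) auto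
  qed
  have X: "[:0, 1:] * P \<in> S (Suc d)" if P: "P \<in> S d" for P d
  proof -
    from P obtain c where c: "P = (\<Sum>n\<le>d. Polynomial.smult (c n) (chebT n))" by (auto simp: S_def)
    have "[:0, 1:] * P = (\<Sum>n\<le>d. Polynomial.smult (c n) ([:0, 1:] * chebT n))"
      unfolding c sum_distrib_left mult_smult_right by simp
    also have "\<dots> \<in> S (Suc d)" by (intro sum XT) auto
    finally show ?thesis .
  qed
  have "P \<in> S (degree P)"
  proof (induction P)
    case 0
    show ?case using T[of 0 0 0] by simp
  next
    case (pCons a P)
    have eq: "pCons a P = Polynomial.smult a (chebT 0) + [:0, 1:] * P" by simp
    show ?case
    proof (cases "P = 0")
      case True
      then show ?thesis using T[of 0 0 a] by simp
    next
      case False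
      then have "degree (pCons a P) = Suc (degree P)" by simp
      then show ?thesis unfolding eq using X[OF pCons.IH] T[of 0 "Suc (degree P)" a] add
        by (metis eq le0)
    qed
  qed
  then show ?thesis unfolding S_def by blast
qed

lemma has_integral_cos_multiple:
  "((\<lambda>t. cos (real n * t)) has_integral (if n = 0 then pi else 0)) {0..pi}"
proof (cases "n = 0")
  case True
  then show ?thesis using has_integral_const_real[of "1::real" 0 pi] by simp
next
  case False
  have "((\<lambda>t. cos (real n * t)) has_integral (sin (real n * pi) / n - sin (real n * 0) / n)) {0..pi}"
    using False
    by (intro fundamental_theorem_of_calculus)
      (auto intro!: derivative_eq_intros simp: has_real_derivative_iff_has_vector_derivative[symmetric])
  then show ?thesis using False by simp
qed

lemma has_integral_cos_cos:
  "((\<lambda>t. cos (real k * t) * cos (real n * t)) has_integral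
     (if k = n then if n = 0 then pi else pi / 2 else 0)) {0..pi}"
proof -
  define d where "d = (if k \<le> n then n - k else k - n)"
  have cd: "cos (real d * t) = cos (real k * t - real n * t)" for t
    by (auto simp: d_def of_nat_diff algebra_simps)
      (metis cos_minus minus_diff_eq)+
  have eq: "cos (real k * t) * cos (real n * t) = (1/2) * (cos (real d * t) + cos (real (k + n) * t))" for t
    unfolding cd cos_times_cos by (simp add: algebra_simps)
  have "((\<lambda>t. (1/2) * (cos (real d * t) + cos (real (k + n) * t))) has_integral
     (1/2) * ((if d = 0 then pi else 0) + (if k + n = 0 then pi else 0))) {0..pi}"
    by (intro has_integral_mult_right has_integral_add has_integral_cos_multiple)
  moreover have "(1/2) * ((if d = 0 then pi else 0) + (if k + n = 0 then pi else 0))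
     = (if k = n then if n = 0 then pi else pi / 2 else 0)"
    by (auto simp: d_def)
  ultimately show ?thesis unfolding eq by simp
qed

text \<open>
  The coefficients are Fourier cosine coefficients of \<open>\<theta> \<mapsto> P (cos \<theta>)\<close>.
\<close>

lemma cheb_coeff_bound:
  assumes P: "P = (\<Sum>k\<le>d. Polynomial.smult (c k) (chebT k))" and n: "n \<le> d"
    and S: "\<And>t. \<bar>t\<bar> \<le> 1 \<Longrightarrow> \<bar>poly P t\<bar> \<le> S"
  shows "\<bar>c n\<bar> \<le> 2 * S"
proof -
  have Pc: "poly P (cos t) = (\<Sum>k\<le>d. c k * cos (real k * t))" for t
    unfolding P by (simp add: poly_sum cheb_cos)
  define I where "I = (if n = 0 then pi else pi / 2)"
  have "((\<lambda>t. \<Sum>k\<le>d. c k * (cos (real k * t) * cos (real n * t))) has_integral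
     (\<Sum>k\<le>d. c k * (if k = n then I else 0))) {0..pi}"
    unfolding I_def by (intro has_integral_sum has_integral_mult_right has_integral_cos_cos) auto
  then have "((\<lambda>t. poly P (cos t) * cos (real n * t)) has_integral (c n * I)) {0..pi}"
    using n unfolding Pc sum_distrib_right
    by (simp add: mult.assoc if_distrib[of "(*) _"] sum.delta cong: if_cong)
  moreover have "norm (poly P (cos t) * cos (real n * t)) \<le> S" for t
  proof -
    have "\<bar>poly P (cos t)\<bar> * \<bar>cos (real n * t)\<bar> \<le> S * 1"
      by (rule mult_mono) (use S[of "cos t"] in \<open>auto simp: abs_cos_le_one\<close>)
    then show ?thesis by (simp add: abs_mult)
  qed
  moreover have "0 \<le> S" using S[of 0] by simp
  ultimately have "norm (c n * I) \<le> S * measure lborel {0..pi}"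
    by (intro has_integral_bound_real[where B = S and f = "\<lambda>t. poly P (cos t) * cos (real n * t)"]) auto
  then have "\<bar>c n\<bar> * I \<le> S * pi" by (auto simp: abs_mult I_def)
  moreover have "\<bar>c n\<bar> * (pi / 2) \<le> \<bar>c n\<bar> * I"
    by (intro mult_left_mono) (auto simp: I_def)
  ultimately have "\<bar>c n\<bar> * (pi / 2) \<le> S * pi" by linarith
  then show ?thesis using pi_gt_zero by (simp add: field_simps)
qed

text \<open>
  The model is \<open>P \<mapsto> p (P(x))\<close> for a fine regular submultiplicative seminorm \<open>p\<close>.
\<close>

locale fine_poly_seminorm =
  fixes \<pi> :: "real poly \<Rightarrow> real"
  assumes nonneg: "0 \<le> \<pi> P"
    and triangle: "\<pi> (P + Q) \<le> \<pi> P + \<pi> Q"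
    and homogeneous: "\<pi> (Polynomial.smult c P) = \<bar>c\<bar> * \<pi> P"
    and submult: "\<pi> (P * Q) \<le> \<pi> P * \<pi> Q"
    and regular: "\<pi> (P * P) = (\<pi> P)\<^sup>2"
    and fine: "\<pi> (P * P) \<le> \<pi> (P * P + Q * Q)"
begin

lemma zero: "\<pi> 0 = 0"
  using homogeneous[of 0 0] by simp

lemma one: "\<pi> 1 \<le> 1"
proof -
  have "\<pi> 1 * (\<pi> 1 - 1) = 0" using regular[of 1] by (simp add: power2_eq_square algebra_simps)
  then show ?thesis by auto
qed

lemma sum_le: "\<pi> (\<Sum>i\<in>F. f i) \<le> (\<Sum>i\<in>F. \<pi> (f i))"
proof (induction F rule: infinite_finite_induct)
  case (insert i F)
  then show ?case using triangle[of "f i" "sum f F"] by simp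
qed (auto simp: zero)

lemma regular_power: "\<pi> (P ^ (2 ^ k)) = \<pi> P ^ (2 ^ k)"
proof (induction k)
  case (Suc k)
  have "P ^ (2 ^ Suc k) = P ^ (2 ^ k) * P ^ (2 ^ k)"
    by (metis mult_2 power_Suc power_add)
  then show ?case using regular[of "P ^ (2 ^ k)"] Suc
    by (simp add: power_mult[symmetric] mult.commute)
qed simp

text \<open>
  If \<open>V = 1 - w\<close>, then \<open>V\<^sup>2 = 1 - Z\<close> means \<open>w = (Z + w\<^sup>2) / 2\<close>. Iterating this fixed point equation stays
  inside \<open>\<real>[t]\<close> and contracts because \<open>\<pi> Z < 1\<close>.
\<close>

lemma approx_sqrt:
  assumes Z: "\<pi> Z < 1" and \<epsilon>: "0 < \<epsilon>"
  shows "\<exists>V. \<pi> (1 - Z - V * V) < \<epsilon>"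
proof -
  define w where "w = rec_nat (0::real poly) (\<lambda>_ w. Polynomial.smult (1/2) (Z + w * w))"
  have w0: "w 0 = 0" and wS: "w (Suc k) = Polynomial.smult (1/2) (Z + w k * w k)" for k
    by (auto simp: w_def)
  define \<rho> where "\<rho> = \<pi> Z"
  have \<rho>: "0 \<le> \<rho>" "\<rho> < 1" using Z nonneg by (auto simp: \<rho>_def)
  have wb: "\<pi> (w k) \<le> \<rho>" for k
  proof (induction k)
    case (Suc k)
    have "\<pi> (w (Suc k)) \<le> (\<pi> Z + \<pi> (w k) * \<pi> (w k)) / 2"
      unfolding wS homogeneous using triangle[of Z "w k * w k"] submult[of "w k" "w k"] by simp
    also have "\<dots> \<le> (\<rho> + \<rho> * 1) / 2"
      using Suc \<rho> nonneg[of "w k"] by (intro divide_right_mono add_mono mult_mono) (auto simp: \<rho>_def)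
    finally show ?case by simp
  qed (use \<rho> in \<open>simp add: w0 zero\<close>)
  have diff: "\<pi> (w (Suc k) - w k) \<le> \<rho> ^ k" for k
  proof (induction k)
    case 0
    then show ?case using wb[of "Suc 0"] \<rho> by (simp add: w0)
  next
    case (Suc k)
    have "w (Suc (Suc k)) - w (Suc k) = Polynomial.smult (1/2) ((w (Suc k) - w k) * (w (Suc k) + w k))"
      unfolding wS[of "Suc k"] wS[of k, symmetric]
      by (subst (2) wS) (simp add: algebra_simps smult_add_right smult_diff_right)
    then have "\<pi> (w (Suc (Suc k)) - w (Suc k))
        \<le> \<pi> (w (Suc k) - w k) * \<pi> (w (Suc k) + w k) / 2"
      using submult by (simp add: homogeneous)
    also have "\<dots> \<le> \<rho> ^ k * (2 * \<rho>) / 2"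
      using Suc wb[of k] wb[of "Suc k"] triangle[of "w (Suc k)" "w k"] \<rho> nonneg
      by (intro divide_right_mono mult_mono) auto
    finally show ?case by (simp add: mult.commute)
  qed
  have "(\<lambda>k. 2 * \<rho> ^ k) \<longlonglongrightarrow> 2 * 0"
    using \<rho> by (intro tendsto_mult tendsto_const LIMSEQ_power_zero) auto
  then have "\<forall>\<^sub>F k in sequentially. 2 * \<rho> ^ k < \<epsilon>"
    using \<epsilon> by (intro order_tendstoD) auto
  then obtain k where k: "2 * \<rho> ^ k < \<epsilon>" by (auto simp: eventually_sequentially)
  have "Polynomial.smult 2 (w k) = w k + w k"
    using smult_add_left[of 1 1 "w k"] by simp
  then have "1 - Z - (1 - w k) * (1 - w k) = Polynomial.smult (- 2) (w (Suc k) - w k)"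
    unfolding wS smult_diff_right smult_smult by (simp add: algebra_simps)
  then have "\<pi> (1 - Z - (1 - w k) * (1 - w k)) \<le> 2 * \<rho> ^ k"
    using diff[of k] by (simp only: homogeneous)
  then show ?thesis using k by (intro exI[of _ "1 - w k"]) linarith
qed

text \<open>
  With \<open>1 - X\<^sup>2\<close> almost a square \<open>V\<^sup>2\<close>, the Pell equation reads \<open>T\<^sup>2 + (V U)\<^sup>2 \<approx> 1\<close>, and fineness gives
  \<open>\<pi> (T\<^sup>2) \<le> 1\<close>.
\<close>

lemma chebT_le_one:
  assumes X: "\<pi> [:0, 1:] < 1"
  shows "\<pi> (chebT n) \<le> 1"
proof -
  define U where "U = chebU n"
  have XX: "\<pi> ([:0, 1:] * [:0, 1:]) < 1"
  proof -
    have "(\<pi> [:0, 1:])\<^sup>2 < 1" using X nonneg by (simp add: power_less_one_iff abs_square_less_1)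
    then show ?thesis by (simp only: regular)
  qed
  have "(\<pi> (chebT n))\<^sup>2 \<le> 1 + \<delta>" if \<delta>: "0 < \<delta>" for \<delta>
  proof -
    have "0 < \<delta> / (\<pi> (U * U) + 1)" using \<delta> nonneg[of "U * U"] by simp
    from approx_sqrt[OF XX this]
    obtain V where V: "\<pi> (1 - [:0, 1:] * [:0, 1:] - V * V) < \<delta> / (\<pi> (U * U) + 1)" by blast
    have "(\<pi> (chebT n))\<^sup>2 \<le> \<pi> (chebT n * chebT n + (V * U) * (V * U))"
      using fine[of "chebT n" "V * U"] regular by simp
    also have "chebT n * chebT n + (V * U) * (V * U)
        = 1 + Polynomial.smult (-1) ((1 - [:0, 1:] * [:0, 1:] - V * V) * (U * U))"
    proof -
      have "t + V * U * (V * U) = 1 + - ((1 - z - V * V) * (U * U))" if "t + (1 - z) * (U * U) = 1"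
        for t z :: "real poly"
      proof -
        from that have "t = 1 - (1 - z) * (U * U)" by (simp add: eq_diff_eq)
        then show ?thesis by (simp add: algebra_simps)
      qed
      from this[OF cheb_pell[of n, folded U_def]]
      show ?thesis unfolding smult_minus_left smult_1_left .
    qed
    also have "\<pi> \<dots> \<le> \<pi> 1 + \<bar>-1\<bar> * \<pi> ((1 - [:0, 1:] * [:0, 1:] - V * V) * (U * U))"
      unfolding homogeneous[symmetric] by (rule triangle)
    also have "\<dots> \<le> 1 + \<pi> (1 - [:0, 1:] * [:0, 1:] - V * V) * \<pi> (U * U)"
      using one submult[of "1 - [:0, 1:] * [:0, 1:] - V * V" "U * U"] by linarith
    also have "\<dots> \<le> 1 + \<delta> / (\<pi> (U * U) + 1) * \<pi> (U * U)"
      using V nonneg by (intro add_left_mono mult_right_mono) auto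
    also have "\<dots> \<le> 1 + \<delta>"
      using \<delta> nonneg[of "U * U"] by (simp add: field_simps)
    finally show ?thesis .
  qed
  then have "(\<pi> (chebT n))\<^sup>2 \<le> 1" by (rule field_le_epsilon)
  then show ?thesis using nonneg by (simp add: power_le_one_iff abs_square_le_1)
qed

text \<open>
  Expanding in Chebyshev polynomials bounds \<open>\<pi> Q\<close> by the supremum of \<open>Q\<close> times a factor linear in the
  degree. Applied to \<open>Q = P ^ (2 ^ k)\<close>, regularity removes the factor.
\<close>

lemma le_sup_unit:
  assumes X: "\<pi> [:0, 1:] < 1" and S: "\<And>t. \<bar>t\<bar> \<le> 1 \<Longrightarrow> \<bar>poly P t\<bar> \<le> S"
  shows "\<pi> P \<le> S"
proof -
  have S0: "0 \<le> S" using S[of 0] by simp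
  have crude: "\<pi> Q \<le> (2 * real (degree Q) + 2) * R" if R: "\<And>t. \<bar>t\<bar> \<le> 1 \<Longrightarrow> \<bar>poly Q t\<bar> \<le> R" for Q R
  proof -
    obtain c where c: "Q = (\<Sum>n\<le>degree Q. Polynomial.smult (c n) (chebT n))" using cheb_expansion by blast
    have "\<pi> Q \<le> (\<Sum>n\<le>degree Q. \<pi> (Polynomial.smult (c n) (chebT n)))"
      by (subst c) (rule sum_le)
    also have "\<dots> \<le> (\<Sum>n\<le>degree Q. (2 * R) * 1)"
      unfolding homogeneous using cheb_coeff_bound[OF c _ R] nonneg chebT_le_one[OF X] R[of 0]
      by (intro sum_mono mult_mono) auto
    finally show ?thesis by (simp add: algebra_simps)
  qed
  show ?thesis
  proof (rule le_of_power_le_linear_mult_power[OF nonneg S0])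
    fix k :: nat
    have "\<pi> P ^ (2 ^ k) = \<pi> (P ^ (2 ^ k))" by (simp add: regular_power)
    also have "\<dots> \<le> (2 * real (degree (P ^ (2 ^ k))) + 2) * S ^ (2 ^ k)"
      by (rule crude) (auto simp: power_abs intro: power_mono S)
    also have "\<dots> \<le> (2 * (real (degree P) * 2 ^ k) + 2) * S ^ (2 ^ k)"
    proof -
      have "real (degree (P ^ (2 ^ k))) \<le> real (degree P * 2 ^ k)"
        using degree_power_le of_nat_le_iff by blast
      then show ?thesis using S0 by (intro mult_right_mono) auto
    qed
    finally show "\<pi> P ^ (2 ^ k) \<le> ((2 * real (degree P)) * 2 ^ k + 2) * S ^ (2 ^ k)"
      by (simp add: mult.assoc)
  qed
qed

end

text \<open>
  The substitution \<open>t \<mapsto> t / r\<close> reduces to the unit interval.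
\<close>

theorem fine_poly_seminorm_le_sup:
  assumes "fine_poly_seminorm \<pi>" and X: "\<pi> [:0, 1:] < r"
    and S: "\<And>t. \<bar>t\<bar> \<le> r \<Longrightarrow> \<bar>poly P t\<bar> \<le> S"
  shows "\<pi> P \<le> S"
proof -
  interpret fine_poly_seminorm \<pi> by fact
  have r: "0 < r" using X nonneg[of "[:0, 1:]"] by linarith
  define \<pi>' where "\<pi>' Q = \<pi> (pcompose Q [:0, 1 / r:])" for Q
  interpret s: fine_poly_seminorm \<pi>'
    by unfold_locales
      (auto simp: \<pi>'_def pcompose_add pcompose_mult pcompose_smult nonneg triangle homogeneous
        submult regular fine[unfolded regular])
  have "\<pi>' (pcompose P [:0, r:]) \<le> S"
  proof (rule s.le_sup_unit)
    have "pcompose [:0, 1:] [:0, 1 / r:] = Polynomial.smult (1 / r) [:0, 1:]" by (simp add: pcompose_pCons)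
    then show "\<pi>' [:0, 1:] < 1" unfolding \<pi>'_def using X r by (simp add: homogeneous del: smult_pCons)
    show "\<bar>poly (pcompose P [:0, r:]) t\<bar> \<le> S" if "\<bar>t\<bar> \<le> 1" for t
      using that r S[of "t * r"] by (simp add: poly_pcompose abs_mult)
  qed
  moreover have "pcompose (pcompose P [:0, r:]) [:0, 1 / r:] = P"
    using r by (simp add: pcompose_assoc[symmetric] pcompose_pCons pcompose_idR)
  ultimately show ?thesis by (simp add: \<pi>'_def)
qed

section \<open>Polynomials in one element of a Jordan algebra\<close>

locale jordan_product =
  fixes m :: "'a::real_vector \<Rightarrow> 'a \<Rightarrow> 'a" and e :: 'a
  assumes jordan: "jordan_algebra (type_algebra m e)"
begin

lemma m_comm: "m x y = m y x"
  using jordan_algebra.mult_comm[OF jordan, of x y] by (simp add: type_algebra_def)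

lemma m_add_left: "m (x + y) z = m x z + m y z"
  using jordan_algebra.mult_distrib[OF jordan, of x y z] by (simp add: type_algebra_def)

lemma m_add_right: "m z (x + y) = m z x + m z y"
  using m_add_left m_comm by metis

lemma m_scale_left: "m (c *\<^sub>R x) y = c *\<^sub>R m x y"
  using jordan_algebra.mult_smult[OF jordan, of x y c] by (simp add: type_algebra_def)

lemma m_scale_right: "m y (c *\<^sub>R x) = c *\<^sub>R m y x"
  using m_scale_left m_comm by metis

lemma m_e_left [simp]: "m e x = x"
  using jordan_algebra.mult_unit[OF jordan, of x] by (simp add: type_algebra_def)

lemma m_e_right [simp]: "m x e = x"
  using m_comm[of x e] by simp

lemma m_diff_left: "m (x - y) z = m x z - m y z"
  using m_add_left[of "x - y" y z] by (simp add: eq_diff_eq)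

lemma m_diff_right: "m z (x - y) = m z x - m z y"
  using m_diff_left m_comm by metis

lemma m_zero_left [simp]: "m 0 x = 0"
  using m_scale_left[of 0 0 x] by simp

lemma m_zero_right [simp]: "m x 0 = 0"
  using m_comm[of x 0] by simp

lemmas m_bilinear = m_add_left m_add_right m_diff_left m_diff_right m_scale_left m_scale_right

lemma jordan_id: "m (m x x) (m y x) = m (m (m x x) y) x"
  using jordan_algebra.jordan_identity[OF jordan, of x y] by (simp add: type_algebra_def)

text \<open>
  The part of the Jordan identity that is linear in \<open>z\<close> after replacing \<open>x\<close> by \<open>x \<plusminus> z\<close>.
\<close>

lemma jordan_linearized:
  "2 *\<^sub>R m x (m (m x z) y) + m z (m (m x x) y) = 2 *\<^sub>R m (m x z) (m x y) + m (m x x) (m z y)"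
proof -
  define lin where "lin = 2 *\<^sub>R m (m x z) (m y x) + m (m x x) (m y z)
    - 2 *\<^sub>R m (m (m x z) y) x - m (m (m x x) y) z"
  define J where "J v = m (m v v) (m y v) - m (m (m v v) y) v" for v
  have J: "J v = 0" for v by (simp add: J_def jordan_id)
  have "J (x + z) - J (x - z) - 2 *\<^sub>R J z = 2 *\<^sub>R lin"
    unfolding J_def lin_def m_bilinear m_comm[of z x]
    by (simp add: algebra_simps scaleR_2)
  then have "lin = 0" by (simp add: J)
  then show ?thesis
    unfolding lin_def m_comm[of "m (m x z) y" x] m_comm[of "m (m x x) y" z] m_comm[of y x] m_comm[of y z]
    by (simp add: algebra_simps)
qed

text \<open>
  Polarisation of \<open>jordan_linearized\<close>, which is quadratic in \<open>x\<close>.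
\<close>

lemma jordan_linearized_full:
  "m x (m (m d z) y) + m d (m (m x z) y) + m z (m (m x d) y)
    = m (m x z) (m d y) + m (m d z) (m x y) + m (m x d) (m z y)"
proof -
  define F where "F v = 2 *\<^sub>R m v (m (m v z) y) + m z (m (m v v) y)
    - (2 *\<^sub>R m (m v z) (m v y) + m (m v v) (m z y))" for v
  define lin where "lin = m x (m (m d z) y) + m d (m (m x z) y) + m z (m (m x d) y)
    - (m (m x z) (m d y) + m (m d z) (m x y) + m (m x d) (m z y))"
  have F: "F v = 0" for v by (simp add: F_def jordan_linearized)
  have "F (x + d) - F x - F d = 2 *\<^sub>R lin"
    unfolding F_def lin_def m_bilinear m_comm[of d x]
    by (simp add: algebra_simps scaleR_2)
  then have "lin = 0" by (simp add: F)
  then show ?thesis by (simp add: lin_def)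
qed

text \<open>
  The right side of \<open>jordan_linearized_full\<close> is symmetric in all four variables. Exchanging two of
  them on the left side expresses multiplication by \<open>x (x z)\<close> through the multiplications by \<open>x\<close>,
  \<open>z\<close>, \<open>x z\<close> and \<open>x\<^sup>2\<close>.
\<close>

lemma mult_by_x_x_z:
  "m (m x (m x z)) d = 2 *\<^sub>R m x (m (m x z) d) + m z (m (m x x) d) - m x (m x (m z d)) - m z (m x (m x d))"
proof -
  have "m (m x z) (m d x) + m (m d z) (m x x) + m (m x d) (m z x)
      = 2 *\<^sub>R m (m x z) (m x d) + m (m x x) (m z d)"
    unfolding m_comm[of d x] m_comm[of "m z d" "m x x"] m_comm[of d z] m_comm[of "m x d" "m z x"]
      m_comm[of z x] by (simp add: scaleR_2 m_comm)
  then have "2 *\<^sub>R m x (m (m x z) d) + m z (m (m x x) d)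
      = m x (m (m d z) x) + m d (m (m x z) x) + m z (m (m x d) x)"
    by (simp only: jordan_linearized[of x z d] jordan_linearized_full[of x d z x])
  then have "m d (m (m x z) x) = 2 *\<^sub>R m x (m (m x z) d) + m z (m (m x x) d)
      - m x (m (m d z) x) - m z (m (m x d) x)" by (simp add: algebra_simps)
  then show ?thesis
    by (simp only: m_comm[of "m x z" x] m_comm[of d "m x (m x z)"] m_comm[of d z]
        m_comm[of "m z d" x] m_comm[of "m x d" x])
qed

text \<open>
  Multiplication by \<open>x\<close> commutes with the multiplications by \<open>z\<close> and by \<open>x z\<close>. Asking for both makes
  the property stable under \<open>z \<mapsto> x z\<close>, so it holds for all polynomials in \<open>x\<close>; this is power
  associativity.
\<close>

definition op_commutes :: "'a \<Rightarrow> 'a \<Rightarrow> bool" where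
  "op_commutes x z \<longleftrightarrow> (\<forall>d. m z (m x d) = m x (m z d) \<and> m (m x z) (m x d) = m x (m (m x z) d))"

lemma op_commutes_e: "op_commutes x e"
  by (simp add: op_commutes_def)

lemma op_commutes_add: "op_commutes x z \<Longrightarrow> op_commutes x w \<Longrightarrow> op_commutes x (z + w)"
  by (simp add: op_commutes_def m_bilinear)

lemma op_commutes_scale: "op_commutes x z \<Longrightarrow> op_commutes x (c *\<^sub>R z)"
  by (simp add: op_commutes_def m_bilinear)

lemma op_commutes_mult:
  assumes "op_commutes x z"
  shows "op_commutes x (m x z)"
proof -
  have z: "m z (m x d) = m x (m z d)" "m (m x z) (m x d) = m x (m (m x z) d)" for d
    using assms by (auto simp: op_commutes_def)
  have xx: "m (m x x) (m x d) = m x (m (m x x) d)" for d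
    using jordan_id[of x d] by (simp only: m_comm[of d x] m_comm[of "m (m x x) d" x])
  have "m (m x (m x z)) (m x d) = m x (m (m x (m x z)) d)" for d
    unfolding mult_by_x_x_z by (simp add: m_bilinear z xx)
  then show ?thesis using z by (simp add: op_commutes_def)
qed

text \<open>
  Polynomial evaluation \<open>P(x)\<close> by Horner's scheme, with powers formed by left multiplication.
\<close>

definition pev :: "'a \<Rightarrow> real poly \<Rightarrow> 'a" where
  "pev x P = fold_coeffs (\<lambda>a b. a *\<^sub>R e + m x b) P 0"

lemma pev_0 [simp]: "pev x 0 = 0"
  by (simp add: pev_def)

lemma pev_pCons [simp]: "pev x (pCons a P) = a *\<^sub>R e + m x (pev x P)"
  by (cases "P = 0 \<and> a = 0") (auto simp: pev_def)

lemma pev_1 [simp]: "pev x 1 = e"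
  by (simp add: one_pCons)

lemma pev_add: "pev x (P + Q) = pev x P + pev x Q"
  by (induction P Q rule: poly_induct2) (auto simp: m_bilinear scaleR_add_left)

lemma pev_smult: "pev x (Polynomial.smult c P) = c *\<^sub>R pev x P"
  by (induction P) (auto simp: m_bilinear scaleR_add_right)

lemma pev_diff: "pev x (P - Q) = pev x P - pev x Q"
  using pev_add[of x "P - Q" Q] by (simp add: eq_diff_eq)

lemma op_commutes_pev: "op_commutes x (pev x P)"
proof (induction P)
  case 0
  show ?case using op_commutes_scale[OF op_commutes_e, of x 0] by simp
next
  case (pCons a P)
  then show ?case
    by (auto intro: op_commutes_add op_commutes_scale op_commutes_e op_commutes_mult)
qed

lemma pev_mult: "pev x (P * Q) = m (pev x P) (pev x Q)"
proof (induction Q)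
  case (pCons a Q)
  have "m (pev x P) (m x (pev x Q)) = m x (m (pev x P) (pev x Q))"
    using op_commutes_pev[of x P] by (simp add: op_commutes_def)
  then show ?case using pCons
    by (simp add: pev_add pev_smult m_bilinear)
qed simp

lemma pev_pcompose: "pev x (pcompose P Q) = pev (pev x Q) P"
  by (induction P) (auto simp: pcompose_pCons pev_add pev_mult)

lemma pev_power: "pev x (P ^ n) = pev (pev x P) ([:0, 1:] ^ n)"
  by (induction n) (simp_all only: power_0 power_Suc pev_mult pev_1 pev_pCons pev_0 m_zero_right
      m_e_right scaleR_one scaleR_zero_left add_0 add_0_right)

lemma pev_even_power: "pev x ([:0, 1:] ^ (2 * n)) = pev (m x x) ([:0, 1:] ^ n)"
proof -
  have "pev x ([:0, 1:] * [:0, 1:]) = m x x" by (simp add: pev_mult del: mult_pCons_left mult_pCons_right)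
  then show ?thesis
    using pev_power[of x "[:0, 1:] * [:0, 1:]" n] by (simp only: power_mult power2_eq_square)
qed

lemma pev_in_subalgebra: "jordan_subalgebra m e B \<Longrightarrow> x \<in> B \<Longrightarrow> pev x P \<in> B"
  by (induction P) (auto simp: jordan_subalgebra_def subspace_0 subspace_add subspace_scale)

end

section \<open>Seminorms on Jordan subalgebras\<close>

abbreviation subalg :: "('a \<Rightarrow> 'a \<Rightarrow> 'a) \<Rightarrow> 'a \<Rightarrow> 'a set \<Rightarrow> (real, 'a::real_vector) module" where
  "subalg m e B \<equiv> (type_algebra m e)\<lparr>carrier := B\<rparr>"

lemma subalg_UNIV: "subalg m e UNIV = type_algebra m e"
  by (simp add: type_algebra_def)

lemma real_ring_simps [simp]:
  "carrier real_ring = UNIV" "mult real_ring = (*)" "one real_ring = 1"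
  "zero real_ring = 0" "add real_ring = (+)"
  by (simp_all add: real_ring_def)

lemma (in jordan_product) cring_real_ring: "cring real_ring"
  using jordan by (simp add: jordan_algebra_def Module.module_def)

lemma (in jordan_product) jordan_subalg:
  assumes "jordan_subalgebra m e N"
  shows "jordan_algebra (subalg m e N)"
proof (intro jordan_algebra.intro jordan_algebra_axioms.intro moduleI cring_real_ring abelian_groupI)
  have N: "subspace N" "e \<in> N" "\<And>x y. x \<in> N \<Longrightarrow> y \<in> N \<Longrightarrow> m x y \<in> N"
    using assms by (auto simp: jordan_subalgebra_def)
  fix x y z :: 'a and a b :: real
  assume x: "x \<in> carrier (subalg m e N)"
  then have xN: "x \<in> N" by (simp add: type_algebra_def)
  show "\<exists>y\<in>carrier (subalg m e N). y \<oplus>\<^bsub>subalg m e N\<^esub> x = \<zero>\<^bsub>subalg m e N\<^esub>"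
    using N xN by (intro bexI[of _ "- x"]) (auto simp: type_algebra_def subspace_neg)
  assume y: "y \<in> carrier (subalg m e N)"
  show "x \<otimes>\<^bsub>subalg m e N\<^esub> y = y \<otimes>\<^bsub>subalg m e N\<^esub> x" by (simp add: type_algebra_def m_comm)
  show "x \<otimes>\<^bsub>subalg m e N\<^esub> x \<otimes>\<^bsub>subalg m e N\<^esub> (y \<otimes>\<^bsub>subalg m e N\<^esub> x)
      = x \<otimes>\<^bsub>subalg m e N\<^esub> x \<otimes>\<^bsub>subalg m e N\<^esub> y \<otimes>\<^bsub>subalg m e N\<^esub> x"
    by (simp add: type_algebra_def jordan_id)
qed (use assms in \<open>auto simp: type_algebra_def jordan_subalgebra_def subspace_add subspace_scale subspace_0
    m_bilinear scaleR_add_left scaleR_add_right add_ac\<close>)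

definition JB_seminorm_on :: "('a \<Rightarrow> 'a \<Rightarrow> 'a) \<Rightarrow> 'a \<Rightarrow> 'a set \<Rightarrow> ('a::real_vector \<Rightarrow> real) \<Rightarrow> bool" where
  "JB_seminorm_on m e B p \<longleftrightarrow> alg_seminorm (subalg m e B) p \<and> submultiplicative (subalg m e B) p
     \<and> fine_seminorm (subalg m e B) p \<and> regular_seminorm (subalg m e B) p"

lemma alg_seminorm_subalg:
  "alg_seminorm (subalg m e B) p \<longleftrightarrow> (\<forall>x\<in>B. 0 \<le> p x) \<and> (\<forall>x\<in>B. \<forall>y\<in>B. p (x + y) \<le> p x + p y)
    \<and> (\<forall>c. \<forall>x\<in>B. p (c *\<^sub>R x) = \<bar>c\<bar> * p x)"
  by (simp add: alg_seminorm_def type_algebra_def)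

lemma submultiplicative_subalg:
  "submultiplicative (subalg m e B) p \<longleftrightarrow> (\<forall>x\<in>B. \<forall>y\<in>B. p (m x y) \<le> p x * p y)"
  by (simp add: submultiplicative_def type_algebra_def)

lemma fine_subalg:
  "fine_seminorm (subalg m e B) p \<longleftrightarrow> (\<forall>x\<in>B. \<forall>y\<in>B. p (m x x) \<le> p (m x x + m y y))"
  by (simp add: fine_seminorm_def type_algebra_def)

lemma regular_subalg:
  "regular_seminorm (subalg m e B) p \<longleftrightarrow> (\<forall>x\<in>B. p (m x x) = (p x)\<^sup>2)"
  by (simp add: regular_seminorm_def type_algebra_def)

lemmas subalg_simps = alg_seminorm_subalg submultiplicative_subalg fine_subalg regular_subalg

locale submult_seminorm = jordan_product m e for m :: "'a::real_vector \<Rightarrow> 'a \<Rightarrow> 'a" and e +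
  fixes B :: "'a set" and q :: "'a \<Rightarrow> real"
  assumes subalgebra: "jordan_subalgebra m e B"
    and seminorm: "alg_seminorm (subalg m e B) q"
    and submultiplicative: "submultiplicative (subalg m e B) q"
begin

lemma B_add: "x \<in> B \<Longrightarrow> y \<in> B \<Longrightarrow> x + y \<in> B"
  and B_diff: "x \<in> B \<Longrightarrow> y \<in> B \<Longrightarrow> x - y \<in> B"
  and B_scale: "x \<in> B \<Longrightarrow> c *\<^sub>R x \<in> B"
  and B_zero: "0 \<in> B"
  and B_e: "e \<in> B"
  and B_mult: "x \<in> B \<Longrightarrow> y \<in> B \<Longrightarrow> m x y \<in> B"
  using subalgebra
  by (auto simp: jordan_subalgebra_def subspace_add subspace_diff subspace_scale subspace_0)

lemma B_pev: "x \<in> B \<Longrightarrow> pev x P \<in> B"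
  by (rule pev_in_subalgebra[OF subalgebra])

lemmas B_closed = B_add B_diff B_scale B_zero B_e B_mult B_pev

lemma q_nonneg: "x \<in> B \<Longrightarrow> 0 \<le> q x"
  and q_add: "x \<in> B \<Longrightarrow> y \<in> B \<Longrightarrow> q (x + y) \<le> q x + q y"
  and q_scale: "x \<in> B \<Longrightarrow> q (c *\<^sub>R x) = \<bar>c\<bar> * q x"
  using seminorm by (auto simp: alg_seminorm_subalg)

lemma q_mult: "x \<in> B \<Longrightarrow> y \<in> B \<Longrightarrow> q (m x y) \<le> q x * q y"
  using submultiplicative by (auto simp: submultiplicative_subalg)

lemma q_zero: "q 0 = 0"
  using q_scale[OF B_zero, of 0] by simp

lemma q_minus: "x \<in> B \<Longrightarrow> q (- x) = q x"
  using q_scale[of x "-1"] by simp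

lemma q_sym: "x \<in> B \<Longrightarrow> y \<in> B \<Longrightarrow> q (x - y) = q (y - x)"
  using q_minus[OF B_diff, of x y] by simp

lemma q_diff: "x \<in> B \<Longrightarrow> y \<in> B \<Longrightarrow> q (x - y) \<le> q x + q y"
  using q_add[of x "- y"] q_minus[of y] B_scale[of y "-1"] by simp

lemma q_dist: "x \<in> B \<Longrightarrow> y \<in> B \<Longrightarrow> z \<in> B \<Longrightarrow> q (x - z) \<le> q (x - y) + q (y - z)"
  using q_add[of "x - y" "y - z"] by (simp add: B_diff)

lemma q_le_dist: "x \<in> B \<Longrightarrow> y \<in> B \<Longrightarrow> q x \<le> q y + q (x - y)"
  using q_add[of y "x - y"] by (simp add: B_diff)

lemma q_eq: "x \<in> B \<Longrightarrow> y \<in> B \<Longrightarrow> q (x - y) = 0 \<Longrightarrow> q x = q y"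
  using q_le_dist[of x y] q_le_dist[of y x] q_sym[of x y] by simp

text \<open>
  The kernel of a submultiplicative seminorm is an ideal, so congruence modulo the kernel is
  compatible with products and with polynomial evaluation.
\<close>

lemma q_cong_mult:
  assumes "a \<in> B" "b \<in> B" "c \<in> B" "d \<in> B" "q (a - b) = 0" "q (c - d) = 0"
  shows "q (m a c - m b d) = 0"
proof -
  have "m a c - m b d = m (a - b) c + m b (c - d)" by (simp add: m_bilinear)
  then have "q (m a c - m b d) \<le> q (a - b) * q c + q b * q (c - d)"
    using q_add[of "m (a - b) c" "m b (c - d)"] q_mult[of "a - b" c] q_mult[of b "c - d"] assms
    by (simp add: B_closed)
  then show ?thesis using assms q_nonneg[of "m a c - m b d"] by (simp add: B_closed)
qed

lemma q_cong_pev: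
  assumes "a \<in> B" "b \<in> B" "q (a - b) = 0"
  shows "q (pev a P - pev b P) = 0"
proof (induction P)
  case (pCons c P)
  then show ?case using q_cong_mult[of a b "pev a P" "pev b P"] assms by (simp add: B_closed)
qed (simp add: q_zero)

lemma q_pev_power: "x \<in> B \<Longrightarrow> q (pev x ([:0, 1:] ^ Suc n)) \<le> q x ^ Suc n"
proof (induction n)
  case (Suc n)
  have "q (pev x ([:0, 1:] ^ Suc (Suc n))) = q (m x (pev x ([:0, 1:] ^ Suc n)))"
    by (subst power_Suc) (simp only: pev_mult pev_pCons pev_0 m_zero_right m_e_right scaleR_one add_0 scaleR_zero_left add_0_right)
  also have "\<dots> \<le> q x * q (pev x ([:0, 1:] ^ Suc n))"
    using Suc.prems by (intro q_mult B_closed)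
  also have "\<dots> \<le> q x * q x ^ Suc n"
    using Suc q_nonneg by (intro mult_left_mono) auto
  finally show ?case by simp
qed simp

end

locale JB_seminorm = jordan_product m e for m :: "'a::real_vector \<Rightarrow> 'a \<Rightarrow> 'a" and e +
  fixes B :: "'a set" and p :: "'a \<Rightarrow> real"
  assumes JB_subalgebra: "jordan_subalgebra m e B"
    and JB: "JB_seminorm_on m e B p"
begin

sublocale submult_seminorm m e B p
  using JB_subalgebra JB by unfold_locales (auto simp: JB_seminorm_on_def)

lemma square: "x \<in> B \<Longrightarrow> p (m x x) = (p x)\<^sup>2"
  using JB by (auto simp: JB_seminorm_on_def subalg_simps)

lemma fine: "x \<in> B \<Longrightarrow> y \<in> B \<Longrightarrow> p (m x x) \<le> p (m x x + m y y)"
  using JB by (auto simp: JB_seminorm_on_def subalg_simps)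

lemma fine_poly_seminorm_pev:
  assumes x: "x \<in> B"
  shows "fine_poly_seminorm (\<lambda>P. p (pev x P))"
proof unfold_locales
  show "p (pev x (P * P)) \<le> p (pev x (P * P + Q * Q))" for P Q
    using fine[OF B_pev[OF x] B_pev[OF x]] by (simp add: pev_add pev_mult)
qed (auto simp: pev_add pev_smult pev_mult q_scale square B_pev[OF x]
    intro!: q_nonneg q_add q_mult)

lemma pev_le:
  assumes "x \<in> B" "p x < r" "\<And>t. \<bar>t\<bar> \<le> r \<Longrightarrow> \<bar>poly P t\<bar> \<le> S"
  shows "p (pev x P) \<le> S"
  using fine_poly_seminorm_le_sup[OF fine_poly_seminorm_pev[OF assms(1)], of r P S] assms by simp

lemma p_e: "p e \<le> 1"
proof -
  have "p e * (p e - 1) = 0" using square[OF B_e] by (simp add: power2_eq_square algebra_simps)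
  then show ?thesis by auto
qed

end

section \<open>Continuous functional calculus\<close>

lemma weierstrass_poly:
  fixes f :: "real \<Rightarrow> real"
  assumes f: "continuous_on UNIV f" and \<epsilon>: "0 < \<epsilon>"
  shows "\<exists>P. \<forall>t. \<bar>t\<bar> \<le> r \<longrightarrow> \<bar>f t - poly P t\<bar> \<le> \<epsilon>"
proof -
  obtain g where g: "real_polynomial_function g" "\<And>t. t \<in> cball 0 r \<Longrightarrow> \<bar>f t - g t\<bar> < \<epsilon>"
    using Stone_Weierstrass_real_polynomial_function[of "cball 0 r" f \<epsilon>]
      continuous_on_subset[OF f, of "cball 0 r"] \<epsilon> by auto
  then obtain a n where "g = (\<lambda>x. \<Sum>i\<le>n. a i * x ^ i)"
    by (auto simp: real_polynomial_function_iff_sum)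
  then have "g t = poly (\<Sum>i\<le>n. monom (a i) i) t" for t
    by (simp add: poly_sum poly_monom)
  then show ?thesis using g(2) by (intro exI[of _ "\<Sum>i\<le>n. monom (a i) i"]) force
qed

definition clamp_real :: "real \<Rightarrow> real \<Rightarrow> real" where
  "clamp_real s t = max (- s) (min s t)"

lemma continuous_clamp_real: "continuous_on UNIV (clamp_real s)"
  unfolding clamp_real_def by (intro continuous_intros)

locale complete_JB_family = jordan_product m e for m :: "'a::real_vector \<Rightarrow> 'a \<Rightarrow> 'a" and e +
  fixes B :: "'a set" and \<Gamma> :: "('a \<Rightarrow> real) set"
  assumes subalgebra: "jordan_subalgebra m e B"
    and JB: "p \<in> \<Gamma> \<Longrightarrow> JB_seminorm_on m e B p"
    and complete: "\<lbrakk>\<And>n::nat. X n \<in> B;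
        \<And>p \<epsilon>. \<lbrakk>p \<in> \<Gamma>; 0 < \<epsilon>\<rbrakk> \<Longrightarrow> \<exists>N. \<forall>i\<ge>N. \<forall>j\<ge>N. p (X i - X j) < \<epsilon>\<rbrakk>
      \<Longrightarrow> \<exists>x\<in>B. \<forall>p\<in>\<Gamma>. (\<lambda>n. p (X n - x)) \<longlonglongrightarrow> 0"
begin

lemma JB_seminorm: "p \<in> \<Gamma> \<Longrightarrow> JB_seminorm m e B p"
  by unfold_locales (use subalgebra JB in auto)

text \<open>
  \<open>y\<close> is a value of \<open>f\<close> at \<open>x\<close>: every polynomial that is close to \<open>f\<close> on \<open>[-r, r]\<close> has a value at \<open>x\<close>
  that is as close to \<open>y\<close>. This determines \<open>y\<close> only modulo the common kernel of the seminorms, hence a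
  relation and not a function.
\<close>

definition fcalc :: "(real \<Rightarrow> real) \<Rightarrow> 'a \<Rightarrow> 'a \<Rightarrow> bool" where
  "fcalc f x y \<longleftrightarrow> y \<in> B \<and> (\<forall>p\<in>\<Gamma>. \<forall>r>p x. \<forall>P S.
     (\<forall>t. \<bar>t\<bar> \<le> r \<longrightarrow> \<bar>f t - poly P t\<bar> \<le> S) \<longrightarrow> p (y - pev x P) \<le> S)"

lemma fcalcD:
  assumes "fcalc f x y" "p \<in> \<Gamma>" "p x < r" "\<And>t. \<bar>t\<bar> \<le> r \<Longrightarrow> \<bar>f t - poly P t\<bar> \<le> S"
  shows "p (y - pev x P) \<le> S"
  using assms unfolding fcalc_def by blast

lemma fcalc_bound:
  assumes "fcalc f x y" "p \<in> \<Gamma>" "p x < r" "\<And>t. \<bar>t\<bar> \<le> r \<Longrightarrow> \<bar>f t\<bar> \<le> S"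
  shows "p y \<le> S"
  using fcalcD[OF assms(1-3), of 0 S] assms(4) by simp

text \<open>
  Polynomials \<open>P k\<close> that approximate \<open>f\<close> within \<open>1 / (k + 1)\<close> on \<open>[-k, k]\<close> serve all seminorms at once:
  for each \<open>p\<close>, the interval eventually contains \<open>[-r, r]\<close> with \<open>r > p x\<close>.
\<close>

lemma fcalc_ex:
  assumes f: "continuous_on UNIV f" and x: "x \<in> B"
  shows "\<exists>y. fcalc f x y"
proof -
  have "\<exists>P. \<forall>t. \<bar>t\<bar> \<le> real k \<longrightarrow> \<bar>f t - poly P t\<bar> \<le> 1 / Suc k" for k
    by (rule weierstrass_poly[OF f]) simp
  then obtain P where P: "\<And>k t. \<bar>t\<bar> \<le> real k \<Longrightarrow> \<bar>f t - poly (P k) t\<bar> \<le> 1 / Suc k" by metis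
  have close: "p (pev x (P k) - pev x Q) \<le> S + 1 / Suc k"
    if p: "p \<in> \<Gamma>" "p x < r" and Q: "\<And>t. \<bar>t\<bar> \<le> r \<Longrightarrow> \<bar>f t - poly Q t\<bar> \<le> S" and k: "r \<le> real k"
    for p r Q S k
  proof -
    interpret JB_seminorm m e B p using JB_seminorm p by blast
    show ?thesis unfolding pev_diff[symmetric]
    proof (rule pev_le[OF x p(2)])
      fix t :: real assume t: "\<bar>t\<bar> \<le> r"
      then show "\<bar>poly (P k - Q) t\<bar> \<le> S + 1 / Suc k"
        using Q[OF t] P[of t k] k by (simp only: poly_diff) linarith
    qed
  qed
  have "\<exists>y\<in>B. \<forall>p\<in>\<Gamma>. (\<lambda>k. p (pev x (P k) - y)) \<longlonglongrightarrow> 0"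
  proof (rule complete)
    fix p and \<epsilon> :: real assume p: "p \<in> \<Gamma>" and \<epsilon>: "0 < \<epsilon>"
    obtain n :: nat where n: "p x + 1 \<le> real n" "2 / \<epsilon> < real n"
      using real_arch_simple[of "max (p x + 1) (2 / \<epsilon> + 1)"] by auto
    have "p (pev x (P i) - pev x (P j)) < \<epsilon>" if ij: "n \<le> i" "n \<le> j" for i j
    proof -
      have inv: "1 / Suc k < \<epsilon> / 2" if "n \<le> k" for k
      proof -
        have "2 / \<epsilon> < real (Suc k)" using n that by linarith
        then show ?thesis using \<epsilon> by (simp add: field_simps)
      qed
      have "p (pev x (P i) - pev x (P j)) \<le> 1 / Suc j + 1 / Suc i"
      proof (rule close[OF p])
        show "p x < p x + 1" by simp
        show "p x + 1 \<le> real i" using n ij by linarith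
        show "\<bar>f t - poly (P j) t\<bar> \<le> 1 / Suc j" if "\<bar>t\<bar> \<le> p x + 1" for t
          by (rule P) (use that n ij in linarith)
      qed
      then show ?thesis using inv[OF ij(1)] inv[OF ij(2)] by linarith
    qed
    then show "\<exists>N. \<forall>i\<ge>N. \<forall>j\<ge>N. p (pev x (P i) - pev x (P j)) < \<epsilon>" by blast
  next
    fix n
    show "pev x (P n) \<in> B" using x by (rule pev_in_subalgebra[OF subalgebra])
  qed
  then obtain y where y: "y \<in> B" "\<And>p. p \<in> \<Gamma> \<Longrightarrow> (\<lambda>k. p (pev x (P k) - y)) \<longlonglongrightarrow> 0" by blast
  have "fcalc f x y" unfolding fcalc_def
  proof (intro conjI ballI allI impI y(1))
    fix p r Q S
    assume p: "p \<in> \<Gamma>" "p x < r" and Q: "\<forall>t. \<bar>t\<bar> \<le> r \<longrightarrow> \<bar>f t - poly Q t\<bar> \<le> S"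
    interpret JB_seminorm m e B p using JB_seminorm p by blast
    have "\<forall>\<^sub>F k in sequentially. p (y - pev x Q) \<le> p (pev x (P k) - y) + (S + 1 / Suc k)"
    proof (rule eventually_sequentiallyI)
      fix k assume "nat \<lceil>r\<rceil> \<le> k"
      then have "r \<le> real k" by linarith
      then show "p (y - pev x Q) \<le> p (pev x (P k) - y) + (S + 1 / Suc k)"
        using close[OF p Q[rule_format]] q_dist[OF y(1) B_pev[OF x, of "P k"] B_pev[OF x, of Q]]
          q_sym[OF y(1) B_pev[OF x], of "P k"] by force
    qed
    moreover have "(\<lambda>k. p (pev x (P k) - y) + (S + 1 / Suc k)) \<longlonglongrightarrow> 0 + (S + 0)"
      by (intro tendsto_add y(2) p tendsto_const LIMSEQ_Suc[OF lim_1_over_n])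
    ultimately show "p (y - pev x Q) \<le> S"
      by (intro tendsto_lowerbound[where f = "\<lambda>k. p (pev x (P k) - y) + (S + 1 / Suc k)" and F = sequentially]) auto
  qed
  then show ?thesis ..
qed

lemma fcalc_in: "fcalc f x y \<Longrightarrow> y \<in> B"
  by (simp add: fcalc_def)

lemma clamp_bound:
  assumes "fcalc (clamp_real s) x y" "0 \<le> s" "p \<in> \<Gamma>"
  shows "p y \<le> s"
  by (rule fcalc_bound[OF assms(1,3), of "p x + 1"]) (use assms(2) in \<open>auto simp: clamp_real_def\<close>)

text \<open>
  The function \<open>t - clamp_real s t\<close> vanishes on \<open>[-s, s]\<close>, so it is \<open>t ^ (2 n)\<close> times a continuous
  function of size \<open>O(s ^ (-2 n))\<close>. The exponent is even in order that \<open>t ^ (2 n) = \<bar>t\<bar> ^ (2 n)\<close>.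
\<close>

lemma clamp_factor:
  assumes y: "fcalc (clamp_real s) x y" and s: "0 < s" and x: "x \<in> B" and p: "p \<in> \<Gamma>"
  shows "\<exists>z\<in>B. p z \<le> (p x + s + 1) / s ^ (2 * n)
    \<and> p (x - y - m (pev x ([:0, 1:] ^ (2 * n))) z) = 0"
proof -
  interpret JB_seminorm m e B p using JB_seminorm p by blast
  define R where "R = p x + s + 1"
  have R: "p x < R" "s \<le> R" "0 < R" using s q_nonneg[OF x] by (auto simp: R_def)
  define g where "g t = (t - clamp_real s t) / (max \<bar>t\<bar> s) ^ (2 * n)" for t
  have "max \<bar>t\<bar> s ^ (2 * n) \<noteq> 0" for t using s by auto
  then have "continuous_on UNIV g" unfolding g_def
    by (intro continuous_intros continuous_clamp_real) auto
  then obtain z where z: "fcalc g x z" using fcalc_ex[OF _ x] by blast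
  have zB: "z \<in> B" and yB: "y \<in> B" using fcalc_in z y by auto
  have "p z \<le> R / s ^ (2 * n)"
  proof (rule fcalc_bound[OF z p R(1)])
    fix t assume t: "\<bar>t\<bar> \<le> R"
    have "\<bar>t - clamp_real s t\<bar> \<le> R" using t R s by (auto simp: clamp_real_def)
    moreover have "s ^ (2 * n) \<le> (max \<bar>t\<bar> s) ^ (2 * n)" using s by (intro power_mono) auto
    ultimately show "\<bar>g t\<bar> \<le> R / s ^ (2 * n)"
      unfolding g_def abs_divide using s by (intro frac_le) auto
  qed
  moreover have gt: "t ^ (2 * n) * g t = t - clamp_real s t" for t
  proof (cases "\<bar>t\<bar> < s")
    case True
    then show ?thesis by (auto simp: g_def clamp_real_def)
  next
    case False
    then have "max \<bar>t\<bar> s ^ (2 * n) = t ^ (2 * n)" "t \<noteq> 0" using s by (auto simp: power_even_abs max_def)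
    then show ?thesis by (simp add: g_def)
  qed
  let ?x = "pev x ([:0, 1:] ^ (2 * n))"
  have xB: "?x \<in> B" using x by (rule B_pev)
  have "p (x - y - m ?x z) \<le> 0 + \<delta>" if \<delta>: "0 < \<delta>" for \<delta>
  proof -
    define \<epsilon> where "\<epsilon> = \<delta> / (R ^ (2 * n) + p ?x + 1)"
    have den: "0 < R ^ (2 * n) + p ?x + 1" using R q_nonneg[OF xB] by (simp add: add_nonneg_pos)
    then have \<epsilon>: "0 < \<epsilon>" using \<delta> by (simp add: \<epsilon>_def)
    obtain P where P: "\<And>t. \<bar>t\<bar> \<le> R \<Longrightarrow> \<bar>g t - poly P t\<bar> \<le> \<epsilon>"
      using weierstrass_poly[OF \<open>continuous_on UNIV g\<close> \<epsilon>] by blast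
    let ?W = "[:0, 1:] - [:0, 1:] ^ (2 * n) * P"
    have 1: "p (z - pev x P) \<le> \<epsilon>" by (rule fcalcD[OF z p R(1) P])
    have 2: "p (y - pev x ?W) \<le> R ^ (2 * n) * \<epsilon>"
    proof (rule fcalcD[OF y p R(1)])
      fix t assume t: "\<bar>t\<bar> \<le> R"
      have "clamp_real s t - poly ?W t = - (t ^ (2 * n) * (g t - poly P t))"
        using gt[of t] by (simp add: algebra_simps poly_power)
      then have "\<bar>clamp_real s t - poly ?W t\<bar>
          = \<bar>t\<bar> ^ (2 * n) * \<bar>g t - poly P t\<bar>" by (simp add: abs_mult power_abs)
      also have "\<dots> \<le> R ^ (2 * n) * \<epsilon>" using t P R by (intro mult_mono power_mono) auto
      finally show "\<bar>clamp_real s t - poly ?W t\<bar> \<le> R ^ (2 * n) * \<epsilon>" .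
    qed
    have eq: "x - y - m ?x z
        = (pev x ?W - y) - m ?x (z - pev x P)"
      by (simp add: pev_diff pev_mult m_bilinear)
    have PB: "pev x ?W \<in> B" "z - pev x P \<in> B"
      using x zB by (auto intro!: B_closed)
    have "p (x - y - m ?x z)
        \<le> p (y - pev x ?W) + p ?x * p (z - pev x P)"
      unfolding eq using q_diff[OF B_diff[OF PB(1) yB] B_mult[OF xB PB(2)]]
        q_sym[OF PB(1) yB] q_mult[OF xB PB(2)] by linarith
    also have "\<dots> \<le> R ^ (2 * n) * \<epsilon> + p ?x * \<epsilon>"
      using 1 2 q_nonneg[OF xB] by (intro add_mono mult_left_mono) auto
    also have "\<dots> \<le> (R ^ (2 * n) + p ?x + 1) * \<epsilon>" using \<epsilon> by (simp add: algebra_simps)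
    also have "\<dots> = \<delta>" using den by (simp add: \<epsilon>_def)
    finally show ?thesis by simp
  qed
  then have "p (x - y - m ?x z) \<le> 0" by (rule field_le_epsilon)
  then have "p (x - y - m ?x z) = 0"
    using q_nonneg[of "x - y - m ?x z"] by (simp add: B_closed x yB zB)
  ultimately show ?thesis using zB by (auto simp: R_def)
qed

text \<open>
  By the factorisation, \<open>q (x - y)\<close> is at most a constant times \<open>(r / s) ^ (2 n)\<close> for infinitely many \<open>n\<close>.
\<close>

lemma clamp_eq_of_spectral_radius:
  assumes y: "fcalc (clamp_real s) x y" and s: "0 < s" and x: "x \<in> B" and p: "p \<in> \<Gamma>"
    and q: "submult_seminorm m e B q" and C: "0 \<le> C" "\<And>z. z \<in> B \<Longrightarrow> q z \<le> C * p z"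
    and r: "0 \<le> r" "r < s"
    and K: "\<And>N. \<exists>n\<ge>N. q (pev x ([:0, 1:] ^ (2 * n))) \<le> K * r ^ (2 * n)"
  shows "q (x - y) = 0"
proof -
  interpret p: JB_seminorm m e B p using JB_seminorm p by blast
  interpret q: submult_seminorm m e B q by fact
  have yB: "y \<in> B" using fcalc_in y by auto
  define R where "R = p x + s + 1"
  have R: "0 \<le> R" using s p.q_nonneg[OF x] by (simp add: R_def)
  have bound: "\<exists>n\<ge>N. q (x - y) \<le> (K * C * R) * (r / s) ^ (2 * n)" for N
  proof -
    obtain n where n: "n \<ge> N" "q (pev x ([:0, 1:] ^ (2 * n))) \<le> K * r ^ (2 * n)" using K by blast
    let ?x = "pev x ([:0, 1:] ^ (2 * n))"
    have xB: "?x \<in> B" using x by (rule q.B_pev)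
    obtain z where z: "z \<in> B" "p z \<le> R / s ^ (2 * n)" "p (x - y - m ?x z) = 0"
      using clamp_factor[OF y s x p, of n] unfolding R_def by blast
    have "q (x - y - m ?x z) = 0"
      using C(2)[of "x - y - m ?x z"] z q.q_nonneg[of "x - y - m ?x z"] by (simp add: q.B_closed x yB)
    then have "q (x - y) = q (m ?x z)" by (intro q.q_eq) (auto intro!: q.B_closed x yB z)
    also have "\<dots> \<le> q ?x * q z" using z xB by (intro q.q_mult)
    also have "\<dots> \<le> (K * r ^ (2 * n)) * (C * (R / s ^ (2 * n)))"
    proof (rule mult_mono[OF n(2)])
      show "q z \<le> C * (R / s ^ (2 * n))"
        using C(2)[OF z(1)] mult_left_mono[OF z(2) C(1)] by linarith
      show "0 \<le> K * r ^ (2 * n)" using n(2) q.q_nonneg[OF xB] by linarith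
    qed (rule q.q_nonneg[OF z(1)])
    also have "\<dots> = (K * C * R) * (r / s) ^ (2 * n)" by (simp add: power_divide)
    finally show ?thesis using n(1) by blast
  qed
  have "norm (r / s) < 1" using r s by auto
  then have "norm ((r / s)\<^sup>2) < 1" by (simp add: abs_square_less_1)
  then have "(\<lambda>n. (K * C * R) * ((r / s)\<^sup>2) ^ n) \<longlonglongrightarrow> (K * C * R) * 0"
    by (intro tendsto_mult tendsto_const LIMSEQ_power_zero)
  then have lim: "(\<lambda>n. (K * C * R) * (r / s) ^ (2 * n)) \<longlonglongrightarrow> 0" by (simp add: power_mult)
  have "\<not> 0 < q (x - y)"
  proof
    assume "0 < q (x - y)"
    from order_tendstoD(2)[OF lim this] obtain N
      where N: "\<And>n. n \<ge> N \<Longrightarrow> (K * C * R) * (r / s) ^ (2 * n) < q (x - y)"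
      by (auto simp: eventually_sequentially)
    from bound[of N] obtain n where "n \<ge> N" "q (x - y) \<le> (K * C * R) * (r / s) ^ (2 * n)" by blast
    with N[of n] show False by simp
  qed
  then show ?thesis using q.q_nonneg[OF q.B_diff[OF x yB]] by simp
qed

lemma clamp_eq:
  assumes y: "fcalc (clamp_real s) x y" and s: "0 < s" and x: "x \<in> B" and p: "p \<in> \<Gamma>"
    and q: "submult_seminorm m e B q" and C: "0 \<le> C" "\<And>z. z \<in> B \<Longrightarrow> q z \<le> C * p z"
    and r: "q x < s"
  shows "q (x - y) = 0"
proof (rule clamp_eq_of_spectral_radius[OF y s x p q C _ r, where K = 1])
  interpret q: submult_seminorm m e B q by fact
  show "0 \<le> q x" by (rule q.q_nonneg[OF x])
  have "q (pev x ([:0, 1:] ^ (2 * Suc N))) \<le> 1 * q x ^ (2 * Suc N)" for N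
    using q.q_pev_power[OF x, of "Suc (2 * N)"] by (simp del: power_Suc)
  then show "\<exists>n\<ge>N. q (pev x ([:0, 1:] ^ (2 * n))) \<le> 1 * q x ^ (2 * n)" for N
    by (meson le_SucI order_refl)
qed

lemma clamp_ex:
  assumes x: "x \<in> B" and s: "0 < s"
  shows "\<exists>y\<in>B. (\<forall>p\<in>\<Gamma>. p y \<le> s) \<and> (\<forall>p\<in>\<Gamma>. p x < s \<longrightarrow> p (x - y) = 0)"
proof -
  obtain y where y: "fcalc (clamp_real s) x y" using fcalc_ex[OF continuous_clamp_real x] by blast
  have "p (x - y) = 0" if p: "p \<in> \<Gamma>" "p x < s" for p
  proof -
    interpret p: JB_seminorm m e B p using JB_seminorm p by blast
    show ?thesis
      by (rule clamp_eq[OF y s x p(1) p.submult_seminorm_axioms, where C = 1]) (use p in auto)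
  qed
  then show ?thesis using fcalc_in[OF y] clamp_bound[OF y] s by (intro bexI[of _ y]) auto
qed

text \<open>
  On \<open>u = c + t\<^sup>2 \<ge> c\<close>, the values of \<open>clamp_real s u - c\<close> lie in \<open>[0, s - c]\<close>. Without the square the bound
  would be \<open>s + c\<close>; this is where positivity enters the proof of fineness below.
\<close>

lemma clamp_shifted_square:
  assumes y: "fcalc (clamp_real s) (c *\<^sub>R e + m x x) y" and c: "0 \<le> c" "c \<le> s"
    and x: "x \<in> B" and p: "p \<in> \<Gamma>"
  shows "p (y - c *\<^sub>R e) \<le> s - c"
proof -
  interpret JB_seminorm m e B p using JB_seminorm p by blast
  define G :: "real poly" where "G = [:c, 0, 1:]"
  define b where "b = c *\<^sub>R e + m x x"
  have b: "b = pev x G" by (simp add: b_def G_def)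
  have bB: "b \<in> B" using x by (simp add: b_def B_closed)
  \<comment> \<open>\<open>[-R, R]\<close> contains the values of \<open>G\<close> on \<open>[-r, r]\<close>.\<close>
  define r R where "r = p x + 1" and "R = p b + c + r\<^sup>2 + 1"
  have "0 \<le> r\<^sup>2" by simp
  then have R: "p b < R" "c + r\<^sup>2 \<le> R"
    unfolding R_def using c q_nonneg[OF bB] by linarith+
  have yB: "y \<in> B" using fcalc_in y by auto
  have "p (y - c *\<^sub>R e) \<le> (s - c) + \<delta>" if \<delta>: "0 < \<delta>" for \<delta>
  proof -
    obtain P where P: "\<And>t. \<bar>t\<bar> \<le> R \<Longrightarrow> \<bar>clamp_real s t - poly P t\<bar> \<le> \<delta> / 2"
      using weierstrass_poly[OF continuous_clamp_real, of "\<delta> / 2"] \<delta> by (metis half_gt_zero)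
    have 1: "p (y - pev b P) \<le> \<delta> / 2"
      by (rule fcalcD[OF y[folded b_def] p R(1) P])
    have 2: "p (pev x (pcompose P G - [:c:])) \<le> s - c + \<delta> / 2"
    proof (rule pev_le[OF x])
      show "p x < r" by (simp add: r_def)
      fix t assume "\<bar>t\<bar> \<le> r"
      then have "t\<^sup>2 \<le> r\<^sup>2" using abs_le_square_iff[of t r] by linarith
      then have t: "c + t\<^sup>2 \<le> R" using R by linarith
      have G: "poly G t = c + t\<^sup>2" by (simp add: G_def power2_eq_square)
      have t0: "0 \<le> t\<^sup>2" by simp
      have "\<bar>clamp_real s (c + t\<^sup>2) - c\<bar> \<le> s - c"
      proof -
        have "\<bar>clamp_real s u - c\<bar> \<le> s - c" if "c \<le> u" for u
          using c that by (auto simp: clamp_real_def)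
        then show ?thesis using t0 by simp
      qed
      moreover have "\<bar>clamp_real s (c + t\<^sup>2) - poly P (c + t\<^sup>2)\<bar> \<le> \<delta> / 2"
        using c t0 t by (intro P) auto
      ultimately show "\<bar>poly (pcompose P G - [:c:]) t\<bar> \<le> s - c + \<delta> / 2"
        unfolding poly_diff poly_pcompose G by (simp only: poly_pCons poly_0)
    qed
    have "p (y - c *\<^sub>R e) \<le> p (y - pev b P) + p (pev b P - c *\<^sub>R e)"
      by (intro q_dist) (auto intro!: B_closed yB bB)
    also have "pev b P - c *\<^sub>R e = pev x (pcompose P G - [:c:])"
      by (simp add: pev_diff pev_pcompose b)
    finally show ?thesis using 1 2 by linarith
  qed
  then show ?thesis by (rule field_le_epsilon)
qed

end

section \<open>A fine regular seminorm equivalent to a given one\<close>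

lemma le_mult_of_le_mult_greater:
  fixes a b u :: real
  assumes "\<And>s t. \<lbrakk>a < s; b < t\<rbrakk> \<Longrightarrow> u \<le> s * t"
  shows "u \<le> a * b"
proof (rule LIMSEQ_le_const)
  have "(\<lambda>n. (a + 1 / Suc n) * (b + 1 / Suc n)) \<longlonglongrightarrow> (a + 0) * (b + 0)"
    by (intro tendsto_mult tendsto_add tendsto_const LIMSEQ_Suc[OF lim_1_over_n])
  then show "(\<lambda>n. (a + 1 / Suc n) * (b + 1 / Suc n)) \<longlonglongrightarrow> a * b" by simp
  show "\<exists>N. \<forall>n\<ge>N. u \<le> (a + 1 / Suc n) * (b + 1 / Suc n)"
    by (intro exI allI impI assms) auto
qed

locale dense_JB = jordan_product m e for m :: "'a::real_vector \<Rightarrow> 'a \<Rightarrow> 'a" and e +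
  fixes N :: "'a set" and nrm q :: "'a \<Rightarrow> real" and C :: real
  assumes complete_N: "complete_JB_family m e N {nrm}"
    and q_submult: "submult_seminorm m e UNIV q"
    and C: "0 \<le> C" "x \<in> N \<Longrightarrow> q x \<le> C * nrm x"
    and dense: "0 < \<epsilon> \<Longrightarrow> \<exists>z\<in>N. q (x - z) < \<epsilon>"
begin

sublocale N: complete_JB_family m e N "{nrm}" by (rule complete_N)
sublocale n: JB_seminorm m e N nrm using N.JB_seminorm by blast
sublocale q: submult_seminorm m e UNIV q by (rule q_submult)

lemma qN: "submult_seminorm m e N q"
  using n.subalgebra q.seminorm q.submultiplicative
  by unfold_locales (auto simp: subalg_simps)

text \<open>
  The largest seminorm that is at most \<open>q\<close> on the whole algebra and at most \<open>nrm\<close> on \<open>N\<close>. Writing it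
  as an infimal convolution defines it on the whole algebra at once, instead of extending it from \<open>N\<close>
  by continuity.
\<close>

definition hat :: "'a \<Rightarrow> real" where
  "hat x = (INF z\<in>N. nrm z + q (x - z))"

lemma hat_le: "z \<in> N \<Longrightarrow> hat x \<le> nrm z + q (x - z)"
  unfolding hat_def
  by (rule cINF_lower) (auto intro!: bdd_belowI[of _ 0] add_nonneg_nonneg n.q_nonneg q.q_nonneg)

lemma hat_ge: "(\<And>z. z \<in> N \<Longrightarrow> a \<le> nrm z + q (x - z)) \<Longrightarrow> a \<le> hat x"
  unfolding hat_def using n.B_zero by (intro cINF_greatest) auto

lemma hat_lessD: "hat x < s \<Longrightarrow> \<exists>z\<in>N. nrm z + q (x - z) < s"
  using hat_ge[of s x] by force

lemma hat_nonneg: "0 \<le> hat x"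
  by (rule hat_ge) (auto intro!: add_nonneg_nonneg n.q_nonneg q.q_nonneg)

lemma hat_le_q: "hat x \<le> q x"
  using hat_le[OF n.B_zero, of x] n.q_zero by simp

lemma hat_le_nrm: "x \<in> N \<Longrightarrow> hat x \<le> nrm x"
  using hat_le[of x x] q.q_zero by simp

lemma q_le_hat: "q x \<le> max C 1 * hat x"
proof -
  have "q x / max C 1 \<le> hat x"
  proof (rule hat_ge)
    fix z assume z: "z \<in> N"
    have "q x \<le> q z + q (x - z)" by (rule q.q_le_dist) auto
    also have "\<dots> \<le> max C 1 * nrm z + max C 1 * q (x - z)"
    proof (rule add_mono)
      show "q z \<le> max C 1 * nrm z"
        using C(2)[OF z] mult_right_mono[OF max.cobounded1 n.q_nonneg[OF z], of C 1] by linarith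
      show "q (x - z) \<le> max C 1 * q (x - z)"
        using mult_right_mono[OF max.cobounded2 q.q_nonneg[of "x - z"], of 1 C] by simp
    qed
    finally show "q x / max C 1 \<le> nrm z + q (x - z)" by (simp add: field_simps)
  qed
  then show ?thesis by (simp add: field_simps)
qed

lemma hat_add: "hat (x + y) \<le> hat x + hat y"
proof (rule field_le_epsilon)
  fix \<epsilon> :: real assume \<epsilon>: "0 < \<epsilon>"
  obtain z where z: "z \<in> N" "nrm z + q (x - z) < hat x + \<epsilon> / 2"
    using hat_lessD[of x "hat x + \<epsilon> / 2"] \<epsilon> by auto
  obtain w where w: "w \<in> N" "nrm w + q (y - w) < hat y + \<epsilon> / 2"
    using hat_lessD[of y "hat y + \<epsilon> / 2"] \<epsilon> by auto
  have "hat (x + y) \<le> nrm (z + w) + q (x + y - (z + w))" using z w by (intro hat_le n.B_add)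
  also have "x + y - (z + w) = (x - z) + (y - w)" by simp
  finally show "hat (x + y) \<le> hat x + hat y + \<epsilon>"
    using n.q_add[OF z(1) w(1)] q.q_add[of "x - z" "y - w"] z w by simp
qed

lemma hat_scale_le: "hat (c *\<^sub>R x) \<le> \<bar>c\<bar> * hat x"
proof (rule le_mult_of_le_mult_greater)
  fix s t assume s: "\<bar>c\<bar> < s" and t: "hat x < t"
  obtain z where z: "z \<in> N" "nrm z + q (x - z) < t" using hat_lessD t by blast
  have "hat (c *\<^sub>R x) \<le> nrm (c *\<^sub>R z) + q (c *\<^sub>R x - c *\<^sub>R z)" using z by (intro hat_le n.B_scale)
  also have "\<dots> = \<bar>c\<bar> * (nrm z + q (x - z))"
    using n.q_scale[OF z(1)] q.q_scale[of "x - z" c] by (simp add: scaleR_diff_right algebra_simps)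
  also have "\<dots> \<le> s * t"
    using z s n.q_nonneg[OF z(1)] q.q_nonneg[of "x - z"] by (intro mult_mono) auto
  finally show "hat (c *\<^sub>R x) \<le> s * t" .
qed

lemma hat_scale: "hat (c *\<^sub>R x) = \<bar>c\<bar> * hat x"
proof (cases "c = 0")
  case True
  then show ?thesis using hat_scale_le[of 0 x] hat_nonneg[of 0] by simp
next
  case False
  have "\<bar>c\<bar> * hat x \<le> \<bar>c\<bar> * (\<bar>1 / c\<bar> * hat (c *\<^sub>R x))"
    using hat_scale_le[of "1 / c" "c *\<^sub>R x"] False by (intro mult_left_mono) auto
  also have "\<dots> = hat (c *\<^sub>R x)" using False by (simp add: abs_mult[symmetric])
  finally show ?thesis using hat_scale_le[of c x] by simp
qed

lemma hat_diff_le: "\<bar>hat x - hat y\<bar> \<le> q (x - y)"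
  using hat_add[of "x - y" y] hat_add[of "y - x" x] hat_le_q[of "x - y"] hat_le_q[of "y - x"]
    q.q_sym[of x y] by simp

lemma hat_cong: "q (x - y) = 0 \<Longrightarrow> hat x = hat y"
  using hat_diff_le[of x y] by simp

text \<open>
  On \<open>N\<close> the value of \<open>hat\<close> is the infimum of \<open>nrm y\<close> over \<open>y\<close> congruent to \<open>x\<close> modulo the kernel of \<open>q\<close>:
  the remainder \<open>x - z\<close> of an almost optimal decomposition is congruent to its truncation at a level
  just above \<open>q (x - z)\<close>.
\<close>

lemma hat_rep:
  assumes x: "x \<in> N" and s: "hat x < s"
  shows "\<exists>y\<in>N. nrm y \<le> s \<and> q (x - y) = 0"
proof -
  obtain z where z: "z \<in> N" "nrm z + q (x - z) < s" using hat_lessD s by blast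
  define s' where "s' = s - nrm z"
  have s': "q (x - z) < s'" using z by (simp add: s'_def)
  then have s'0: "0 < s'" using q.q_nonneg[of "x - z"] by simp
  have xz: "x - z \<in> N" using x z by (intro n.B_diff)
  obtain y where y: "N.fcalc (clamp_real s') (x - z) y"
    using N.fcalc_ex[OF continuous_clamp_real xz] by blast
  have "q (x - z - y) = 0"
    by (rule N.clamp_eq[OF y s'0 xz _ qN C s']) auto
  moreover have "nrm y \<le> s'" using N.clamp_bound[OF y] s'0 by simp
  then have "nrm (z + y) \<le> s"
    using n.q_add[OF z(1) N.fcalc_in[OF y]] by (simp add: s'_def)
  ultimately show ?thesis using z N.fcalc_in[OF y]
    by (intro bexI[of _ "z + y"]) (auto simp: algebra_simps intro: n.B_add)
qed

lemma hat_mult_N: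
  assumes "x \<in> N" "y \<in> N"
  shows "hat (m x y) \<le> hat x * hat y"
proof (rule le_mult_of_le_mult_greater)
  fix s t assume s: "hat x < s" and t: "hat y < t"
  obtain x' where x': "x' \<in> N" "nrm x' \<le> s" "q (x - x') = 0" using hat_rep[OF assms(1) s] by blast
  obtain y' where y': "y' \<in> N" "nrm y' \<le> t" "q (y - y') = 0" using hat_rep[OF assms(2) t] by blast
  have "hat (m x y) = hat (m x' y')"
    by (rule hat_cong, rule q.q_cong_mult) (use x' y' in auto)
  also have "\<dots> \<le> nrm (m x' y')" using x' y' by (intro hat_le_nrm n.B_mult)
  also have "\<dots> \<le> nrm x' * nrm y'" using x' y' by (intro n.q_mult)
  also have "\<dots> \<le> s * t"
    using x' y' n.q_nonneg s hat_nonneg[of x] by (intro mult_mono) auto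
  finally show "hat (m x y) \<le> s * t" .
qed

lemma q_power_le:
  assumes d: "d \<in> N" "nrm d \<le> s"
  shows "q (pev d ([:0, 1:] ^ Suc n)) \<le> C * s ^ Suc n"
proof -
  have "q (pev d ([:0, 1:] ^ Suc n)) \<le> C * nrm (pev d ([:0, 1:] ^ Suc n))"
    using d by (intro C n.B_pev)
  also have "\<dots> \<le> C * nrm d ^ Suc n"
    using d C by (intro mult_left_mono n.q_pev_power)
  also have "\<dots> \<le> C * s ^ Suc n"
    using d C n.q_nonneg by (intro mult_left_mono power_mono)
  finally show ?thesis .
qed

text \<open>
  If \<open>x\<^sup>2\<close> has a representative of norm at most \<open>r\<close>, the powers of \<open>x\<close> show that the spectral radius of
  \<open>x\<close> with respect to \<open>q\<close> is at most \<open>sqrt r\<close>. So \<open>x\<close> is congruent to its truncation at any level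
  above \<open>sqrt r\<close>.
\<close>

lemma hat_square_N:
  assumes x: "x \<in> N"
  shows "(hat x)\<^sup>2 \<le> hat (m x x)"
proof (rule field_le_epsilon)
  fix \<epsilon> :: real assume \<epsilon>: "0 < \<epsilon>"
  define r where "r = hat (m x x) + \<epsilon>"
  have r: "hat (m x x) < r" "0 < r" using \<epsilon> hat_nonneg[of "m x x"] by (auto simp: r_def)
  obtain y0 where y0: "y0 \<in> N" "nrm y0 \<le> r" "q (m x x - y0) = 0"
    using hat_rep[OF n.B_mult[OF x x] r(1)] by blast
  have "hat x \<le> sqrt r + \<delta>" if \<delta>: "0 < \<delta>" for \<delta>
  proof -
    define s where "s = sqrt r + \<delta>"
    have s: "0 < s" using \<delta> r by (simp add: s_def add_pos_pos)
    obtain y where y: "N.fcalc (clamp_real s) x y"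
      using N.fcalc_ex[OF continuous_clamp_real x] by blast
    have "q (x - y) = 0"
    proof (rule N.clamp_eq_of_spectral_radius[OF y s x _ qN C])
      show "0 \<le> sqrt r" "sqrt r < s" using r \<delta> by (auto simp: s_def)
      have "q (pev x ([:0, 1:] ^ (2 * Suc M))) \<le> C * sqrt r ^ (2 * Suc M)" for M
      proof -
        have "q (pev x ([:0, 1:] ^ (2 * Suc M))) = q (pev y0 ([:0, 1:] ^ Suc M))"
          unfolding pev_even_power by (rule q.q_eq[OF _ _ q.q_cong_pev]) (use y0 in auto)
        also have "\<dots> \<le> C * r ^ Suc M" by (rule q_power_le) (use y0 in auto)
        also have "r ^ Suc M = sqrt r ^ (2 * Suc M)" using r by (simp only: power_mult real_sqrt_pow2 less_imp_le)
        finally show ?thesis .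
      qed
      then show "\<exists>n\<ge>M. q (pev x ([:0, 1:] ^ (2 * n))) \<le> C * sqrt r ^ (2 * n)" for M
        by (meson le_SucI order_refl)
    qed auto
    then have "hat x = hat y" by (rule hat_cong)
    also have "\<dots> \<le> s"
      using hat_le_nrm[OF N.fcalc_in[OF y]] N.clamp_bound[OF y, of nrm] s by simp
    finally show ?thesis by (simp add: s_def)
  qed
  then have "hat x \<le> sqrt r" by (rule field_le_epsilon)
  then have "(hat x)\<^sup>2 \<le> (sqrt r)\<^sup>2" using hat_nonneg by (intro power_mono)
  then show "(hat x)\<^sup>2 \<le> hat (m x x) + \<epsilon>" using r by (simp add: r_def)
qed

text \<open>
  Let \<open>z\<close> be congruent to \<open>x\<^sup>2 + y\<^sup>2\<close>, with norm at most \<open>l\<close>, and let \<open>t > nrm y\<close>. Then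
  \<open>d = (t\<^sup>2 - y\<^sup>2) + z\<close> has norm at most \<open>t\<^sup>2 + l\<close> and is congruent to \<open>b = t\<^sup>2 + x\<^sup>2\<close>. Hence \<open>b\<close> is congruent
  to its truncation at \<open>s > t\<^sup>2 + l\<close>, and subtracting \<open>t\<^sup>2\<close> leaves a representative of \<open>x\<^sup>2\<close> of norm at most
  \<open>s - t\<^sup>2\<close>. The shift by \<open>t\<^sup>2\<close> replaces the addition of \<open>y\<^sup>2\<close>, which need not operator commute with
  \<open>x\<close>, by the addition of a scalar.
\<close>

lemma hat_fine_N:
  assumes x: "x \<in> N" and y: "y \<in> N"
  shows "hat (m x x) \<le> hat (m x x + m y y)"
proof (rule field_le_epsilon)
  fix \<epsilon> :: real assume \<epsilon>: "0 < \<epsilon>"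
  define l where "l = hat (m x x + m y y) + \<epsilon> / 2"
  have l: "hat (m x x + m y y) < l" "0 < l" using \<epsilon> hat_nonneg[of "m x x + m y y"] by (auto simp: l_def)
  have xx: "m x x \<in> N" and yy: "m y y \<in> N" using x y by (auto intro: n.B_mult)
  obtain z where z: "z \<in> N" "nrm z \<le> l" "q (m x x + m y y - z) = 0"
    using hat_rep[OF n.B_add[OF xx yy] l(1)] by blast
  define t where "t = nrm y + 1"
  define d where "d = (t\<^sup>2 *\<^sub>R e - m y y) + z"
  define b where "b = t\<^sup>2 *\<^sub>R e + m x x"
  define s where "s = t\<^sup>2 + l + \<epsilon> / 2"
  have t0: "0 \<le> t\<^sup>2" by simp
  have dN: "d \<in> N" and bN: "b \<in> N" using z xx yy by (auto simp: d_def b_def intro!: n.B_closed)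
  have "nrm (pev y [:t\<^sup>2, 0, - 1:]) \<le> t\<^sup>2"
  proof (rule n.pev_le[OF y])
    show "nrm y < t" by (simp add: t_def)
    fix u assume "\<bar>u\<bar> \<le> t"
    then have "u * u \<le> t\<^sup>2" "0 \<le> u * u" using abs_le_square_iff[of u t] by (auto simp: power2_eq_square)
    then show "\<bar>poly [:t\<^sup>2, 0, - 1:] u\<bar> \<le> t\<^sup>2" by simp
  qed
  moreover have "pev y [:t\<^sup>2, 0, - 1:] = t\<^sup>2 *\<^sub>R e - m y y"
    using m_diff_right[of y 0 e] by (simp add: m_diff_right[of y 0, simplified])
  ultimately have "nrm (t\<^sup>2 *\<^sub>R e - m y y) \<le> t\<^sup>2" by simp
  then have nd: "nrm d \<le> t\<^sup>2 + l"
    using n.q_add[of "t\<^sup>2 *\<^sub>R e - m y y" z] z yy by (simp add: d_def n.B_closed)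
  have bd: "q (b - d) = 0" using z(3) by (simp add: b_def d_def algebra_simps)
  have s: "0 < s" "t\<^sup>2 \<le> s" using \<epsilon> l t0 by (auto simp: s_def intro: add_nonneg_pos)
  obtain y' where y': "N.fcalc (clamp_real s) b y'"
    using N.fcalc_ex[OF continuous_clamp_real bN] by blast
  have y'N: "y' \<in> N" by (rule N.fcalc_in[OF y'])
  have "q (b - y') = 0"
  proof (rule N.clamp_eq_of_spectral_radius[OF y' s(1) bN _ qN C])
    show "0 \<le> t\<^sup>2 + l" "t\<^sup>2 + l < s" using l \<epsilon> t0 by (auto simp: s_def)
    have "q (pev b ([:0, 1:] ^ (2 * Suc M))) \<le> C * (t\<^sup>2 + l) ^ (2 * Suc M)" for M
    proof -
      have "q (pev b ([:0, 1:] ^ (2 * Suc M))) = q (pev d ([:0, 1:] ^ (2 * Suc M)))"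
        by (rule q.q_eq[OF _ _ q.q_cong_pev]) (use bd in auto)
      moreover have "2 * Suc M = Suc (2 * M + 1)" by simp
      ultimately show ?thesis using q_power_le[OF dN nd, of "2 * M + 1"] by metis
    qed
    then show "\<exists>n\<ge>M. q (pev b ([:0, 1:] ^ (2 * n))) \<le> C * (t\<^sup>2 + l) ^ (2 * n)" for M
      by (meson le_SucI order_refl)
  qed auto
  moreover have "nrm (y' - t\<^sup>2 *\<^sub>R e) \<le> s - t\<^sup>2"
    by (rule N.clamp_shifted_square[OF y'[unfolded b_def] t0 s(2) x]) simp
  moreover have "hat (m x x) \<le> nrm (y' - t\<^sup>2 *\<^sub>R e) + q (m x x - (y' - t\<^sup>2 *\<^sub>R e))"
    using y'N by (intro hat_le) (auto intro!: n.B_closed)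
  moreover have "m x x - (y' - t\<^sup>2 *\<^sub>R e) = b - y'" by (simp add: b_def algebra_simps)
  ultimately show "hat (m x x) \<le> hat (m x x + m y y) + \<epsilon>" by (simp add: s_def l_def)
qed

lemma approx_sequence: "\<exists>X. (\<forall>k. X k \<in> N) \<and> (\<lambda>k. q (x - X k)) \<longlonglongrightarrow> 0"
proof -
  have "\<forall>k. \<exists>z\<in>N. q (x - z) < 1 / Suc k" using dense by simp
  then obtain X where X: "\<And>k. X k \<in> N" "\<And>k. q (x - X k) < 1 / Suc k" by metis
  have "(\<lambda>k. q (x - X k)) \<longlonglongrightarrow> 0"
  proof (rule tendsto_sandwich[OF _ _ tendsto_const LIMSEQ_Suc[OF lim_1_over_n]])
    show "\<forall>\<^sub>F k in sequentially. 0 \<le> q (x - X k)" by (simp add: q.q_nonneg)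
    show "\<forall>\<^sub>F k in sequentially. q (x - X k) \<le> 1 / real (Suc k)"
      using X(2) by (intro always_eventually) (auto intro: less_imp_le)
  qed
  then show ?thesis using X(1) by blast
qed

lemma hat_tendsto:
  assumes "(\<lambda>k. q (x - X k)) \<longlonglongrightarrow> 0"
  shows "(\<lambda>k. hat (X k)) \<longlonglongrightarrow> hat x"
proof -
  have "(\<lambda>k. hat (X k) - hat x) \<longlonglongrightarrow> 0"
    by (rule tendsto_rabs_zero_cancel, rule tendsto_sandwich[OF _ _ tendsto_const assms])
      (use hat_diff_le in \<open>auto simp: abs_minus_commute\<close>)
  then show ?thesis by (simp add: LIM_zero_iff)
qed

lemma mult_tendsto:
  assumes X: "(\<lambda>k. q (x - X k)) \<longlonglongrightarrow> 0" and Y: "(\<lambda>k. q (y - Y k)) \<longlonglongrightarrow> 0"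
  shows "(\<lambda>k. q (m x y - m (X k) (Y k))) \<longlonglongrightarrow> 0"
proof (rule tendsto_sandwich[OF _ _ tendsto_const])
  have "(\<lambda>k. q (x - X k) * q y + (q x + q (x - X k)) * q (y - Y k)) \<longlonglongrightarrow> 0 * q y + (q x + 0) * 0"
    by (intro tendsto_intros X Y)
  then show "(\<lambda>k. q (x - X k) * q y + (q x + q (x - X k)) * q (y - Y k)) \<longlonglongrightarrow> 0" by simp
  have "q (m x y - m (X k) (Y k)) \<le> q (x - X k) * q y + (q x + q (x - X k)) * q (y - Y k)" for k
  proof -
    have "m x y - m (X k) (Y k) = m (x - X k) y + m (X k) (y - Y k)" by (simp add: m_bilinear)
    then have "q (m x y - m (X k) (Y k)) \<le> q (x - X k) * q y + q (X k) * q (y - Y k)"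
      using q.q_add[of "m (x - X k) y" "m (X k) (y - Y k)"] q.q_mult[of "x - X k" y]
        q.q_mult[of "X k" "y - Y k"] by simp
    also have "\<dots> \<le> q (x - X k) * q y + (q x + q (x - X k)) * q (y - Y k)"
      using q.q_le_dist[of "X k" x] q.q_sym[of "X k" x] q.q_nonneg[of "y - Y k"]
      by (intro add_left_mono mult_right_mono) auto
    finally show ?thesis .
  qed
  then show "\<forall>\<^sub>F k in sequentially. q (m x y - m (X k) (Y k))
      \<le> q (x - X k) * q y + (q x + q (x - X k)) * q (y - Y k)" by simp
qed (simp add: q.q_nonneg)

lemma add_tendsto:
  assumes X: "(\<lambda>k. q (x - X k)) \<longlonglongrightarrow> 0" and Y: "(\<lambda>k. q (y - Y k)) \<longlonglongrightarrow> 0"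
  shows "(\<lambda>k. q (x + y - (X k + Y k))) \<longlonglongrightarrow> 0"
proof (rule tendsto_sandwich[OF _ _ tendsto_const])
  show "(\<lambda>k. q (x - X k) + q (y - Y k)) \<longlonglongrightarrow> 0" using tendsto_add[OF X Y] by simp
  have "q (x + y - (X k + Y k)) \<le> q (x - X k) + q (y - Y k)" for k
    using q.q_add[of "x - X k" "y - Y k"] by (simp add: algebra_simps)
  then show "\<forall>\<^sub>F k in sequentially. q (x + y - (X k + Y k)) \<le> q (x - X k) + q (y - Y k)" by simp
qed (simp add: q.q_nonneg)

text \<open>
  All three conditions compare continuous expressions, so they extend from the dense subalgebra \<open>N\<close>.
\<close>

theorem JB_hat: "JB_seminorm_on m e UNIV hat"
proof -
  have mult: "hat (m x y) \<le> hat x * hat y" for x y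
  proof -
    obtain X Y where X: "\<And>k. X k \<in> N" "(\<lambda>k. q (x - X k)) \<longlonglongrightarrow> 0"
      and Y: "\<And>k. Y k \<in> N" "(\<lambda>k. q (y - Y k)) \<longlonglongrightarrow> 0"
      using approx_sequence[of x] approx_sequence[of y] by blast
    show ?thesis
      by (rule LIMSEQ_le[OF hat_tendsto[OF mult_tendsto[OF X(2) Y(2)]]
            tendsto_mult[OF hat_tendsto[OF X(2)] hat_tendsto[OF Y(2)]]])
        (use X Y hat_mult_N in auto)
  qed
  have sq: "(hat x)\<^sup>2 \<le> hat (m x x)" for x
  proof -
    obtain X where X: "\<And>k. X k \<in> N" "(\<lambda>k. q (x - X k)) \<longlonglongrightarrow> 0"
      using approx_sequence[of x] by blast
    show ?thesis
      by (rule LIMSEQ_le[OF tendsto_power[OF hat_tendsto[OF X(2)]] hat_tendsto[OF mult_tendsto[OF X(2) X(2)]]])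
        (use X hat_square_N in auto)
  qed
  have fine: "hat (m x x) \<le> hat (m x x + m y y)" for x y
  proof -
    obtain X Y where X: "\<And>k. X k \<in> N" "(\<lambda>k. q (x - X k)) \<longlonglongrightarrow> 0"
      and Y: "\<And>k. Y k \<in> N" "(\<lambda>k. q (y - Y k)) \<longlonglongrightarrow> 0"
      using approx_sequence[of x] approx_sequence[of y] by blast
    note XX = mult_tendsto[OF X(2) X(2)] and YY = mult_tendsto[OF Y(2) Y(2)]
    show ?thesis
      by (rule LIMSEQ_le[OF hat_tendsto[OF XX] hat_tendsto[OF add_tendsto[OF XX YY]]])
        (use X Y hat_fine_N in auto)
  qed
  have "hat (m x x) = (hat x)\<^sup>2" for x
    using mult[of x x] sq[of x] by (simp add: power2_eq_square)
  then show ?thesis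
    unfolding JB_seminorm_on_def subalg_simps
    using mult fine hat_nonneg hat_add hat_scale by auto
qed

end

section \<open>Normed modules and their topology\<close>

locale real_normed_module = Module.module real_ring A for A :: "(real, 'a) module" (structure) +
  fixes p :: "'a \<Rightarrow> real"
  assumes norm: "alg_norm A p"
begin

lemma p_nonneg: "x \<in> carrier A \<Longrightarrow> 0 \<le> p x"
  and p_add: "x \<in> carrier A \<Longrightarrow> y \<in> carrier A \<Longrightarrow> p (x \<oplus> y) \<le> p x + p y"
  and p_smult: "x \<in> carrier A \<Longrightarrow> p (c \<odot> x) = \<bar>c\<bar> * p x"
  and p_eq_0: "x \<in> carrier A \<Longrightarrow> p x = 0 \<Longrightarrow> x = \<zero>"
  using norm by (auto simp: alg_norm_def alg_seminorm_def)

lemma smult_UNIV_closed: "x \<in> carrier A \<Longrightarrow> c \<odot> x \<in> carrier A"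
  using smult_closed[of c x] by simp

lemma smult_0: "x \<in> carrier A \<Longrightarrow> 0 \<odot> x = \<zero>"
  using smult_l_null[of x] by simp

lemma p_zero: "p \<zero> = 0"
  using p_smult[of \<zero> 0] smult_0[of \<zero>] by simp

lemma smult_minus_1:
  assumes "x \<in> carrier A"
  shows "(- 1) \<odot> x = \<ominus> x"
proof -
  have "(- 1) \<odot> x \<oplus> x = (- 1 + 1) \<odot> x"
    using smult_l_distr[of "- 1" 1 x] smult_one[of x] assms by simp
  then show ?thesis using assms smult_0[OF assms] smult_UNIV_closed
    by (intro minus_equality[symmetric]) auto
qed

lemma diff_eq_0: "x \<in> carrier A \<Longrightarrow> y \<in> carrier A \<Longrightarrow> x \<ominus> y = \<zero> \<longleftrightarrow> x = y"
  using r_neg[of x] minus_equality[of x "\<ominus> y"] by (auto simp: minus_eq)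

lemma diff_self: "x \<in> carrier A \<Longrightarrow> x \<ominus> x = \<zero>"
  by (simp add: diff_eq_0)

lemma diff_sym: "x \<in> carrier A \<Longrightarrow> y \<in> carrier A \<Longrightarrow> (- 1) \<odot> (x \<ominus> y) = y \<ominus> x"
  using smult_minus_1[of "x \<ominus> y"] by (simp add: minus_eq minus_add a_comm)

lemma p_diff_sym: "x \<in> carrier A \<Longrightarrow> y \<in> carrier A \<Longrightarrow> p (x \<ominus> y) = p (y \<ominus> x)"
  using diff_sym[of x y] p_smult[of "x \<ominus> y" "- 1"] by simp

lemma diff_add_diff:
  "x \<in> carrier A \<Longrightarrow> y \<in> carrier A \<Longrightarrow> z \<in> carrier A \<Longrightarrow> (x \<ominus> y) \<oplus> (y \<ominus> z) = x \<ominus> z"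
  by (simp add: minus_eq a_assoc r_neg1)

lemma diff_zero: "x \<in> carrier A \<Longrightarrow> x \<ominus> \<zero> = x"
  by (simp add: minus_eq)

lemma p_dist:
  "x \<in> carrier A \<Longrightarrow> y \<in> carrier A \<Longrightarrow> z \<in> carrier A \<Longrightarrow> p (x \<ominus> z) \<le> p (x \<ominus> y) + p (y \<ominus> z)"
  using p_add[of "x \<ominus> y" "y \<ominus> z"] diff_add_diff[of x y z] by simp

sublocale metric: Metric_space "carrier A" "norm_dist A p"
proof
  fix x y z
  show "0 \<le> norm_dist A p x y" by (simp add: norm_dist_def p_nonneg)
  show "norm_dist A p x y = norm_dist A p y x" by (simp add: norm_dist_def p_diff_sym)
  show "norm_dist A p x y = 0 \<longleftrightarrow> x = y" if "x \<in> carrier A" "y \<in> carrier A"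
    using that diff_eq_0[of x y] p_eq_0[of "x \<ominus> y"] p_zero by (auto simp: norm_dist_def)
  show "norm_dist A p x z \<le> norm_dist A p x y + norm_dist A p y z"
    if "x \<in> carrier A" "y \<in> carrier A" "z \<in> carrier A"
    using that p_dist by (simp add: norm_dist_def)
qed

lemma topspace_norm_topology [simp]: "topspace (norm_topology A p) = carrier A"
  by (simp add: norm_topology_def)

lemma openin_norm_topology:
  "openin (norm_topology A p) U \<longleftrightarrow>
    U \<subseteq> carrier A \<and> (\<forall>x\<in>U. \<exists>r>0. \<forall>y\<in>carrier A. p (y \<ominus> x) < r \<longrightarrow> y \<in> U)"
  unfolding norm_topology_def metric.openin_mtopology
proof (intro conj_cong refl)
  assume U: "U \<subseteq> carrier A"
  have "metric.mball x r \<subseteq> U \<longleftrightarrow> (\<forall>y\<in>carrier A. p (y \<ominus> x) < r \<longrightarrow> y \<in> U)" if "x \<in> U" for x r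
    using that U p_diff_sym[of x] by (auto simp: norm_dist_def subset_iff)
  then show "(\<forall>x. x \<in> U \<longrightarrow> (\<exists>r>0. metric.mball x r \<subseteq> U)) \<longleftrightarrow>
      (\<forall>x\<in>U. \<exists>r>0. \<forall>y\<in>carrier A. p (y \<ominus> x) < r \<longrightarrow> y \<in> U)" by auto
qed

lemma openin_norm_ball:
  assumes "x \<in> carrier A"
  shows "openin (norm_topology A p) {y \<in> carrier A. p (y \<ominus> x) < r}"
proof -
  have "metric.mball x r = {y \<in> carrier A. p (y \<ominus> x) < r}"
    using assms p_diff_sym[of x] by (auto simp: norm_dist_def)
  then show ?thesis using metric.openin_mball[of x r] by (simp add: norm_topology_def)
qed

lemma mcomplete_norm_iff:
  "metric.mcomplete \<longleftrightarrow> (\<forall>X. (\<forall>n. X n \<in> carrier A)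
      \<and> (\<forall>\<epsilon>>0. \<exists>N. \<forall>i\<ge>N. \<forall>j\<ge>N. p (X i \<ominus> X j) < \<epsilon>)
    \<longrightarrow> (\<exists>x\<in>carrier A. (\<lambda>n. p (X n \<ominus> x)) \<longlonglongrightarrow> 0))"
proof -
  have cauchy: "metric.MCauchy X \<longleftrightarrow> (\<forall>n. X n \<in> carrier A)
      \<and> (\<forall>\<epsilon>>0. \<exists>N. \<forall>i\<ge>N. \<forall>j\<ge>N. p (X i \<ominus> X j) < \<epsilon>)" for X
    unfolding metric.MCauchy_def by (auto simp: norm_dist_def image_subset_iff)
  have lim: "(\<exists>x. limitin metric.mtopology X x sequentially) \<longleftrightarrow>
      (\<exists>x\<in>carrier A. (\<lambda>n. p (X n \<ominus> x)) \<longlonglongrightarrow> 0)" if "\<And>n. X n \<in> carrier A" for X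
    using that by (auto simp: metric.limitin_metric_dist_null norm_dist_def)
  show ?thesis unfolding metric.mcomplete_def cauchy by (metis lim)
qed

text \<open>
  The usual scaling argument: a neighbourhood of zero contains a ball.
\<close>

lemma bounded_by_norm:
  assumes f: "\<And>c x. x \<in> carrier A \<Longrightarrow> f (c \<odot> x) = \<bar>c\<bar> * f x"
    and "open": "openin (norm_topology A p) {x \<in> carrier A. f x < (1::real)}"
  shows "\<exists>C\<ge>0. \<forall>x\<in>carrier A. f x \<le> C * p x"
proof -
  have f0: "f \<zero> = 0" using f[of \<zero> 0] smult_0[of \<zero>] by simp
  then have "\<zero> \<in> {x \<in> carrier A. f x < 1}" by simp
  then obtain r where r: "r > 0" "\<And>y. y \<in> carrier A \<Longrightarrow> p (y \<ominus> \<zero>) < r \<Longrightarrow> f y < 1"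
    using "open" unfolding openin_norm_topology by blast
  have "f x \<le> (2 / r) * p x" if x: "x \<in> carrier A" for x
  proof (cases "p x = 0")
    case True
    then show ?thesis using p_eq_0[OF x] f0 p_zero by simp
  next
    case False
    then have px: "0 < p x" using p_nonneg[OF x] by simp
    define c where "c = r / (2 * p x)"
    have c: "0 < c" using r px by (simp add: c_def)
    have "p (c \<odot> x) < r" using x c px r by (simp add: p_smult c_def)
    then have "f (c \<odot> x) < 1"
      using r(2)[of "c \<odot> x"] x by (simp add: diff_zero smult_UNIV_closed)
    then have "c * f x < 1" using f[OF x, of c] c by simp
    then show ?thesis using px r by (simp add: c_def field_simps)
  qed
  then show ?thesis using r by (intro exI[of _ "2 / r"]) auto
qed

end

lemma real_normed_moduleI:
  "jordan_algebra A \<Longrightarrow> alg_norm A p \<Longrightarrow> real_normed_module A p"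
  by (simp add: jordan_algebra_def real_normed_module_def real_normed_module_axioms_def)

lemma subalg_diff:
  assumes "real_normed_module (subalg m e N) p" "x \<in> N" "y \<in> N"
  shows "x \<ominus>\<^bsub>subalg m e N\<^esub> y = x - y"
proof -
  interpret real_normed_module "subalg m e N" p by fact
  have "\<ominus>\<^bsub>subalg m e N\<^esub> y = - y"
    using smult_minus_1[of y, symmetric] assms by (simp add: type_algebra_def)
  then show ?thesis unfolding minus_eq by (simp only:) (simp add: type_algebra_def)
qed

section \<open>Projective limits in terms of seminorms\<close>

text \<open>
  What the proof uses of a projective limit of Banach-Jordan algebras, in terms of the seminorms
  \<open>x \<mapsto> \<nu> \<alpha> (x \<alpha>)\<close>. The last two conditions are two facets of completeness. Sequences suffice for the
  functional calculus. The points of a projective limit over an uncountable directed set need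
  \<open>coherent\<close>: a choice \<open>xs\<close> of elements that agree modulo the kernels comes from a single element.
\<close>

locale seminorm_presentation = jordan_product m e
  for m :: "'a::{real_vector, topological_space} \<Rightarrow> 'a \<Rightarrow> 'a" and e +
  fixes Q :: "('a \<Rightarrow> real) set"
  assumes nonempty: "Q \<noteq> {}"
    and submult: "q \<in> Q \<Longrightarrow> submult_seminorm m e UNIV q"
    and directed: "q1 \<in> Q \<Longrightarrow> q2 \<in> Q \<Longrightarrow>
      \<exists>q3\<in>Q. \<exists>C\<ge>0. \<forall>x. q1 x \<le> C * q3 x \<and> q2 x \<le> C * q3 x"
    and separated: "(\<And>q. q \<in> Q \<Longrightarrow> q x = 0) \<Longrightarrow> x = 0"
    and topology: "open U \<longleftrightarrow> (\<forall>x\<in>U. \<exists>q\<in>Q. \<exists>r>0. \<forall>y. q (y - x) < r \<longrightarrow> y \<in> U)"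
    and complete: "(\<And>q \<epsilon>. \<lbrakk>q \<in> Q; 0 < \<epsilon>\<rbrakk> \<Longrightarrow> \<exists>N. \<forall>i\<ge>N. \<forall>j\<ge>N. q (X i - X j) < \<epsilon>)
      \<Longrightarrow> \<exists>x. \<forall>q\<in>Q. (\<lambda>n::nat. q (X n - x)) \<longlonglongrightarrow> 0"
    and coherent: "(\<And>q q' C. \<lbrakk>q \<in> Q; q' \<in> Q; 0 \<le> C; \<And>x. q x \<le> C * q' x\<rbrakk> \<Longrightarrow> q (xs q' - xs q) = 0)
      \<Longrightarrow> \<exists>x. \<forall>q\<in>Q. q (x - xs q) = 0"

locale projective_limit =
  fixes m :: "'a::{real_vector, topological_space} \<Rightarrow> 'a \<Rightarrow> 'a" and e :: 'a
    and I :: "'i set" and leq :: "'i \<Rightarrow> 'i \<Rightarrow> bool" and E :: "'i \<Rightarrow> (real, 'e) module"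
    and \<nu> :: "'i \<Rightarrow> 'e \<Rightarrow> real" and g :: "'i \<Rightarrow> 'i \<Rightarrow> 'e \<Rightarrow> 'e" and \<phi> :: "'a \<Rightarrow> 'i \<Rightarrow> 'e"
  assumes jordan_type: "jordan_algebra (type_algebra m e)"
    and family: "projective_family I leq E \<nu> g"
    and hom: "\<phi> \<in> jordan_hom (type_algebra m e) (proj_lim I leq E g)"
    and homeo: "homeomorphic_map euclidean (proj_lim_topology I leq E \<nu> g) \<phi>"
begin

sublocale jordan_product m e by (rule jordan_product.intro) (rule jordan_type)

abbreviation (input) ntop :: "'i \<Rightarrow> 'e topology" where
  "ntop a \<equiv> norm_topology (E a) (\<nu> a)"

abbreviation (input) L :: "(real, 'i \<Rightarrow> 'e) module" where
  "L \<equiv> proj_lim I leq E g"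

abbreviation (input) ltop :: "('i \<Rightarrow> 'e) topology" where
  "ltop \<equiv> proj_lim_topology I leq E \<nu> g"

lemma I_nonempty: "I \<noteq> {}"
  and up: "a \<in> I \<Longrightarrow> b \<in> I \<Longrightarrow> \<exists>k\<in>I. leq a k \<and> leq b k"
  and banach: "a \<in> I \<Longrightarrow> banach_jordan_algebra (E a) (\<nu> a)"
  and g_hom: "a \<in> I \<Longrightarrow> b \<in> I \<Longrightarrow> leq a b \<Longrightarrow> g a b \<in> jordan_hom (E b) (E a)"
  and g_cont: "a \<in> I \<Longrightarrow> b \<in> I \<Longrightarrow> leq a b \<Longrightarrow>
    continuous_map (ntop b) (ntop a) (g a b)"
  using family unfolding projective_family_def by auto

lemma normed: "a \<in> I \<Longrightarrow> real_normed_module (E a) (\<nu> a)"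
  using banach by (intro real_normed_moduleI) (auto simp: banach_jordan_algebra_def)

lemma \<phi>_carrier: "\<phi> x \<in> carrier L"
  using hom by (auto simp: jordan_hom_def ring_hom_def type_algebra_def)

lemma \<phi>_in: "a \<in> I \<Longrightarrow> \<phi> x a \<in> carrier (E a)"
  using \<phi>_carrier[of x] by (auto simp: proj_lim_def)

lemma \<phi>_g: "a \<in> I \<Longrightarrow> b \<in> I \<Longrightarrow> leq a b \<Longrightarrow> g a b (\<phi> x b) = \<phi> x a"
  using \<phi>_carrier[of x] by (auto simp: proj_lim_def)

lemma \<phi>_add: "a \<in> I \<Longrightarrow> \<phi> (x + y) a = \<phi> x a \<oplus>\<^bsub>E a\<^esub> \<phi> y a"
  and \<phi>_mult: "a \<in> I \<Longrightarrow> \<phi> (m x y) a = \<phi> x a \<otimes>\<^bsub>E a\<^esub> \<phi> y a"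
  and \<phi>_scale: "a \<in> I \<Longrightarrow> \<phi> (c *\<^sub>R x) a = c \<odot>\<^bsub>E a\<^esub> \<phi> x a"
  using hom by (auto simp: jordan_hom_def ring_hom_def type_algebra_def proj_lim_def)

lemma \<phi>_diff:
  assumes "a \<in> I"
  shows "\<phi> (x - y) a = \<phi> x a \<ominus>\<^bsub>E a\<^esub> \<phi> y a"
proof -
  interpret real_normed_module "E a" "\<nu> a" by (rule normed[OF assms])
  show ?thesis
    using \<phi>_add[OF assms, of x "(- 1) *\<^sub>R y"] \<phi>_scale[OF assms, of "- 1" y]
      smult_minus_1[OF \<phi>_in[OF assms, of y]] by (simp add: minus_eq)
qed

lemma \<phi>_surj:
  assumes "y \<in> carrier L"
  shows "\<exists>x. \<phi> x = y"
proof -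
  have "y \<in> topspace ltop"
    using assms real_normed_module.topspace_norm_topology[OF normed]
    by (auto simp: proj_lim_topology_def proj_lim_def topspace_product_topology PiE_iff)
  then have "y \<in> range \<phi>" using homeomorphic_imp_surjective_map[OF homeo] by simp
  then show ?thesis by blast
qed

lemma \<phi>_inj: "\<phi> x = \<phi> y \<Longrightarrow> x = y"
  using homeomorphic_imp_injective_map[OF homeo] by (auto simp: inj_on_def)

definition cnorm :: "'i \<Rightarrow> 'a \<Rightarrow> real" where "cnorm a x = \<nu> a (\<phi> x a)"

lemma cnorm_diff: "a \<in> I \<Longrightarrow> cnorm a (x - y) = \<nu> a (\<phi> x a \<ominus>\<^bsub>E a\<^esub> \<phi> y a)"
  by (simp add: cnorm_def \<phi>_diff)

lemma cnorm_submult: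
  assumes "a \<in> I"
  shows "submult_seminorm m e UNIV (cnorm a)"
proof -
  interpret real_normed_module "E a" "\<nu> a" by (rule normed[OF assms])
  have "\<nu> a (x \<otimes>\<^bsub>E a\<^esub> y) \<le> \<nu> a x * \<nu> a y" if "x \<in> carrier (E a)" "y \<in> carrier (E a)" for x y
    using banach[OF assms] that by (simp add: banach_jordan_algebra_def submultiplicative_def)
  then have "submultiplicative (subalg m e UNIV) (cnorm a)"
    using \<phi>_in[OF assms] by (simp add: submultiplicative_subalg cnorm_def \<phi>_mult assms)
  moreover have "alg_seminorm (subalg m e UNIV) (cnorm a)"
    using \<phi>_in[OF assms] p_nonneg p_add p_smult
    by (simp add: alg_seminorm_subalg cnorm_def \<phi>_add \<phi>_scale assms)
  moreover have "jordan_subalgebra m e UNIV" by (simp add: jordan_subalgebra_def)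
  ultimately show ?thesis
    by (intro submult_seminorm.intro submult_seminorm_axioms.intro jordan_product_axioms)
qed

lemma cnorm_JB:
  assumes "a \<in> I" and JB: "JB_algebra (E a) (\<nu> a)"
  shows "JB_seminorm_on m e UNIV (cnorm a)"
proof -
  interpret submult_seminorm m e UNIV "cnorm a" by (rule cnorm_submult[OF assms(1)])
  have sq: "\<nu> a (x \<otimes>\<^bsub>E a\<^esub> x) = (\<nu> a x)\<^sup>2" if "x \<in> carrier (E a)" for x
    using JB that by (auto simp: JB_algebra_def)
  have "(\<nu> a x)\<^sup>2 \<le> \<nu> a (x \<otimes>\<^bsub>E a\<^esub> x \<oplus>\<^bsub>E a\<^esub> y \<otimes>\<^bsub>E a\<^esub> y)"
    if "x \<in> carrier (E a)" "y \<in> carrier (E a)" for x y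
    using JB that by (auto simp: JB_algebra_def)
  then show ?thesis
    using seminorm submultiplicative \<phi>_in[OF assms(1)]
    by (simp add: JB_seminorm_on_def fine_subalg regular_subalg cnorm_def \<phi>_add \<phi>_mult assms sq)
qed

lemma g_bounded:
  assumes "a \<in> I" "b \<in> I" "leq a b"
  shows "\<exists>C\<ge>0. \<forall>y\<in>carrier (E b). \<nu> a (g a b y) \<le> C * \<nu> b y"
proof -
  interpret a: real_normed_module "E a" "\<nu> a" by (rule normed[OF assms(1)])
  interpret b: real_normed_module "E b" "\<nu> b" by (rule normed[OF assms(2)])
  have g: "g a b y \<in> carrier (E a)" "g a b (c \<odot>\<^bsub>E b\<^esub> y) = c \<odot>\<^bsub>E a\<^esub> g a b y" if "y \<in> carrier (E b)" for y c
    using g_hom[OF assms] that by (auto simp: jordan_hom_def ring_hom_def)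
  show ?thesis
  proof (rule b.bounded_by_norm)
    show "\<nu> a (g a b (c \<odot>\<^bsub>E b\<^esub> y)) = \<bar>c\<bar> * \<nu> a (g a b y)" if "y \<in> carrier (E b)" for c y
      using that g a.p_smult by simp
    have "openin (ntop b)
        {x \<in> topspace (ntop b).
          g a b x \<in> {y \<in> carrier (E a). \<nu> a (y \<ominus>\<^bsub>E a\<^esub> \<zero>\<^bsub>E a\<^esub>) < 1}}"
      by (rule openin_continuous_map_preimage[OF g_cont[OF assms] a.openin_norm_ball]) simp
    also have "{x \<in> topspace (ntop b).
          g a b x \<in> {y \<in> carrier (E a). \<nu> a (y \<ominus>\<^bsub>E a\<^esub> \<zero>\<^bsub>E a\<^esub>) < 1}}
        = {x \<in> carrier (E b). \<nu> a (g a b x) < 1}"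
      using g by (auto simp: a.diff_zero)
    finally show "openin (ntop b) {x \<in> carrier (E b). \<nu> a (g a b x) < 1}" .
  qed
qed

lemma cnorm_mono: "a \<in> I \<Longrightarrow> b \<in> I \<Longrightarrow> leq a b \<Longrightarrow> \<exists>C\<ge>0. \<forall>x. cnorm a x \<le> C * cnorm b x"
  using g_bounded[of a b] \<phi>_in[of b] \<phi>_g[of a b] unfolding cnorm_def by metis

lemma cnorm_directed:
  assumes "a \<in> I" "b \<in> I"
  shows "\<exists>k\<in>I. \<exists>C\<ge>0. \<forall>x. cnorm a x \<le> C * cnorm k x \<and> cnorm b x \<le> C * cnorm k x"
proof -
  obtain k where k: "k \<in> I" "leq a k" "leq b k" using up assms by blast
  obtain C D where C: "C \<ge> 0" "\<And>x. cnorm a x \<le> C * cnorm k x" and D: "D \<ge> 0" "\<And>x. cnorm b x \<le> D * cnorm k x"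
    using cnorm_mono[OF assms(1) k(1,2)] cnorm_mono[OF assms(2) k(1,3)] by blast
  interpret submult_seminorm m e UNIV "cnorm k" by (rule cnorm_submult[OF k(1)])
  have "C * cnorm k x \<le> max C D * cnorm k x" "D * cnorm k x \<le> max C D * cnorm k x" for x
    by (auto intro!: mult_right_mono q_nonneg)
  then have "cnorm a x \<le> max C D * cnorm k x" "cnorm b x \<le> max C D * cnorm k x" for x
    using C(2)[of x] D(2)[of x] order_trans by blast+
  then show ?thesis using C k(1) by (intro bexI[of _ k] exI[of _ "max C D"]) auto
qed

definition cnorm_open :: "'a set \<Rightarrow> bool" where
  "cnorm_open U \<longleftrightarrow> (\<forall>x\<in>U. \<exists>a\<in>I. \<exists>r>0. \<forall>y. cnorm a (y - x) < r \<longrightarrow> y \<in> U)"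

lemma istopology_cnorm_open: "istopology cnorm_open"
  unfolding istopology_def
proof (intro conjI allI impI)
  fix S T assume S: "cnorm_open S" and T: "cnorm_open T"
  show "cnorm_open (S \<inter> T)" unfolding cnorm_open_def
  proof
    fix x assume x: "x \<in> S \<inter> T"
    obtain a r where a: "a \<in> I" "r > 0" "\<And>y. cnorm a (y - x) < r \<Longrightarrow> y \<in> S"
      using S x unfolding cnorm_open_def by blast
    obtain b s where b: "b \<in> I" "s > 0" "\<And>y. cnorm b (y - x) < s \<Longrightarrow> y \<in> T"
      using T x unfolding cnorm_open_def by blast
    obtain k C where k: "k \<in> I" "C \<ge> 0" "\<And>x. cnorm a x \<le> C * cnorm k x \<and> cnorm b x \<le> C * cnorm k x"
      using cnorm_directed[OF a(1) b(1)] by blast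
    interpret submult_seminorm m e UNIV "cnorm k" by (rule cnorm_submult[OF k(1)])
    have "y \<in> S \<inter> T" if y: "cnorm k (y - x) < min r s / (C + 1)" for y
    proof -
      have "(C + 1) * cnorm k (y - x) < min r s" using y k(2) by (simp add: field_simps)
      moreover have "C * cnorm k (y - x) \<le> (C + 1) * cnorm k (y - x)"
        by (intro mult_right_mono q_nonneg) auto
      ultimately have "C * cnorm k (y - x) < min r s" by linarith
      then show ?thesis using k(3)[of "y - x"] a(3)[of y] b(3)[of y] by auto
    qed
    moreover have "0 < min r s / (C + 1)" using a b k by auto
    ultimately show "\<exists>a\<in>I. \<exists>r>0. \<forall>y. cnorm a (y - x) < r \<longrightarrow> y \<in> S \<inter> T" using k(1) by blast
  qed
next
  fix K assume "\<forall>T\<in>K. cnorm_open T"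
  then show "cnorm_open (\<Union>K)" unfolding cnorm_open_def by (meson Union_iff)
qed

lemma open_ball_cnorm:
  assumes "a \<in> I"
  shows "open {y. cnorm a (y - x) < r}"
proof -
  interpret real_normed_module "E a" "\<nu> a" by (rule normed[OF assms])
  have "continuous_map euclidean ltop \<phi>"
    by (rule homeomorphic_imp_continuous_map[OF homeo])
  then have "continuous_map euclidean (product_topology (\<lambda>a. ntop a) I) \<phi>"
    by (simp add: proj_lim_topology_def continuous_map_in_subtopology)
  then have "continuous_map euclidean (ntop a) (\<lambda>y. \<phi> y a)"
    using assms by (simp add: continuous_map_componentwise)
  from openin_continuous_map_preimage[OF this openin_norm_ball[OF \<phi>_in[OF assms, of x], of r]]
  show ?thesis using \<phi>_in[OF assms] by (simp add: cnorm_diff[OF assms])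
qed

text \<open>
  The sets that are open for the seminorms form a topology, which is the coarsest one making all
  components continuous. This avoids the finite boxes of the product topology.
\<close>

lemma open_iff_cnorm_open: "open U \<longleftrightarrow> cnorm_open U"
proof
  assume U: "open U"
  have T: "openin (topology cnorm_open) V \<longleftrightarrow> cnorm_open V" for V
    using topology_inverse'[OF istopology_cnorm_open] by simp
  have top: "topspace (topology cnorm_open) = UNIV"
  proof -
    have "cnorm_open UNIV" using I_nonempty by (auto simp: cnorm_open_def intro: exI[of _ "1::real"])
    then show ?thesis using T openin_subset by blast
  qed
  have "continuous_map (topology cnorm_open) (ntop a) (\<lambda>y. \<phi> y a)" if a: "a \<in> I" for a
  proof -
    interpret real_normed_module "E a" "\<nu> a" by (rule normed[OF a])
    have "cnorm_open {x. \<phi> x a \<in> V}" if V: "openin (ntop a) V" for V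
      unfolding cnorm_open_def
    proof
      fix x assume "x \<in> {x. \<phi> x a \<in> V}"
      then obtain r where "r > 0" "\<And>y. y \<in> carrier (E a) \<Longrightarrow> \<nu> a (y \<ominus>\<^bsub>E a\<^esub> \<phi> x a) < r \<Longrightarrow> y \<in> V"
        using V unfolding openin_norm_topology by blast
      then show "\<exists>a'\<in>I. \<exists>r>0. \<forall>y. cnorm a' (y - x) < r \<longrightarrow> y \<in> {x. \<phi> x a \<in> V}"
        using a \<phi>_in[OF a] by (auto simp: cnorm_diff intro!: bexI[of _ a] exI[of _ r])
    qed
    then show ?thesis using \<phi>_in[OF a] by (auto simp: continuous_map_def top T)
  qed
  moreover have "\<phi> x \<in> extensional I" for x
    using \<phi>_carrier[of x] by (auto simp: proj_lim_def PiE_def)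
  ultimately have cont: "continuous_map (topology cnorm_open) ltop \<phi>"
    using \<phi>_carrier
    by (auto simp: proj_lim_topology_def continuous_map_in_subtopology continuous_map_componentwise)
  have "openin ltop (\<phi> ` U)"
    using homeomorphic_imp_open_map[OF homeo] U by (auto simp: open_map_def)
  from openin_continuous_map_preimage[OF cont this]
  have "cnorm_open {x. \<phi> x \<in> \<phi> ` U}" by (simp add: T top)
  moreover have "{x. \<phi> x \<in> \<phi> ` U} = U" using \<phi>_inj by blast
  ultimately show "cnorm_open U" by simp
next
  assume U: "cnorm_open U"
  have "\<exists>V. open V \<and> x \<in> V \<and> V \<subseteq> U" if x: "x \<in> U" for x
  proof -
    obtain a r where a: "a \<in> I" "r > 0" "\<And>y. cnorm a (y - x) < r \<Longrightarrow> y \<in> U"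
      using U x unfolding cnorm_open_def by blast
    interpret submult_seminorm m e UNIV "cnorm a" by (rule cnorm_submult[OF a(1)])
    show ?thesis using open_ball_cnorm[OF a(1), of x r] a q_zero by (intro exI[of _ "{y. cnorm a (y - x) < r}"]) auto
  qed
  then show "open U" by (metis openI open_subopen)
qed

text \<open>
  The component limits are compatible because the connecting maps are bounded.
\<close>

lemma cnorm_complete:
  assumes cauchy: "\<And>a \<epsilon>. \<lbrakk>a \<in> I; 0 < \<epsilon>\<rbrakk> \<Longrightarrow> \<exists>N. \<forall>i\<ge>N. \<forall>j\<ge>N. cnorm a (X i - X j) < \<epsilon>"
  shows "\<exists>x. \<forall>a\<in>I. (\<lambda>n::nat. cnorm a (X n - x)) \<longlonglongrightarrow> 0"
proof -
  have "\<exists>y\<in>carrier (E a). (\<lambda>n. \<nu> a (\<phi> (X n) a \<ominus>\<^bsub>E a\<^esub> y)) \<longlonglongrightarrow> 0" if a: "a \<in> I" for a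
  proof -
    interpret real_normed_module "E a" "\<nu> a" by (rule normed[OF a])
    have "metric.mcomplete" using banach[OF a] by (simp add: banach_jordan_algebra_def)
    then show ?thesis
      using \<phi>_in[OF a] cauchy[OF a] unfolding mcomplete_norm_iff cnorm_diff[OF a]
      by (elim allE[of _ "\<lambda>n. \<phi> (X n) a"]) blast
  qed
  then obtain y where y: "\<And>a. a \<in> I \<Longrightarrow> y a \<in> carrier (E a)"
    "\<And>a. a \<in> I \<Longrightarrow> (\<lambda>n. \<nu> a (\<phi> (X n) a \<ominus>\<^bsub>E a\<^esub> y a)) \<longlonglongrightarrow> 0" by metis
  have coh: "y a = g a b (y b)" if ab: "a \<in> I" "b \<in> I" "leq a b" for a b
  proof -
    interpret a: real_normed_module "E a" "\<nu> a" by (rule normed[OF ab(1)])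
    interpret b: real_normed_module "E b" "\<nu> b" by (rule normed[OF ab(2)])
    obtain C where C: "C \<ge> 0" "\<And>y. y \<in> carrier (E b) \<Longrightarrow> \<nu> a (g a b y) \<le> C * \<nu> b y"
      using g_bounded[OF ab] by blast
    have g: "g a b y \<in> carrier (E a)" "g a b (c \<odot>\<^bsub>E b\<^esub> y) = c \<odot>\<^bsub>E a\<^esub> g a b y"
      if "y \<in> carrier (E b)" for y c
      using g_hom[OF ab] that by (auto simp: jordan_hom_def ring_hom_def)
    have g_add: "g a b (y \<oplus>\<^bsub>E b\<^esub> z) = g a b y \<oplus>\<^bsub>E a\<^esub> g a b z"
      if "y \<in> carrier (E b)" "z \<in> carrier (E b)" for y z
      using g_hom[OF ab] that by (auto simp: jordan_hom_def ring_hom_def)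
    have g_diff: "g a b (y \<ominus>\<^bsub>E b\<^esub> z) = g a b y \<ominus>\<^bsub>E a\<^esub> g a b z"
      if "y \<in> carrier (E b)" "z \<in> carrier (E b)" for y z
    proof -
      have "g a b (\<ominus>\<^bsub>E b\<^esub> z) = \<ominus>\<^bsub>E a\<^esub> g a b z"
        using g(2)[OF that(2), of "- 1"] a.smult_minus_1[OF g(1)[OF that(2)]]
          b.smult_minus_1[OF that(2)] by simp
      then show ?thesis using g_add[OF that(1), of "\<ominus>\<^bsub>E b\<^esub> z"] that
        by (simp add: a.minus_eq b.minus_eq)
    qed
    have le: "\<nu> a (\<phi> (X n) a \<ominus>\<^bsub>E a\<^esub> g a b (y b)) \<le> C * \<nu> b (\<phi> (X n) b \<ominus>\<^bsub>E b\<^esub> y b)" for n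
      using C(2)[of "\<phi> (X n) b \<ominus>\<^bsub>E b\<^esub> y b"] g_diff[OF \<phi>_in[OF ab(2)] y(1)[OF ab(2)]]
        \<phi>_in[OF ab(2)] y(1)[OF ab(2)] \<phi>_g[OF ab] by simp
    have gy: "g a b (y b) \<in> carrier (E a)" using g y(1)[OF ab(2)] by simp
    have "(\<lambda>n. \<nu> a (\<phi> (X n) a \<ominus>\<^bsub>E a\<^esub> y a) + C * \<nu> b (\<phi> (X n) b \<ominus>\<^bsub>E b\<^esub> y b)) \<longlonglongrightarrow> 0 + C * 0"
      by (intro tendsto_intros y ab)
    moreover have "\<nu> a (y a \<ominus>\<^bsub>E a\<^esub> g a b (y b))
        \<le> \<nu> a (\<phi> (X n) a \<ominus>\<^bsub>E a\<^esub> y a) + C * \<nu> b (\<phi> (X n) b \<ominus>\<^bsub>E b\<^esub> y b)" for n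
      using le[of n] a.p_dist[OF y(1)[OF ab(1)] \<phi>_in[OF ab(1)] gy, of "X n"]
        a.p_diff_sym[OF y(1)[OF ab(1)] \<phi>_in[OF ab(1)], of "X n"] by linarith
    ultimately have "\<nu> a (y a \<ominus>\<^bsub>E a\<^esub> g a b (y b)) \<le> 0"
      by (intro LIMSEQ_le_const[where X = "\<lambda>n. \<nu> a (\<phi> (X n) a \<ominus>\<^bsub>E a\<^esub> y a) + C * \<nu> b (\<phi> (X n) b \<ominus>\<^bsub>E b\<^esub> y b)"]) auto
    then have "\<nu> a (y a \<ominus>\<^bsub>E a\<^esub> g a b (y b)) = 0"
      using a.p_nonneg[of "y a \<ominus>\<^bsub>E a\<^esub> g a b (y b)"] gy y(1)[OF ab(1)] by simp
    then show ?thesis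
      using a.p_eq_0[of "y a \<ominus>\<^bsub>E a\<^esub> g a b (y b)"] a.diff_eq_0 gy y(1)[OF ab(1)] by simp
  qed
  define z where "z = (\<lambda>a\<in>I. y a)"
  have "z \<in> carrier L"
    using y(1) coh by (auto simp: proj_lim_def z_def)
  then obtain x where "\<phi> x = z" using \<phi>_surj by blast
  then have "(\<lambda>n. cnorm a (X n - x)) \<longlonglongrightarrow> 0" if "a \<in> I" for a
    using y(2)[OF that] that by (simp add: cnorm_diff z_def)
  then show ?thesis by blast
qed

lemma cnorm_coherent:
  assumes coh: "\<And>q q' C. \<lbrakk>q \<in> cnorm ` I; q' \<in> cnorm ` I; 0 \<le> C; \<And>x. q x \<le> C * q' x\<rbrakk> \<Longrightarrow> q (xs q' - xs q) = 0"
  shows "\<exists>x. \<forall>q\<in>cnorm ` I. q (x - xs q) = 0"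
proof -
  define z where "z = (\<lambda>a\<in>I. \<phi> (xs (cnorm a)) a)"
  have "z a = g a b (z b)" if ab: "a \<in> I" "b \<in> I" "leq a b" for a b
  proof -
    interpret a: real_normed_module "E a" "\<nu> a" by (rule normed[OF ab(1)])
    obtain C where "C \<ge> 0" "\<And>x. cnorm a x \<le> C * cnorm b x" using cnorm_mono[OF ab] by blast
    then have "cnorm a (xs (cnorm b) - xs (cnorm a)) = 0" using coh[of "cnorm a" "cnorm b" C] ab by simp
    then have "\<phi> (xs (cnorm b)) a = \<phi> (xs (cnorm a)) a"
      using a.p_eq_0[of "\<phi> (xs (cnorm b)) a \<ominus>\<^bsub>E a\<^esub> \<phi> (xs (cnorm a)) a"] a.diff_eq_0 \<phi>_in[OF ab(1)]
      by (simp add: cnorm_diff[OF ab(1)])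
    then show ?thesis using ab \<phi>_g[OF ab] by (simp add: z_def)
  qed
  then have "z \<in> carrier L" using \<phi>_in by (auto simp: proj_lim_def z_def)
  then obtain x where x: "\<phi> x = z" using \<phi>_surj by blast
  have "cnorm a (x - xs (cnorm a)) = 0" if a: "a \<in> I" for a
  proof -
    interpret a: real_normed_module "E a" "\<nu> a" by (rule normed[OF a])
    have "\<phi> x a = \<phi> (xs (cnorm a)) a" using x a by (simp add: z_def)
    then show ?thesis using a \<phi>_in[OF a] a.p_zero by (simp add: cnorm_diff a.diff_self)
  qed
  then show ?thesis by blast
qed

theorem presentation: "seminorm_presentation m e (cnorm ` I)"
proof (intro seminorm_presentation.intro seminorm_presentation_axioms.intro)
  show "jordan_product m e" by (rule jordan_product_axioms)
  show "cnorm ` I \<noteq> {}" using I_nonempty by simp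
  show "submult_seminorm m e UNIV q" if "q \<in> cnorm ` I" for q using that cnorm_submult by auto
  show "\<exists>q3\<in>cnorm ` I. \<exists>C\<ge>0. \<forall>x. q1 x \<le> C * q3 x \<and> q2 x \<le> C * q3 x"
    if "q1 \<in> cnorm ` I" "q2 \<in> cnorm ` I" for q1 q2 using that cnorm_directed by blast
  show "x = 0" if x: "\<And>q. q \<in> cnorm ` I \<Longrightarrow> q x = 0" for x
  proof (rule \<phi>_inj, rule ext)
    fix a
    show "\<phi> x a = \<phi> 0 a"
    proof (cases "a \<in> I")
      case True
      interpret a: real_normed_module "E a" "\<nu> a" by (rule normed[OF True])
      have "cnorm a (x - 0) = 0" using x True by simp
      then show ?thesis unfolding cnorm_diff[OF True]
        using a.p_eq_0[of "\<phi> x a \<ominus>\<^bsub>E a\<^esub> \<phi> 0 a"] a.diff_eq_0 \<phi>_in[OF True] by simp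
    next
      case False
      then show ?thesis using \<phi>_carrier[of x] \<phi>_carrier[of 0] by (auto simp: proj_lim_def PiE_def extensional_def)
    qed
  qed
  show "open U \<longleftrightarrow> (\<forall>x\<in>U. \<exists>q\<in>cnorm ` I. \<exists>r>0. \<forall>y. q (y - x) < r \<longrightarrow> y \<in> U)" for U
    by (simp add: open_iff_cnorm_open cnorm_open_def)
  show "\<exists>x. \<forall>q\<in>cnorm ` I. (\<lambda>n. q (X n - x)) \<longlonglongrightarrow> 0"
    if "\<And>q \<epsilon>. \<lbrakk>q \<in> cnorm ` I; 0 < \<epsilon>\<rbrakk> \<Longrightarrow> \<exists>N. \<forall>i\<ge>N. \<forall>j\<ge>N. q (X i - X j) < \<epsilon>" for X
    using cnorm_complete[of X] that by auto
  show "\<exists>x. \<forall>q\<in>cnorm ` I. q (x - xs q) = 0"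
    if "\<And>q q' C. \<lbrakk>q \<in> cnorm ` I; q' \<in> cnorm ` I; 0 \<le> C; \<And>x. q x \<le> C * q' x\<rbrakk> \<Longrightarrow> q (xs q' - xs q) = 0" for xs
    using cnorm_coherent[of xs] that by blast
qed

end

section \<open>Quotients by kernels of seminorms\<close>

text \<open>
  The class of \<open>x\<close> modulo the kernel of \<open>p\<close>, each element of the class being encoded as a constant
  sequence. The left summand is there to embed the classes in a type with an arbitrary component.
\<close>

definition ker_class :: "('a \<Rightarrow> real) \<Rightarrow> 'a::real_vector \<Rightarrow> 'e + (nat \<Rightarrow> 'a) set" where
  "ker_class p x = Inr ((\<lambda>y _. y) ` {y. p (y - x) = 0})"

definition ker_rep :: "('a \<Rightarrow> real) \<Rightarrow> 'e + (nat \<Rightarrow> 'a) set \<Rightarrow> 'a::real_vector" where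
  "ker_rep p A = (SOME x. ker_class p x = A)"

definition quotient_algebra ::
    "('a \<Rightarrow> 'a \<Rightarrow> 'a) \<Rightarrow> 'a \<Rightarrow> ('a \<Rightarrow> real) \<Rightarrow> (real, 'e + (nat \<Rightarrow> 'a::real_vector) set) module" where
  "quotient_algebra m e p =
    \<lparr>carrier = range (ker_class p),
     monoid.mult = (\<lambda>A B. ker_class p (m (ker_rep p A) (ker_rep p B))),
     one = ker_class p e,
     zero = ker_class p 0,
     add = (\<lambda>A B. ker_class p (ker_rep p A + ker_rep p B)),
     module.smult = (\<lambda>c A. ker_class p (c *\<^sub>R ker_rep p A))\<rparr>"

definition quotient_norm :: "('a \<Rightarrow> real) \<Rightarrow> 'e + (nat \<Rightarrow> 'a::real_vector) set \<Rightarrow> real" where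
  "quotient_norm p A = p (ker_rep p A)"

locale kernel_quotient = submult_seminorm m e UNIV q
  for m :: "'a::real_vector \<Rightarrow> 'a \<Rightarrow> 'a" and e and q :: "'a \<Rightarrow> real" +
  fixes ty :: "'e itself"
begin

abbreviation (input) quot :: "(real, 'e + (nat \<Rightarrow> 'a) set) module" where
  "quot \<equiv> quotient_algebra m e q"

abbreviation (input) cl :: "'a \<Rightarrow> 'e + (nat \<Rightarrow> 'a) set" where
  "cl \<equiv> ker_class q"

lemma ker_class_eq_iff: "cl x = cl y \<longleftrightarrow> q (x - y) = 0"
proof
  define K where "K z = (\<lambda>(y :: 'a) (_ :: nat). y) ` {y. q (y - z) = 0}" for z
  assume "cl x = cl y"
  then have "K x = K y" by (simp add: ker_class_def K_def)
  moreover have "(\<lambda>_. x) \<in> K x" using q_zero by (auto simp: K_def)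
  ultimately have "(\<lambda>_. x) \<in> K y" by simp
  then obtain z where "q (z - y) = 0" "(\<lambda>_ :: nat. x) = (\<lambda>_. z)" by (auto simp: K_def)
  then show "q (x - y) = 0" by (metis (full_types))
next
  assume xy: "q (x - y) = 0"
  have "q (z - x) = 0 \<longleftrightarrow> q (z - y) = 0" for z
    using q_eq[of "z - x" "z - y"] xy q_sym[of x y] by simp
  then show "cl x = cl y" by (simp add: ker_class_def)
qed

lemma ker_rep: "q (ker_rep q (cl x) - x) = 0"
proof -
  have "cl (ker_rep q (cl x)) = (cl x)"
    unfolding ker_rep_def by (rule someI[of _ x]) simp
  then show ?thesis by (simp add: ker_class_eq_iff)
qed

lemma ker_class_rep: "A \<in> range (cl) \<Longrightarrow> cl (ker_rep q A) = A"
  using ker_rep ker_class_eq_iff by auto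

lemma quotient_norm_class: "quotient_norm q (cl x) = q x"
  unfolding quotient_norm_def using q_eq[OF _ _ ker_rep] by simp

lemma quotient_carrier: "carrier quot = range cl"
  and quotient_one: "\<one>\<^bsub>quot\<^esub> = cl e"
  and quotient_zero: "\<zero>\<^bsub>quot\<^esub> = cl 0"
  by (simp_all add: quotient_algebra_def)

lemma quotient_mult: "cl x \<otimes>\<^bsub>quot\<^esub> cl y = cl (m x y)"
  using q_cong_mult[OF _ _ _ _ ker_rep ker_rep]
  by (simp add: quotient_algebra_def ker_class_eq_iff)

lemma quotient_add: "cl x \<oplus>\<^bsub>quot\<^esub> cl y = cl (x + y)"
proof -
  let ?x = "ker_rep q (cl x)" and ?y = "ker_rep q (cl y)"
  have "q ((?x - x) + (?y - y)) \<le> q (?x - x) + q (?y - y)" by (rule q_add) simp_all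
  then have "q ((?x - x) + (?y - y)) \<le> 0" by (simp only: ker_rep add_0)
  moreover have "(?x - x) + (?y - y) = (?x + ?y) - (x + y)" by simp
  ultimately have "q ((?x + ?y) - (x + y)) = 0"
    using q_nonneg[of "(?x + ?y) - (x + y)"] by simp
  then show ?thesis by (simp add: quotient_algebra_def ker_class_eq_iff)
qed

lemma quotient_smult: "c \<odot>\<^bsub>quot\<^esub> cl x = cl (c *\<^sub>R x)"
proof -
  let ?x = "ker_rep q (cl x)"
  have "q (c *\<^sub>R (?x - x)) = \<bar>c\<bar> * q (?x - x)" by (rule q_scale) simp
  then have "q (c *\<^sub>R ?x - c *\<^sub>R x) = 0" by (simp only: ker_rep scaleR_diff_right mult_zero_right)
  then show ?thesis by (simp add: quotient_algebra_def ker_class_eq_iff)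
qed

lemmas quotient_simps = quotient_carrier quotient_one quotient_zero quotient_mult quotient_add
  quotient_smult

lemma jordan_quotient: "jordan_algebra quot"
proof (intro jordan_algebra.intro jordan_algebra_axioms.intro moduleI cring_real_ring abelian_groupI)
  fix x y assume "x \<in> carrier quot" "y \<in> carrier quot"
  then show "x \<otimes>\<^bsub>quot\<^esub> x \<otimes>\<^bsub>quot\<^esub> (y \<otimes>\<^bsub>quot\<^esub> x) = x \<otimes>\<^bsub>quot\<^esub> x \<otimes>\<^bsub>quot\<^esub> y \<otimes>\<^bsub>quot\<^esub> x"
    by (auto simp: quotient_simps jordan_id)
  show "x \<otimes>\<^bsub>quot\<^esub> y = y \<otimes>\<^bsub>quot\<^esub> x"
    using \<open>x \<in> carrier quot\<close> \<open>y \<in> carrier quot\<close> by (auto simp: quotient_simps m_comm)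
next
  fix x assume "x \<in> carrier quot"
  then obtain a where "x = cl a" by (auto simp: quotient_carrier)
  then show "\<exists>y\<in>carrier quot. y \<oplus>\<^bsub>quot\<^esub> x = \<zero>\<^bsub>quot\<^esub>"
    by (intro bexI[of _ "cl (- a)"]) (auto simp: quotient_simps)
qed (auto simp: quotient_simps add_ac m_bilinear scaleR_add_left scaleR_add_right)

lemma norm_quotient: "alg_norm quot (quotient_norm q)"
  using q_nonneg q_add q_scale q_zero
  by (auto simp: alg_norm_def alg_seminorm_def quotient_simps quotient_norm_class
      ker_class_eq_iff)

lemma normed_quotient: "real_normed_module quot (quotient_norm q)"
  by (intro real_normed_moduleI jordan_quotient norm_quotient)

lemma quotient_diff: "cl x \<ominus>\<^bsub>quot\<^esub> cl y = cl (x - y)"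
proof -
  interpret n: real_normed_module quot "quotient_norm q" by (rule normed_quotient)
  have "\<ominus>\<^bsub>quot\<^esub> cl y = cl (- y)"
    using n.smult_minus_1[of "cl y", symmetric] by (simp add: quotient_simps)
  then show ?thesis by (simp add: n.minus_eq quotient_add)
qed

end

section \<open>Reconstruction of the projective limit\<close>

locale JB_presentation = seminorm_presentation m e Q
  for m :: "'a::{real_vector, topological_space} \<Rightarrow> 'a \<Rightarrow> 'a" and e and Q +
  assumes JB: "q \<in> Q \<Longrightarrow> JB_seminorm_on m e UNIV q"
begin

sublocale family: complete_JB_family m e UNIV Q
  using JB complete by unfold_locales (auto simp: jordan_subalgebra_def)

text \<open>
  Pass to a subsequence whose increments \<open>d k\<close> satisfy \<open>p (d k) < (1/2)^k\<close>. The truncation \<open>y k\<close> of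
  \<open>d k\<close> at \<open>(1/2)^k\<close> is congruent to \<open>d k\<close> modulo the kernel of \<open>p\<close> and small in every seminorm, so the
  series of the \<open>y k\<close> converges.
\<close>

lemma quotient_complete:
  assumes p: "p \<in> Q" and cauchy: "\<And>r. 0 < r \<Longrightarrow> \<exists>N. \<forall>i\<ge>N. \<forall>j\<ge>N. p (x i - x j) < (r::real)"
  shows "\<exists>z. (\<lambda>n::nat. p (x n - z)) \<longlonglongrightarrow> 0"
proof -
  interpret p: submult_seminorm m e UNIV p by (rule submult[OF p])
  have "\<forall>k. \<exists>N. \<forall>i\<ge>N. \<forall>j\<ge>N. p (x i - x j) < (1/2) ^ k" using cauchy by simp
  then obtain N where N: "\<And>k i j. i \<ge> N k \<Longrightarrow> j \<ge> N k \<Longrightarrow> p (x i - x j) < (1/2) ^ k" by metis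
  \<comment> \<open>Summing makes the thresholds monotone.\<close>
  define K where "K k = (\<Sum>i\<le>k. N i)" for k
  have K_mono: "K k \<le> K l" if "k \<le> l" for k l
    unfolding K_def using that by (intro sum_mono2) auto
  have K: "N k \<le> K k" for k unfolding K_def by (intro member_le_sum) auto
  have small: "p (x i - x j) < (1/2) ^ k" if "i \<ge> K k" "j \<ge> K k" for i j k
    using N[of k i j] K[of k] that by simp
  define d where "d k = x (K (Suc k)) - x (K k)" for k
  have d: "p (d k) < (1/2) ^ k" for k unfolding d_def by (rule small) (auto intro: K_mono)
  have "\<exists>y. (\<forall>q\<in>Q. q y \<le> (1/2) ^ k) \<and> p (d k - y) = 0" for k
    using family.clamp_ex[of "d k" "(1/2) ^ k"] p d[of k] by auto
  then obtain y where y: "\<And>q k. q \<in> Q \<Longrightarrow> q (y k) \<le> (1/2) ^ k" "\<And>k. p (d k - y k) = 0" by metis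
  define Z where "Z n = (\<Sum>k<n. y k)" for n
  have Zdiff: "q (Z (n + l) - Z n) \<le> 2 * (1/2) ^ n" if q: "q \<in> Q" for q n l
  proof -
    interpret q: submult_seminorm m e UNIV q by (rule submult[OF q])
    have "q (Z (n + l) - Z n) \<le> 2 * (1/2) ^ n - 2 * (1/2) ^ (n + l)"
    proof (induction l)
      case 0
      then show ?case by (simp add: q.q_zero)
    next
      case (Suc l)
      have eq: "Z (n + Suc l) - Z n = (Z (n + l) - Z n) + y (n + l)" by (simp add: Z_def)
      have "q (Z (n + Suc l) - Z n) \<le> q (Z (n + l) - Z n) + (1/2) ^ (n + l)"
        unfolding eq
        using q.q_add[of "Z (n + l) - Z n" "y (n + l)"] y(1)[OF q, of "n + l"] by simp
      then show ?case using Suc by simp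
    qed
    moreover have "0 \<le> (1/2::real) ^ (n + l)" by simp
    ultimately show ?thesis by linarith
  qed
  have "\<exists>z. \<forall>q\<in>Q. (\<lambda>n. q (Z n - z)) \<longlonglongrightarrow> 0"
  proof (rule complete)
    fix q and r :: real assume q: "q \<in> Q" and r: "0 < r"
    interpret q: submult_seminorm m e UNIV q by (rule submult[OF q])
    have "(\<lambda>n. 4 * (1/2::real) ^ n) \<longlonglongrightarrow> 4 * 0" by (intro tendsto_intros LIMSEQ_power_zero) auto
    then have "\<forall>\<^sub>F n in sequentially. 4 * (1/2::real) ^ n < r" using r by (intro order_tendstoD) auto
    then obtain n where n: "4 * (1/2::real) ^ n < r" by (auto simp: eventually_sequentially)
    have "q (Z i - Z j) < r" if "i \<ge> n" "j \<ge> n" for i j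
      using q.q_dist[of "Z i" "Z n" "Z j"] q.q_sym[of "Z n" "Z j"] n
        Zdiff[OF q, of n "i - n"] Zdiff[OF q, of n "j - n"] that by simp
    then show "\<exists>N. \<forall>i\<ge>N. \<forall>j\<ge>N. q (Z i - Z j) < r" by blast
  qed
  then obtain z where "(\<lambda>n. p (Z n - z)) \<longlonglongrightarrow> 0" using p by blast
  moreover have "p (x (K n) - (x (K 0) + z)) = p (Z n - z)" for n
  proof -
    have "p (x (K n) - x (K 0) - Z n) = 0"
    proof (induction n)
      case 0
      then show ?case by (simp add: Z_def p.q_zero)
    next
      case (Suc n)
      have eq: "x (K (Suc n)) - x (K 0) - Z (Suc n) = (x (K n) - x (K 0) - Z n) + (d n - y n)"
        by (simp add: d_def Z_def)
      have "p (x (K (Suc n)) - x (K 0) - Z (Suc n)) \<le> 0"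
        unfolding eq using p.q_add[of "x (K n) - x (K 0) - Z n" "d n - y n"] Suc y(2)[of n] by simp
      then show ?case using p.q_nonneg[of "x (K (Suc n)) - x (K 0) - Z (Suc n)"] by simp
    qed
    then show ?thesis
      using p.q_eq[of "x (K n) - (x (K 0) + z)" "Z n - z"] by (simp add: algebra_simps)
  qed
  ultimately have lim: "(\<lambda>n. p (x (K n) - (x (K 0) + z))) \<longlonglongrightarrow> 0" by simp
  have "(\<lambda>n. p (x n - (x (K 0) + z))) \<longlonglongrightarrow> 0"
  proof (rule LIMSEQ_I)
    fix r :: real assume r: "0 < r"
    have "(\<lambda>n. (1/2::real) ^ n) \<longlonglongrightarrow> 0" by (intro LIMSEQ_power_zero) auto
    then have "\<forall>\<^sub>F n in sequentially. (1/2::real) ^ n < r / 2 \<and> p (x (K n) - (x (K 0) + z)) < r / 2"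
      using r lim by (intro eventually_conj order_tendstoD) auto
    then obtain k where k: "(1/2::real) ^ k < r / 2" "p (x (K k) - (x (K 0) + z)) < r / 2"
      by (auto simp: eventually_sequentially)
    have "norm (p (x n - (x (K 0) + z)) - 0) < r" if "n \<ge> K k" for n
      using small[of k n "K k"] that k p.q_dist[of "x n" "x (K k)" "x (K 0) + z"]
        p.q_nonneg[of "x n - (x (K 0) + z)"] by simp
    then show "\<exists>N. \<forall>n\<ge>N. norm (p (x n - (x (K 0) + z)) - 0) < r" by blast
  qed
  then show ?thesis by blast
qed

end

context JB_presentation
begin

lemma quotient_JB:
  assumes p: "p \<in> Q"
  shows "JB_algebra (quotient_algebra m e p :: (real, 'e + (nat \<Rightarrow> 'a) set) module) (quotient_norm p)"
proof -
  interpret submult_seminorm m e UNIV p by (rule submult[OF p])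
  interpret JB: JB_seminorm m e UNIV p by (rule family.JB_seminorm[OF p])
  interpret kernel_quotient m e p "TYPE('e)" by unfold_locales
  interpret n: real_normed_module quot "quotient_norm p" by (rule normed_quotient)
  have "n.metric.mcomplete"
    unfolding n.mcomplete_norm_iff
  proof (intro allI impI, elim conjE)
    fix X :: "nat \<Rightarrow> 'e + (nat \<Rightarrow> 'a) set"
    assume X: "\<forall>n. X n \<in> carrier quot"
      and cauchy: "\<forall>\<epsilon>>0. \<exists>N. \<forall>i\<ge>N. \<forall>j\<ge>N. quotient_norm p (X i \<ominus>\<^bsub>quot\<^esub> X j) < \<epsilon>"
    have "\<forall>n. \<exists>x. X n = cl x" using X by (auto simp: quotient_carrier)
    then obtain x where x: "\<And>n. X n = cl (x n)" by metis
    have "\<exists>z. (\<lambda>n. p (x n - z)) \<longlonglongrightarrow> 0"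
      using cauchy by (intro quotient_complete[OF p]) (simp add: x quotient_diff quotient_norm_class)
    then show "\<exists>z\<in>carrier quot. (\<lambda>n. quotient_norm p (X n \<ominus>\<^bsub>quot\<^esub> z)) \<longlonglongrightarrow> 0"
      by (auto simp: x quotient_diff quotient_norm_class quotient_carrier)
  qed
  moreover have "submultiplicative quot (quotient_norm p)"
    using q_mult by (auto simp: submultiplicative_def quotient_simps quotient_norm_class)
  moreover have "(p a)\<^sup>2 \<le> p (m a a + m b b)" for a b
    using JB.fine[of a b] JB.square[of a] by simp
  ultimately show ?thesis
    using jordan_quotient norm_quotient JB.square
    by (auto simp: JB_algebra_def banach_jordan_algebra_def quotient_simps quotient_norm_class)
qed

end

text \<open>
  The index set is \<open>Q\<close> itself, ordered by domination up to a constant, and the factors are the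
  quotients by the kernels. The two type tokens only fix the types of indices and of factors.
\<close>

locale JB_presentation_limit = JB_presentation m e Q
  for m :: "'a::{real_vector, topological_space} \<Rightarrow> 'a \<Rightarrow> 'a" and e and Q +
  fixes ti :: "'i itself" and te :: "'e itself"
begin

definition I :: "('i + ('a \<Rightarrow> real)) set" where "I = Inr ` Q"

definition below :: "'i + ('a \<Rightarrow> real) \<Rightarrow> 'i + ('a \<Rightarrow> real) \<Rightarrow> bool" where
  "below i j \<longleftrightarrow> (\<exists>C\<ge>0. \<forall>x. projr i x \<le> C * projr j x)"

definition E :: "'i + ('a \<Rightarrow> real) \<Rightarrow> (real, 'e + (nat \<Rightarrow> 'a) set) module" where
  "E i = quotient_algebra m e (projr i)"

definition \<nu> :: "'i + ('a \<Rightarrow> real) \<Rightarrow> 'e + (nat \<Rightarrow> 'a) set \<Rightarrow> real" where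
  "\<nu> i = quotient_norm (projr i)"

definition pr :: "'i + ('a \<Rightarrow> real) \<Rightarrow> 'a \<Rightarrow> 'e + (nat \<Rightarrow> 'a) set" where
  "pr i = ker_class (projr i)"

definition g :: "'i + ('a \<Rightarrow> real) \<Rightarrow> 'i + ('a \<Rightarrow> real) \<Rightarrow> 'e + (nat \<Rightarrow> 'a) set \<Rightarrow> 'e + (nat \<Rightarrow> 'a) set" where
  "g i j A = pr i (ker_rep (projr j) A)"

definition \<phi> :: "'a \<Rightarrow> 'i + ('a \<Rightarrow> real) \<Rightarrow> 'e + (nat \<Rightarrow> 'a) set" where
  "\<phi> x = (\<lambda>i\<in>I. pr i x)"

abbreviation (input) ntop :: "'i + ('a \<Rightarrow> real) \<Rightarrow> ('e + (nat \<Rightarrow> 'a) set) topology" where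
  "ntop i \<equiv> norm_topology (E i) (\<nu> i)"

abbreviation (input) L :: "(real, 'i + ('a \<Rightarrow> real) \<Rightarrow> 'e + (nat \<Rightarrow> 'a) set) module" where
  "L \<equiv> proj_lim I below E g"

abbreviation (input) ltop :: "('i + ('a \<Rightarrow> real) \<Rightarrow> 'e + (nat \<Rightarrow> 'a) set) topology" where
  "ltop \<equiv> proj_lim_topology I below E \<nu> g"

lemma projr_I: "i \<in> I \<Longrightarrow> projr i \<in> Q"
  by (auto simp: I_def)

lemma kernel_quotient: "i \<in> I \<Longrightarrow> kernel_quotient m e (projr i)"
  by (intro kernel_quotient.intro submult projr_I)

lemma
  assumes i: "i \<in> I"
  shows pr_eq_iff: "pr i x = pr i y \<longleftrightarrow> projr i (x - y) = 0"
    and pr_rep: "projr i (ker_rep (projr i) (pr i x) - x) = 0"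
    and \<nu>_pr: "\<nu> i (pr i x) = projr i x"
    and E_carrier: "carrier (E i) = range (pr i)"
    and E_one: "\<one>\<^bsub>E i\<^esub> = pr i e"
    and E_mult: "pr i x \<otimes>\<^bsub>E i\<^esub> pr i y = pr i (m x y)"
    and E_add: "pr i x \<oplus>\<^bsub>E i\<^esub> pr i y = pr i (x + y)"
    and E_smult: "c \<odot>\<^bsub>E i\<^esub> pr i x = pr i (c *\<^sub>R x)"
    and E_diff: "pr i x \<ominus>\<^bsub>E i\<^esub> pr i y = pr i (x - y)"
    and normed: "real_normed_module (E i) (\<nu> i)"
  unfolding E_def \<nu>_def pr_def
  by (rule kernel_quotient.ker_class_eq_iff kernel_quotient.ker_rep kernel_quotient.quotient_norm_class
      kernel_quotient.quotient_carrier kernel_quotient.quotient_one kernel_quotient.quotient_mult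
      kernel_quotient.quotient_add kernel_quotient.quotient_smult kernel_quotient.quotient_diff
      kernel_quotient.normed_quotient, rule kernel_quotient[OF i])+

lemma JB_E: "i \<in> I \<Longrightarrow> JB_algebra (E i) (\<nu> i)"
  unfolding E_def \<nu>_def by (intro quotient_JB projr_I)

lemma g_pr:
  assumes "i \<in> I" "j \<in> I" "below i j"
  shows "g i j (pr j x) = pr i x"
proof -
  obtain C where C: "C \<ge> 0" "\<And>x. projr i x \<le> C * projr j x" using assms by (auto simp: below_def)
  interpret i: submult_seminorm m e UNIV "projr i" using submult projr_I assms by blast
  show ?thesis
    using C(2)[of "ker_rep (projr j) (pr j x) - x"] pr_rep[OF assms(2), of x]
      i.q_nonneg[of "ker_rep (projr j) (pr j x) - x"]
    by (simp add: g_def pr_eq_iff[OF assms(1)])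
qed

lemma g_continuous:
  assumes "i \<in> I" "j \<in> I" "below i j"
  shows "continuous_map (ntop j) (ntop i) (g i j)"
proof -
  interpret i: real_normed_module "E i" "\<nu> i" by (rule normed[OF assms(1)])
  interpret j: real_normed_module "E j" "\<nu> j" by (rule normed[OF assms(2)])
  interpret si: submult_seminorm m e UNIV "projr i" using submult projr_I assms by blast
  interpret sj: submult_seminorm m e UNIV "projr j" using submult projr_I assms by blast
  obtain C where C: "C \<ge> 0" "\<And>x. projr i x \<le> C * projr j x" using assms by (auto simp: below_def)
  have "openin (ntop j) {A \<in> carrier (E j). g i j A \<in> V}"
    if V: "openin (ntop i) V" for V
    unfolding j.openin_norm_topology
  proof (intro conjI ballI)
    fix A assume "A \<in> {A \<in> carrier (E j). g i j A \<in> V}"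
    then obtain x where x: "A = pr j x" "pr i x \<in> V"
      by (auto simp: E_carrier[OF assms(2)] g_pr[OF assms])
    then obtain r where r: "r > 0" "\<And>y. projr i (y - x) < r \<Longrightarrow> pr i y \<in> V"
      using V unfolding i.openin_norm_topology
      by (fastforce simp: E_carrier[OF assms(1)] E_diff[OF assms(1)] \<nu>_pr[OF assms(1)])
    have "pr i y \<in> V" if "projr j (y - x) < r / (C + 1)" for y
    proof (rule r(2))
      have "(C + 1) * projr j (y - x) < r" using that C(1) by (simp add: field_simps)
      moreover have "C * projr j (y - x) \<le> (C + 1) * projr j (y - x)"
        by (intro mult_right_mono sj.q_nonneg) auto
      ultimately show "projr i (y - x) < r" using C(2)[of "y - x"] by linarith
    qed
    then show "\<exists>r>0. \<forall>B\<in>carrier (E j). \<nu> j (B \<ominus>\<^bsub>E j\<^esub> A) < r \<longrightarrow> B \<in> {A \<in> carrier (E j). g i j A \<in> V}"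
      using r(1) C(1)
      by (intro exI[of _ "r / (C + 1)"])
        (auto simp: x E_carrier[OF assms(2)] E_diff[OF assms(2)] \<nu>_pr[OF assms(2)] g_pr[OF assms])
  qed auto
  then show ?thesis
    by (auto simp: continuous_map_def E_carrier assms g_pr)
qed

lemma family: "projective_family I below E \<nu> g"
  unfolding projective_family_def
proof (intro conjI ballI impI allI)
  show "I \<noteq> {}" using nonempty by (simp add: I_def)
  show "reflp_on I below" by (auto simp: reflp_on_def below_def intro: exI[of _ 1])
  show "transp_on I below"
  proof (rule transp_onI)
    fix i j k assume "below i j" "below j k"
    then obtain C D where C: "C \<ge> 0" "\<And>x. projr i x \<le> C * projr j x"
      and D: "D \<ge> 0" "\<And>x. projr j x \<le> D * projr k x" unfolding below_def by blast
    have "projr i x \<le> (C * D) * projr k x" for x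
      using C(2)[of x] mult_left_mono[OF D(2)[of x] C(1)] by (simp add: mult.assoc)
    then show "below i k" using C(1) D(1) unfolding below_def by (intro exI[of _ "C * D"]) auto
  qed
  show "\<exists>k\<in>I. below i k \<and> below j k" if "i \<in> I" "j \<in> I" for i j
    using directed[OF projr_I[OF that(1)] projr_I[OF that(2)]] that by (auto simp: below_def I_def)
  show "banach_jordan_algebra (E i) (\<nu> i)" if "i \<in> I" for i
    using JB_E[OF that] by (simp add: JB_algebra_def)
  show "continuous_map (ntop j) (ntop i) (g i j)"
    if "i \<in> I" "j \<in> I" "below i j" for i j by (rule g_continuous[OF that])
  show "g i j \<in> jordan_hom (E j) (E i)" if "i \<in> I" "j \<in> I" "below i j" for i j
    using that by (auto simp: jordan_hom_def ring_hom_def E_carrier E_one E_mult E_add E_smult g_pr)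
  show "g i i A = A" if "i \<in> I" "A \<in> carrier (E i)" for i A
  proof -
    have "below i i" by (auto simp: below_def intro: exI[of _ 1])
    then show ?thesis using that by (auto simp: E_carrier g_pr)
  qed
  show "g i k A = g i j (g j k A)"
    if "i \<in> I" "j \<in> I" "k \<in> I" "below i j \<and> below j k" "A \<in> carrier (E k)" for i j k A
  proof -
    have "below i k" using \<open>transp_on I below\<close> that by (auto dest: transp_onD)
    then show ?thesis using that by (auto simp: E_carrier g_pr)
  qed
qed

lemma hom: "\<phi> \<in> jordan_hom (type_algebra m e) (L)"
  by (auto simp: jordan_hom_def ring_hom_def proj_lim_def \<phi>_def type_algebra_def E_carrier E_one
      E_mult E_add E_smult g_pr intro!: restrict_ext)

lemma topspace_limit: "topspace ltop = carrier L"
  using real_normed_module.topspace_norm_topology[OF normed]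
  by (auto simp: proj_lim_topology_def proj_lim_def PiE_iff extensional_def)

lemma \<phi>_in: "\<phi> x \<in> carrier L"
  using hom by (auto simp: jordan_hom_def ring_hom_def type_algebra_def)

text \<open>
  Representatives of a compatible family of classes are coherent in the sense of the presentation.
\<close>

lemma \<phi>_surj: "range \<phi> = carrier L"
proof
  show "carrier L \<subseteq> range \<phi>"
  proof
    fix c assume c: "c \<in> carrier L"
    have "c i \<in> carrier (E i)" and cg: "j \<in> I \<Longrightarrow> below i j \<Longrightarrow> c i = g i j (c j)" if "i \<in> I" for i j
      using c that by (auto simp: proj_lim_def)
    then have cE: "c i \<in> range (pr i)" if "i \<in> I" for i
      using that E_carrier[OF that] by blast
    define xs where "xs p = ker_rep p (c (Inr p))" for p
    have pr_xs: "pr (Inr p) (xs p) = c (Inr p)" if p: "p \<in> Q" for p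
    proof -
      have i: "Inr p \<in> I" using p by (simp add: I_def)
      interpret kernel_quotient m e p "TYPE('e)" using kernel_quotient[OF i] by simp
      show ?thesis using ker_class_rep[of "c (Inr p)"] cE[OF i] by (simp add: pr_def xs_def)
    qed
    have "\<exists>x. \<forall>p\<in>Q. p (x - xs p) = 0"
    proof (rule coherent)
      fix p p' C assume p: "p \<in> Q" "p' \<in> Q" and C: "0 \<le> C" "\<And>x. p x \<le> C * p' x"
      let ?i = "Inr p :: 'i + ('a \<Rightarrow> real)" and ?j = "Inr p' :: 'i + ('a \<Rightarrow> real)"
      have ij: "?i \<in> I" "?j \<in> I" "below ?i ?j" using p C by (auto simp: I_def below_def)
      have "pr ?i (xs p) = pr ?i (xs p')"
        using cg[OF ij] pr_xs p g_pr[OF ij, of "xs p'"] by simp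
      then have "pr ?i (xs p') = pr ?i (xs p)" by simp
      then show "p (xs p' - xs p) = 0" using pr_eq_iff[OF ij(1)] by simp
    qed
    then obtain x where x: "\<And>p. p \<in> Q \<Longrightarrow> p (x - xs p) = 0" by blast
    have "c = \<phi> x"
    proof
      fix i show "c i = \<phi> x i"
      proof (cases "i \<in> I")
        case True
        then obtain p where p: "p \<in> Q" "i = Inr p" by (auto simp: I_def)
        then show ?thesis using pr_xs[OF p(1)] x[OF p(1)] pr_eq_iff[OF True, of x "xs p"] True
          by (simp add: \<phi>_def)
      next
        case False
        then show ?thesis using c by (auto simp: \<phi>_def proj_lim_def PiE_def extensional_def)
      qed
    qed
    then show "c \<in> range \<phi>" by blast
  qed
qed (use \<phi>_in in auto)

lemma \<phi>_inj: "inj \<phi>"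
proof (rule injI)
  fix x y assume eq: "\<phi> x = \<phi> y"
  have "p (x - y) = 0" if p: "p \<in> Q" for p
  proof -
    have i: "Inr p \<in> I" using p by (simp add: I_def)
    then have "pr (Inr p) x = pr (Inr p) y" using fun_cong[OF eq, of "Inr p"] by (simp add: \<phi>_def)
    then show ?thesis using pr_eq_iff[OF i] by simp
  qed
  then have "x - y = 0" by (rule separated)
  then show "x = y" by simp
qed

lemma homeomorphism: "homeomorphic_map euclidean ltop \<phi>"
proof (rule bijective_open_imp_homeomorphic_map)
  have "continuous_map euclidean (ntop i) (pr i)" if i: "i \<in> I" for i
  proof -
    interpret n: real_normed_module "E i" "\<nu> i" by (rule normed[OF i])
    have "open {x. pr i x \<in> V}" if V: "openin (ntop i) V" for V
      unfolding topology
    proof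
      fix x assume "x \<in> {x. pr i x \<in> V}"
      then obtain r where "r > 0" "\<And>y. projr i (y - x) < r \<Longrightarrow> pr i y \<in> V"
        using V unfolding n.openin_norm_topology by (fastforce simp: E_carrier E_diff \<nu>_pr i)
      then show "\<exists>q\<in>Q. \<exists>r>0. \<forall>y. q (y - x) < r \<longrightarrow> y \<in> {x. pr i x \<in> V}"
        using projr_I[OF i] by blast
    qed
    then show ?thesis by (auto simp: continuous_map_def E_carrier i)
  qed
  then show "continuous_map euclidean ltop \<phi>"
    using \<phi>_in by (auto simp: proj_lim_topology_def continuous_map_in_subtopology
        continuous_map_componentwise \<phi>_def)
  show "open_map euclidean ltop \<phi>"
    unfolding open_map_def
  proof (intro allI impI)
    fix U :: "'a set" assume "openin euclidean U"
    then have U: "open U" by simp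
    have "\<exists>W. openin ltop W \<and> \<phi> x \<in> W \<and> W \<subseteq> \<phi> ` U" if x: "x \<in> U" for x
    proof -
      obtain p r where p: "p \<in> Q" "r > 0" "\<And>y. p (y - x) < r \<Longrightarrow> y \<in> U"
        using U x unfolding topology by blast
      let ?i = "Inr p :: 'i + ('a \<Rightarrow> real)"
      have i: "?i \<in> I" using p by (simp add: I_def)
      interpret n: real_normed_module "E ?i" "\<nu> ?i" by (rule normed[OF i])
      interpret p: submult_seminorm m e UNIV p by (rule submult[OF p(1)])
      let ?V = "{A \<in> carrier (E ?i). \<nu> ?i (A \<ominus>\<^bsub>E ?i\<^esub> pr ?i x) < r}"
      define W where "W = {c \<in> topspace ltop. c ?i \<in> ?V}"
      have "continuous_map ltop (ntop ?i) (\<lambda>c. c ?i)"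
        unfolding proj_lim_topology_def
        by (intro continuous_map_from_subtopology continuous_map_product_projection i)
      then have "openin ltop W" unfolding W_def
        by (rule openin_continuous_map_preimage) (rule n.openin_norm_ball, simp add: E_carrier i)
      moreover have "\<phi> x \<in> W" using i p \<phi>_in[of x]
        by (simp add: W_def topspace_limit \<phi>_def E_carrier E_diff \<nu>_pr p.q_zero)
      moreover have "W \<subseteq> \<phi> ` U"
      proof
        fix c assume c: "c \<in> W"
        then obtain y where y: "c = \<phi> y" using \<phi>_surj by (auto simp: W_def topspace_limit)
        then have "p (y - x) < r" using c i by (simp add: W_def \<phi>_def E_diff \<nu>_pr)
        then show "c \<in> \<phi> ` U" using p(3) y by blast
      qed
      ultimately show ?thesis by blast
    qed
    then show "openin ltop (\<phi> ` U)"
      by (subst openin_subopen) blast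
  qed
  show "\<phi> ` topspace euclidean = topspace ltop"
    by (simp add: topspace_limit \<phi>_surj)
  show "inj_on \<phi> (topspace euclidean)" using \<phi>_inj by simp
qed

theorem projective_limit_of_JB:
  "projective_limit_of TYPE('i + ('a \<Rightarrow> real))
    (JB_algebra :: (real, 'e + (nat \<Rightarrow> 'a) set) module \<Rightarrow> _) m e"
  unfolding projective_limit_of_def
proof (intro exI conjI ballI bexI)
  show "projective_family I below E \<nu> g" by (rule family)
  show "JB_algebra (E i) (\<nu> i)" if "i \<in> I" for i by (rule JB_E[OF that])
qed (rule homeomorphism hom)+

end

section \<open>JB-algebras as complete seminormed subalgebras\<close>

lemma (in jordan_product) complete_family_of_JB:
  assumes N: "jordan_subalgebra m e N" and JB: "JB_algebra (subalg m e N) p"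
  shows "complete_JB_family m e N {p}"
proof (intro complete_JB_family.intro complete_JB_family_axioms.intro jordan_product_axioms N)
  have banach: "alg_norm (subalg m e N) p" "submultiplicative (subalg m e N) p"
    and complete: "Metric_space.mcomplete (carrier (subalg m e N)) (norm_dist (subalg m e N) p)"
    using JB by (auto simp: JB_algebra_def banach_jordan_algebra_def)
  interpret n: real_normed_module "subalg m e N" p
    by (intro real_normed_moduleI jordan_subalg N banach)
  have carrier: "carrier (subalg m e N) = N" by (simp add: type_algebra_def)
  have sq: "p (m x x) = (p x)\<^sup>2" and fine: "(p x)\<^sup>2 \<le> p (m x x + m y y)" if "x \<in> N" "y \<in> N" for x y
    using JB that by (auto simp: JB_algebra_def type_algebra_def)
  have "JB_seminorm_on m e N p"
    using banach sq fine by (auto simp: JB_seminorm_on_def fine_subalg regular_subalg alg_norm_def)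
  then show "JB_seminorm_on m e N p'" if "p' \<in> {p}" for p' using that by simp
  fix X :: "nat \<Rightarrow> 'a"
  assume X: "\<And>n. X n \<in> N"
    and cauchy: "\<And>p' \<epsilon>. \<lbrakk>p' \<in> {p}; 0 < \<epsilon>\<rbrakk> \<Longrightarrow> \<exists>M. \<forall>i\<ge>M. \<forall>j\<ge>M. p' (X i - X j) < \<epsilon>"
  have "\<exists>x\<in>N. (\<lambda>n. p (X n \<ominus>\<^bsub>subalg m e N\<^esub> x)) \<longlonglongrightarrow> 0"
    using complete[unfolded n.mcomplete_norm_iff, rule_format, of X] X cauchy[of p]
    by (simp add: carrier subalg_diff[OF n.real_normed_module_axioms])
  then show "\<exists>x\<in>N. \<forall>p'\<in>{p}. (\<lambda>n. p' (X n - x)) \<longlonglongrightarrow> 0"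
    using X by (auto simp: subalg_diff[OF n.real_normed_module_axioms])
qed

lemma (in complete_JB_family) JB_of_single_norm:
  assumes \<Gamma>: "\<Gamma> = {p}" and pos: "\<And>x. x \<in> B \<Longrightarrow> p x = 0 \<Longrightarrow> x = 0"
  shows "JB_algebra (subalg m e B) p"
proof -
  interpret JB_seminorm m e B p using JB_seminorm[of p] \<Gamma> by simp
  have carrier: "carrier (subalg m e B) = B" by (simp add: type_algebra_def)
  have norm: "alg_norm (subalg m e B) p"
    using seminorm pos by (auto simp: alg_norm_def type_algebra_def)
  interpret n: real_normed_module "subalg m e B" p
    by (intro real_normed_moduleI jordan_subalg subalgebra norm)
  have "n.metric.mcomplete"
    unfolding n.mcomplete_norm_iff unfolding carrier
  proof (intro allI impI, elim conjE)
    fix X :: "nat \<Rightarrow> 'a"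
    assume X: "\<forall>n. X n \<in> B" and "\<forall>\<epsilon>>0. \<exists>N. \<forall>i\<ge>N. \<forall>j\<ge>N. p (X i \<ominus>\<^bsub>subalg m e B\<^esub> X j) < \<epsilon>"
    then have "\<exists>x\<in>B. \<forall>p\<in>\<Gamma>. (\<lambda>n. p (X n - x)) \<longlonglongrightarrow> 0"
      by (intro complete) (auto simp: \<Gamma> subalg_diff[OF n.real_normed_module_axioms])
    then show "\<exists>x\<in>B. (\<lambda>n. p (X n \<ominus>\<^bsub>subalg m e B\<^esub> x)) \<longlonglongrightarrow> 0"
      using X by (auto simp: \<Gamma> subalg_diff[OF n.real_normed_module_axioms])
  qed
  moreover have "(p x)\<^sup>2 \<le> p (m x x + m y y)" if "x \<in> B" "y \<in> B" for x y
    using fine[OF that] square[OF that(1)] by simp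
  ultimately show ?thesis
    using norm submultiplicative square jordan_subalg[OF subalgebra]
    by (simp add: JB_algebra_def banach_jordan_algebra_def) (simp add: type_algebra_def)
qed

section \<open>Dense JB-subalgebras give fine regular defining seminorms\<close>

context seminorm_presentation
begin

lemma open_ball:
  assumes q: "q \<in> Q"
  shows "open {y. q (y - x) < r}"
proof -
  interpret submult_seminorm m e UNIV q by (rule submult[OF q])
  show ?thesis unfolding topology
  proof
    fix y assume "y \<in> {y. q (y - x) < r}"
    then have "0 < r - q (y - x)" by simp
    moreover have "z \<in> {y. q (y - x) < r}" if "q (z - y) < r - q (y - x)" for z
      using that q_dist[of z y x] by simp
    ultimately show "\<exists>q'\<in>Q. \<exists>s>0. \<forall>z. q' (z - y) < s \<longrightarrow> z \<in> {y. q (y - x) < r}" using q by blast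
  qed
qed

lemma dense_meets_ball:
  assumes "closure N = UNIV" "q \<in> Q" "0 < \<epsilon>"
  shows "\<exists>z\<in>N. q (x - z) < \<epsilon>"
proof -
  interpret submult_seminorm m e UNIV q by (rule submult[OF assms(2)])
  have "x \<in> {y. q (y - x) < \<epsilon>} \<inter> closure N" using assms q_zero by simp
  then obtain z where "z \<in> N" "q (z - x) < \<epsilon>"
    using open_Int_closure_eq_empty[OF open_ball[OF assms(2)], of x \<epsilon> N] by blast
  then show ?thesis using q_sym[of x z] by (intro bexI[of _ z]) auto
qed

lemma equivalent_presentation:
  assumes h: "\<And>q. q \<in> Q \<Longrightarrow> submult_seminorm m e UNIV (h q)"
    and le: "\<And>q x. q \<in> Q \<Longrightarrow> h q x \<le> q x"
    and ge: "\<And>q. q \<in> Q \<Longrightarrow> \<exists>K>0. \<forall>x. q x \<le> K * h q x"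
  shows "seminorm_presentation m e (h ` Q)"
proof (intro seminorm_presentation.intro seminorm_presentation_axioms.intro jordan_product_axioms)
  have h0: "0 \<le> h q x" and q0: "0 \<le> q x" if "q \<in> Q" for q x
    using submult_seminorm.q_nonneg[OF h[OF that]] submult_seminorm.q_nonneg[OF submult[OF that]] by auto
  have h_eq_0: "q x = 0" if "q \<in> Q" "h q x = 0" for q x
    using ge[OF that(1)] that(2) q0[OF that(1), of x] by (metis mult_zero_right order_antisym)
  show "h ` Q \<noteq> {}" using nonempty by simp
  show "submult_seminorm m e UNIV q" if "q \<in> h ` Q" for q using that h by auto
  show "\<exists>q3\<in>h ` Q. \<exists>C\<ge>0. \<forall>x. q1 x \<le> C * q3 x \<and> q2 x \<le> C * q3 x"
    if "q1 \<in> h ` Q" "q2 \<in> h ` Q" for q1 q2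
  proof -
    obtain a b where ab: "a \<in> Q" "q1 = h a" "b \<in> Q" "q2 = h b" using \<open>q1 \<in> h ` Q\<close> \<open>q2 \<in> h ` Q\<close> by auto
    obtain c C where c: "c \<in> Q" "0 \<le> C" "\<And>x. a x \<le> C * c x \<and> b x \<le> C * c x"
      using directed[OF ab(1,3)] by blast
    obtain K where K: "K > 0" "\<And>x. c x \<le> K * h c x" using ge[OF c(1)] by blast
    have "C * c x \<le> (C * K) * h c x" for x
      using mult_left_mono[OF K(2)[of x] c(2)] by (simp add: mult.assoc)
    then have "q1 x \<le> (C * K) * h c x" "q2 x \<le> (C * K) * h c x" for x
      using le[OF ab(1), of x] le[OF ab(3), of x] c(3)[of x] ab order_trans by metis+
    then show ?thesis using c K by (intro bexI[of _ "h c"] exI[of _ "C * K"]) auto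
  qed
  show "x = 0" if "\<And>q. q \<in> h ` Q \<Longrightarrow> q x = 0" for x
    using that h_eq_0 by (intro separated) auto
  have "(\<exists>q\<in>h ` Q. \<exists>r>0. \<forall>y. q (y - x) < r \<longrightarrow> y \<in> U) \<longleftrightarrow>
      (\<exists>q\<in>Q. \<exists>r>0. \<forall>y. q (y - x) < r \<longrightarrow> y \<in> U)" for x U
  proof
    assume "\<exists>q\<in>h ` Q. \<exists>r>0. \<forall>y. q (y - x) < r \<longrightarrow> y \<in> U"
    then obtain q r where q: "q \<in> Q" "r > 0" "\<And>y. h q (y - x) < r \<Longrightarrow> y \<in> U" by blast
    then have "y \<in> U" if "q (y - x) < r" for y
      using le[OF q(1), of "y - x"] that by simp
    then show "\<exists>q\<in>Q. \<exists>r>0. \<forall>y. q (y - x) < r \<longrightarrow> y \<in> U" using q by blast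
  next
    assume "\<exists>q\<in>Q. \<exists>r>0. \<forall>y. q (y - x) < r \<longrightarrow> y \<in> U"
    then obtain q r where q: "q \<in> Q" "r > 0" "\<And>y. q (y - x) < r \<Longrightarrow> y \<in> U" by blast
    obtain K where K: "K > 0" "\<And>x. q x \<le> K * h q x" using ge[OF q(1)] by blast
    have "y \<in> U" if "h q (y - x) < r / K" for y
    proof (rule q(3))
      have "K * h q (y - x) < r" using that K by (simp add: field_simps)
      then show "q (y - x) < r" using K(2)[of "y - x"] by linarith
    qed
    then show "\<exists>q\<in>h ` Q. \<exists>r>0. \<forall>y. q (y - x) < r \<longrightarrow> y \<in> U"
      using q K by (intro bexI[of _ "h q"] exI[of _ "r / K"]) auto
  qed
  then show "open U \<longleftrightarrow> (\<forall>x\<in>U. \<exists>q\<in>h ` Q. \<exists>r>0. \<forall>y. q (y - x) < r \<longrightarrow> y \<in> U)" for U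
    unfolding topology by simp
  show "\<exists>x. \<forall>q\<in>h ` Q. (\<lambda>n. q (X n - x)) \<longlonglongrightarrow> 0"
    if cauchy: "\<And>q \<epsilon>. \<lbrakk>q \<in> h ` Q; 0 < \<epsilon>\<rbrakk> \<Longrightarrow> \<exists>N. \<forall>i\<ge>N. \<forall>j\<ge>N. q (X i - X j) < \<epsilon>"
    for X :: "nat \<Rightarrow> 'a"
  proof -
    have "\<exists>x. \<forall>q\<in>Q. (\<lambda>n. q (X n - x)) \<longlonglongrightarrow> 0"
    proof (rule complete)
      fix q and \<epsilon> :: real assume q: "q \<in> Q" and \<epsilon>: "0 < \<epsilon>"
      obtain K where K: "K > 0" "\<And>x. q x \<le> K * h q x" using ge[OF q] by blast
      obtain N where N: "\<And>i j. i \<ge> N \<Longrightarrow> j \<ge> N \<Longrightarrow> h q (X i - X j) < \<epsilon> / K"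
        using cauchy[of "h q" "\<epsilon> / K"] q \<epsilon> K by auto
      have "q (X i - X j) < \<epsilon>" if "i \<ge> N" "j \<ge> N" for i j
      proof -
        have "K * h q (X i - X j) < \<epsilon>" using N[OF that] K by (simp add: field_simps)
        then show ?thesis using K(2)[of "X i - X j"] by linarith
      qed
      then show "\<exists>N. \<forall>i\<ge>N. \<forall>j\<ge>N. q (X i - X j) < \<epsilon>" by blast
    qed
    then obtain x where x: "\<And>q. q \<in> Q \<Longrightarrow> (\<lambda>n. q (X n - x)) \<longlonglongrightarrow> 0" by blast
    have "(\<lambda>n. h q (X n - x)) \<longlonglongrightarrow> 0" if q: "q \<in> Q" for q
      by (rule tendsto_sandwich[OF _ _ tendsto_const x[OF q]]) (use h0 le q in auto)
    then show ?thesis by blast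
  qed
  show "\<exists>x. \<forall>q\<in>h ` Q. q (x - xs q) = 0"
    if coh: "\<And>q q' C. \<lbrakk>q \<in> h ` Q; q' \<in> h ` Q; 0 \<le> C; \<And>x. q x \<le> C * q' x\<rbrakk> \<Longrightarrow> q (xs q' - xs q) = 0"
    for xs
  proof -
    have "\<exists>x. \<forall>q\<in>Q. q (x - xs (h q)) = 0"
    proof (rule coherent)
      fix q q' C assume q: "q \<in> Q" "q' \<in> Q" and C: "0 \<le> C" "\<And>x. q x \<le> C * q' x"
      obtain K where K: "K > 0" "\<And>x. q' x \<le> K * h q' x" using ge[OF q(2)] by blast
      have "h q x \<le> (C * K) * h q' x" for x
        using le[OF q(1), of x] C(2)[of x] mult_left_mono[OF K(2)[of x] C(1)] by (simp add: mult.assoc)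
      then have "h q (xs (h q') - xs (h q)) = 0" using q C(1) K(1) by (intro coh[of _ _ "C * K"]) auto
      then show "q (xs (h q') - xs (h q)) = 0" by (rule h_eq_0[OF q(1)])
    qed
    then obtain x where x: "\<And>q. q \<in> Q \<Longrightarrow> q (x - xs (h q)) = 0" by blast
    have "h q (x - xs (h q)) = 0" if "q \<in> Q" for q
      using le[OF that, of "x - xs (h q)"] h0[OF that, of "x - xs (h q)"] x[OF that] by simp
    then show ?thesis by blast
  qed
qed

lemma inclusion_bounded:
  assumes N: "densely_included_JB m e N p"
    and q: "submult_seminorm m e UNIV q" and "open": "open {x. q x < 1}"
  shows "\<exists>C\<ge>0. \<forall>x\<in>N. q x \<le> C * p x"
proof -
  interpret q: submult_seminorm m e UNIV q by (rule q)
  have sub: "jordan_subalgebra m e N" and JB: "JB_algebra (subalg m e N) p"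
    and cont: "continuous_map (norm_topology (subalg m e N) p) euclidean (\<lambda>x. x)"
    using N by (auto simp: densely_included_JB_def)
  interpret n: real_normed_module "subalg m e N" p
    using JB by (intro real_normed_moduleI) (auto simp: JB_algebra_def banach_jordan_algebra_def)
  have carrier: "carrier (subalg m e N) = N" by (simp add: type_algebra_def)
  have "\<exists>C\<ge>0. \<forall>x\<in>carrier (subalg m e N). q x \<le> C * p x"
  proof (rule n.bounded_by_norm)
    show "q (c \<odot>\<^bsub>subalg m e N\<^esub> x) = \<bar>c\<bar> * q x" for c x
      using q.q_scale by (simp add: type_algebra_def)
    have "openin (norm_topology (subalg m e N) p)
        {x \<in> topspace (norm_topology (subalg m e N) p). x \<in> {x. q x < 1}}"
      by (rule openin_continuous_map_preimage[OF cont]) (use "open" in simp)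
    then show "openin (norm_topology (subalg m e N) p) {x \<in> carrier (subalg m e N). q x < 1}" by simp
  qed
  then show ?thesis unfolding carrier .
qed

lemma JB_presentation_of_dense_JB:
  assumes N: "densely_included_JB m e N p"
  shows "\<exists>Q'. JB_presentation m e Q'"
proof -
  have sub: "jordan_subalgebra m e N" and JB: "JB_algebra (subalg m e N) p" and dense: "closure N = UNIV"
    using N by (auto simp: densely_included_JB_def)
  define h where "h = dense_JB.hat N p"
  have dJB: "\<exists>C. dense_JB m e N p q C" if q: "q \<in> Q" for q
  proof -
    have "open {x. q x < 1}" using open_ball[OF q, of 0 1] by simp
    then obtain C where "C \<ge> 0" "\<And>x. x \<in> N \<Longrightarrow> q x \<le> C * p x"
      using inclusion_bounded[OF N submult[OF q]] by blast
    then show ?thesis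
      using complete_family_of_JB[OF sub JB] submult[OF q] dense_meets_ball[OF dense q]
      by (intro exI[of _ C] dense_JB.intro dense_JB_axioms.intro jordan_product_axioms) auto
  qed
  have JBh: "JB_seminorm_on m e UNIV (h q)" if "q \<in> Q" for q
    using dJB[OF that] dense_JB.JB_hat unfolding h_def by blast
  have "seminorm_presentation m e (h ` Q)"
  proof (rule equivalent_presentation)
    show "submult_seminorm m e UNIV (h q)" if "q \<in> Q" for q
      using JBh[OF that]
      by (intro submult_seminorm.intro submult_seminorm_axioms.intro jordan_product_axioms)
        (auto simp: JB_seminorm_on_def jordan_subalgebra_def)
    show "h q x \<le> q x" if "q \<in> Q" for q x
      using dJB[OF that] dense_JB.hat_le_q unfolding h_def by blast
    show "\<exists>K>0. \<forall>x. q x \<le> K * h q x" if q: "q \<in> Q" for q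
    proof -
      obtain C where "dense_JB m e N p q C" using dJB[OF q] by blast
      then show ?thesis unfolding h_def
        by (intro exI[of _ "max C 1"]) (auto intro: dense_JB.q_le_hat)
    qed
  qed
  then have "JB_presentation m e (h ` Q)"
    by (intro JB_presentation.intro JB_presentation_axioms.intro) (use JBh in auto)
  then show ?thesis ..
qed

end

section \<open>The bounded part of a locally JB-algebra\<close>

context JB_presentation
begin

definition M_b :: "'a set" where
  "M_b = {x. \<exists>K. \<forall>q\<in>Q. q x \<le> K}"

definition sup_norm :: "'a \<Rightarrow> real" where
  "sup_norm x = (SUP q\<in>Q. q x)"

lemma le_sup_norm: "x \<in> M_b \<Longrightarrow> q \<in> Q \<Longrightarrow> q x \<le> sup_norm x"
  unfolding sup_norm_def M_b_def by (intro cSUP_upper) (auto simp: bdd_above_def)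

lemma sup_norm_le: "(\<And>q. q \<in> Q \<Longrightarrow> q x \<le> K) \<Longrightarrow> sup_norm x \<le> K"
  unfolding sup_norm_def using nonempty by (intro cSUP_least) auto

lemma M_bI: "(\<And>q. q \<in> Q \<Longrightarrow> q x \<le> K) \<Longrightarrow> x \<in> M_b"
  by (auto simp: M_b_def)

lemma Q_JB: "q \<in> Q \<Longrightarrow> JB_seminorm m e UNIV q"
  by (rule family.JB_seminorm)

lemma sup_norm_nonneg:
  assumes "x \<in> M_b"
  shows "0 \<le> sup_norm x"
proof -
  obtain q where q: "q \<in> Q" using nonempty by blast
  interpret JB_seminorm m e UNIV q by (rule Q_JB[OF q])
  show ?thesis using le_sup_norm[OF assms q] q_nonneg[of x] by simp
qed

lemma
  assumes x: "x \<in> M_b" and y: "y \<in> M_b"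
  shows sup_norm_add: "x + y \<in> M_b \<and> sup_norm (x + y) \<le> sup_norm x + sup_norm y"
    and sup_norm_mult: "m x y \<in> M_b \<and> sup_norm (m x y) \<le> sup_norm x * sup_norm y"
proof -
  have "q (x + y) \<le> sup_norm x + sup_norm y" "q (m x y) \<le> sup_norm x * sup_norm y" if q: "q \<in> Q" for q
  proof -
    interpret JB_seminorm m e UNIV q by (rule Q_JB[OF q])
    show "q (x + y) \<le> sup_norm x + sup_norm y"
      using q_add[of x y] le_sup_norm[OF x q] le_sup_norm[OF y q] by simp
    have "q x * q y \<le> sup_norm x * sup_norm y"
      using le_sup_norm[OF x q] le_sup_norm[OF y q] q_nonneg sup_norm_nonneg[OF x] by (intro mult_mono) auto
    then show "q (m x y) \<le> sup_norm x * sup_norm y" using q_mult[of x y] by simp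
  qed
  then show "x + y \<in> M_b \<and> sup_norm (x + y) \<le> sup_norm x + sup_norm y"
    "m x y \<in> M_b \<and> sup_norm (m x y) \<le> sup_norm x * sup_norm y"
    using M_bI sup_norm_le by blast+
qed

lemma sup_norm_scale:
  assumes x: "x \<in> M_b"
  shows "c *\<^sub>R x \<in> M_b \<and> sup_norm (c *\<^sub>R x) = \<bar>c\<bar> * sup_norm x"
proof -
  have *: "c *\<^sub>R x \<in> M_b \<and> sup_norm (c *\<^sub>R x) \<le> \<bar>c\<bar> * sup_norm x"
    if x: "x \<in> M_b" for c x
  proof -
    have "q (c *\<^sub>R x) \<le> \<bar>c\<bar> * sup_norm x" if q: "q \<in> Q" for q
    proof -
      interpret JB_seminorm m e UNIV q by (rule Q_JB[OF q])
      show ?thesis using q_scale[of x c] le_sup_norm[OF x q] by (simp add: mult_left_mono)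
    qed
    then show ?thesis using M_bI sup_norm_le by blast
  qed
  have "\<bar>c\<bar> * sup_norm x \<le> sup_norm (c *\<^sub>R x)"
  proof (cases "c = 0")
    case True
    then show ?thesis using sup_norm_nonneg *[OF x, of c] by simp
  next
    case False
    then have "\<bar>c\<bar> * sup_norm x \<le> \<bar>c\<bar> * (\<bar>1 / c\<bar> * sup_norm (c *\<^sub>R x))"
      using *[of "c *\<^sub>R x" "1 / c"] *[OF x, of c] by (intro mult_left_mono) auto
    then show ?thesis using False by (simp add: abs_mult[symmetric])
  qed
  then show ?thesis using *[OF x, of c] by simp
qed

lemma bounded_subalgebra: "jordan_subalgebra m e M_b"
proof -
  have e: "e \<in> M_b"
  proof (rule M_bI)
    fix q assume "q \<in> Q"
    then interpret JB_seminorm m e UNIV q by (rule Q_JB)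
    show "q e \<le> 1" by (rule p_e)
  qed
  then have "0 \<in> M_b" using sup_norm_scale[of e 0] by simp
  then show ?thesis
    using e sup_norm_add sup_norm_scale sup_norm_mult
    by (auto simp: jordan_subalgebra_def subspace_def)
qed

lemma JB_sup_norm: "JB_seminorm_on m e M_b sup_norm"
proof -
  have sq: "sup_norm (m x x) = (sup_norm x)\<^sup>2" if x: "x \<in> M_b" for x
  proof (rule antisym)
    show "sup_norm (m x x) \<le> (sup_norm x)\<^sup>2"
      using sup_norm_mult[OF x x] by (simp add: power2_eq_square)
    have xx: "m x x \<in> M_b" using sup_norm_mult[OF x x] by simp
    have "q x \<le> sqrt (sup_norm (m x x))" if q: "q \<in> Q" for q
    proof -
      interpret JB_seminorm m e UNIV q by (rule Q_JB[OF q])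
      show ?thesis using le_sup_norm[OF xx q] square[of x] by (intro real_le_rsqrt) simp
    qed
    then have "sup_norm x \<le> sqrt (sup_norm (m x x))" by (rule sup_norm_le)
    then have "(sup_norm x)\<^sup>2 \<le> (sqrt (sup_norm (m x x)))\<^sup>2" using sup_norm_nonneg[OF x] by (rule power_mono)
    then show "(sup_norm x)\<^sup>2 \<le> sup_norm (m x x)" using sup_norm_nonneg[OF xx] by simp
  qed
  have fine: "sup_norm (m x x) \<le> sup_norm (m x x + m y y)"
    if x: "x \<in> M_b" and y: "y \<in> M_b" for x y
  proof (rule sup_norm_le)
    fix q assume q: "q \<in> Q"
    interpret JB_seminorm m e UNIV q by (rule Q_JB[OF q])
    have "m x x + m y y \<in> M_b" using sup_norm_mult sup_norm_add x y by blast
    then show "q (m x x) \<le> sup_norm (m x x + m y y)" using fine[of x y] le_sup_norm[OF _ q] by fastforce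
  qed
  show ?thesis
    unfolding JB_seminorm_on_def subalg_simps
    using sq fine sup_norm_add sup_norm_mult sup_norm_scale sup_norm_nonneg by auto
qed

lemma bounded_complete: "complete_JB_family m e M_b {sup_norm}"
proof (intro complete_JB_family.intro complete_JB_family_axioms.intro jordan_product_axioms bounded_subalgebra)
  show "JB_seminorm_on m e M_b p" if "p \<in> {sup_norm}" for p
    using that JB_sup_norm by simp
  fix X :: "nat \<Rightarrow> 'a"
  assume X: "\<And>n. X n \<in> M_b"
    and "\<And>p r. \<lbrakk>p \<in> {sup_norm}; 0 < r\<rbrakk> \<Longrightarrow> \<exists>N. \<forall>i\<ge>N. \<forall>j\<ge>N. p (X i - X j) < r"
  then have cauchy: "\<exists>N. \<forall>i\<ge>N. \<forall>j\<ge>N. sup_norm (X i - X j) < r" if "0 < r" for r using that by blast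
  have sub: "subspace M_b" using bounded_subalgebra by (simp add: jordan_subalgebra_def)
  have diff: "q (X i - X j) \<le> sup_norm (X i - X j)" if "q \<in> Q" for q i j
    using le_sup_norm[OF _ that] X sub by (blast intro: subspace_diff)
  have "\<exists>x. \<forall>q\<in>Q. (\<lambda>n. q (X n - x)) \<longlonglongrightarrow> 0"
    by (rule complete) (meson cauchy diff order_le_less_trans)
  then obtain x where x: "\<And>q. q \<in> Q \<Longrightarrow> (\<lambda>n. q (X n - x)) \<longlonglongrightarrow> 0" by blast
  have close: "\<exists>N. \<forall>i\<ge>N. \<forall>q\<in>Q. q (X i - x) \<le> r" if r: "0 < r" for r
  proof -
    obtain N where N: "\<And>i j. i \<ge> N \<Longrightarrow> j \<ge> N \<Longrightarrow> sup_norm (X i - X j) < r" using cauchy[OF r] by blast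
    have "q (X i - x) \<le> r" if i: "i \<ge> N" and q: "q \<in> Q" for i q
    proof -
      interpret JB_seminorm m e UNIV q by (rule Q_JB[OF q])
      have "(\<lambda>j. r + q (X j - x)) \<longlonglongrightarrow> r + 0" by (intro tendsto_add tendsto_const x q)
      moreover have "q (X i - x) \<le> r + q (X j - x)" if "j \<ge> N" for j
        using q_dist[of "X i" "X j" x] diff[OF q, of i j] N[OF i that] by simp
      ultimately show ?thesis
        by (intro LIMSEQ_le_const[where X = "\<lambda>j. r + q (X j - x)"]) auto
    qed
    then show ?thesis by blast
  qed
  have Xx: "X i - x \<in> M_b" if "\<forall>q\<in>Q. q (X i - x) \<le> 1" for i
    using that by (intro M_bI) auto
  obtain N where "\<forall>q\<in>Q. q (X N - x) \<le> 1" using close[of 1] by auto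
  then have "X N - (X N - x) \<in> M_b" using Xx X sub by (blast intro: subspace_diff)
  then have xB: "x \<in> M_b" by simp
  have "(\<lambda>n. sup_norm (X n - x)) \<longlonglongrightarrow> 0"
  proof (rule LIMSEQ_I)
    fix r :: real assume r: "0 < r"
    obtain N where N: "\<And>i. i \<ge> N \<Longrightarrow> \<forall>q\<in>Q. q (X i - x) \<le> r / 2" using close[of "r / 2"] r by auto
    have "norm (sup_norm (X i - x) - 0) < r" if "i \<ge> N" for i
    proof -
      have "sup_norm (X i - x) \<le> r / 2" using N[OF that] by (intro sup_norm_le) auto
      moreover have "0 \<le> sup_norm (X i - x)" using X xB sub by (intro sup_norm_nonneg subspace_diff)
      ultimately show ?thesis using r by simp
    qed
    then show "\<exists>N. \<forall>n\<ge>N. norm (sup_norm (X n - x) - 0) < r" by blast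
  qed
  then show "\<exists>x\<in>M_b. \<forall>p\<in>{sup_norm}. (\<lambda>n. p (X n - x)) \<longlonglongrightarrow> 0" using xB by auto
qed

text \<open>
  Density: the truncation of \<open>x\<close> at a level above \<open>q x\<close> is bounded and equals \<open>x\<close> modulo the kernel of
  \<open>q\<close>, so it lies in every neighbourhood of \<open>x\<close> defined by \<open>q\<close>.
\<close>

theorem densely_included_bounded: "densely_included_JB m e M_b sup_norm"
proof -
  interpret b: complete_JB_family m e M_b "{sup_norm}" by (rule bounded_complete)
  have JB: "JB_algebra (subalg m e M_b) sup_norm"
  proof (rule b.JB_of_single_norm[OF refl])
    fix x assume x: "x \<in> M_b" "sup_norm x = 0"
    show "x = 0"
    proof (rule separated)
      fix q assume q: "q \<in> Q"
      interpret JB_seminorm m e UNIV q by (rule Q_JB[OF q])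
      show "q x = 0" using le_sup_norm[OF x(1) q] x(2) q_nonneg[of x] by simp
    qed
  qed
  interpret n: real_normed_module "subalg m e M_b" sup_norm
    using JB by (intro real_normed_moduleI) (auto simp: JB_algebra_def banach_jordan_algebra_def)
  have carrier: "carrier (subalg m e M_b) = M_b" by (simp add: type_algebra_def)
  have "openin (norm_topology (subalg m e M_b) sup_norm) {x \<in> M_b. x \<in> U}"
    if U: "open U" for U
    unfolding n.openin_norm_topology carrier
  proof (intro conjI ballI)
    fix x assume "x \<in> {x \<in> M_b. x \<in> U}"
    then have x: "x \<in> M_b" "x \<in> U" by auto
    then obtain q r where q: "q \<in> Q" "r > 0" "\<And>y. q (y - x) < r \<Longrightarrow> y \<in> U"
      using U unfolding topology by blast
    have "q (y - x) \<le> sup_norm (y - x)" if "y \<in> M_b" for y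
      using x that bounded_subalgebra by (intro le_sup_norm q) (auto simp: jordan_subalgebra_def subspace_diff)
    then show "\<exists>r>0. \<forall>y\<in>M_b. sup_norm (y \<ominus>\<^bsub>subalg m e M_b\<^esub> x) < r
        \<longrightarrow> y \<in> {x \<in> M_b. x \<in> U}"
      using q x by (intro exI[of _ r]) (fastforce simp: subalg_diff[OF n.real_normed_module_axioms])
  qed auto
  then have cont: "continuous_map (norm_topology (subalg m e M_b) sup_norm) euclidean (\<lambda>x. x)"
    by (simp add: continuous_map_def carrier)
  have "closure M_b = UNIV"
  proof (rule ccontr)
    assume "closure M_b \<noteq> UNIV"
    then obtain x where x: "x \<in> - closure M_b" by blast
    have "open (- closure M_b)" by (simp add: open_Compl)
    then obtain q r where q: "q \<in> Q" "r > 0" "\<And>y. q (y - x) < r \<Longrightarrow> y \<in> - closure M_b"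
      using x unfolding topology by blast
    interpret JB_seminorm m e UNIV q by (rule Q_JB[OF q(1)])
    have "0 < q x + 1" using q_nonneg[of x] by simp
    then obtain y where y: "\<forall>q'\<in>Q. q' y \<le> q x + 1" "q (x - y) = 0"
      using family.clamp_ex[of x "q x + 1"] q(1) by auto
    then have "y \<in> M_b" by (intro M_bI) auto
    moreover have "y \<in> - closure M_b" using y(2) q_sym[of x y] q by simp
    ultimately show False using closure_subset by blast
  qed
  then show ?thesis using bounded_subalgebra JB cont by (simp add: densely_included_JB_def)
qed

end

section \<open>Dense JB-subalgebras with closed unit ball\<close>

lemma generate_topology_empty: "generate_topology {} U \<Longrightarrow> U = {} \<or> U = UNIV"
  by (induction U rule: generate_topology.induct) auto

text \<open>
  Saturation makes it possible to replace the finitely many seminorms of a basic neighbourhood by their maximum.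
\<close>

lemma saturated_seminorm_nhd:
  fixes \<Gamma> :: "('a::real_vector \<Rightarrow> real) set"
  assumes sat: "saturated \<Gamma>" and ne: "\<Gamma> \<noteq> {}"
    and tri: "\<And>p x y z. p \<in> \<Gamma> \<Longrightarrow> p (x - z) \<le> p (x - y) + p (y - z)"
    and U: "generate_topology {{y. p (y - x) < r} | p x r. p \<in> \<Gamma> \<and> 0 < r} U" and x: "x \<in> U"
  shows "\<exists>p\<in>\<Gamma>. \<exists>r>0. \<forall>y. p (y - x) < r \<longrightarrow> y \<in> U"
  using U x
proof (induction arbitrary: x rule: generate_topology.induct)
  case UNIV
  then show ?case using ne by (auto intro: exI[of _ "1::real"])
next
  case (Int a b)
  obtain p r where p: "p \<in> \<Gamma>" "r > 0" "\<And>y. p (y - x) < r \<Longrightarrow> y \<in> a" using Int.IH(1)[of x] Int.prems by blast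
  obtain q s where q: "q \<in> \<Gamma>" "s > 0" "\<And>y. q (y - x) < s \<Longrightarrow> y \<in> b" using Int.IH(2)[of x] Int.prems by blast
  have "(\<lambda>x. MAX p\<in>{p, q}. p x) \<in> \<Gamma>"
    by (rule sat[unfolded saturated_def, rule_format]) (use p q in simp)
  moreover have "(MAX p\<in>{p, q}. p x) = max (p x) (q x)" for x by (cases "p = q") simp_all
  ultimately have "(\<lambda>x. max (p x) (q x)) \<in> \<Gamma>" by simp
  then show ?case using p q by (intro bexI[of _ "\<lambda>x. max (p x) (q x)"] exI[of _ "min r s"]) auto
next
  case (UN K)
  then show ?case by (meson UnionE UnionI)
next
  case (Basis S)
  then obtain p z r where p: "S = {y. p (y - z) < r}" "p \<in> \<Gamma>" by blast
  have "y \<in> S" if "p (y - x) < r - p (x - z)" for y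
    using tri[OF p(2), of y z x] that p(1) by simp
  moreover have "0 < r - p (x - z)" using Basis.prems p(1) by simp
  ultimately show ?case using p(2) by blast
qed

text \<open>
  An empty \<open>\<Gamma>\<close> can only define the indiscrete topology, which separates points only if the algebra
  is zero. For nonempty \<open>\<Gamma>\<close> it suffices to show that \<open>x\<close>, scaled so that all its seminorms are below \<open>1\<close>,
  lies in the closed unit ball.
\<close>

lemma (in seminorm_presentation) dense_JB_eq_bounded_part:
  assumes N: "densely_included_JB m e N p" and cl: "closed {x \<in> N. p x \<le> 1}"
    and \<Gamma>: "JB_seminorm_family m e \<Gamma>"
  shows "N = bounded_part \<Gamma>"
proof (cases "\<Gamma> = {}")
  case True
  have "x = 0" for x :: 'a
  proof (rule separated, rule ccontr)
    fix q assume q: "q \<in> Q" and "q x \<noteq> 0"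
    interpret submult_seminorm m e UNIV q by (rule submult[OF q])
    have "generate_topology {} {y. q (y - 0) < q x}"
      using open_ball[OF q, of 0 "q x"] \<Gamma> True by (simp add: JB_seminorm_family_def defines_topology_def)
    then have "{y. q (y - 0) < q x} = {} \<or> {y. q (y - 0) < q x} = UNIV" by (rule generate_topology_empty)
    moreover have "0 \<in> {y. q (y - 0) < q x}" using q_nonneg[of x] \<open>q x \<noteq> 0\<close> q_zero by simp
    moreover have "x \<notin> {y. q (y - 0) < q x}" by simp
    ultimately show False by blast
  qed
  moreover have "0 \<in> N" using N by (auto simp: densely_included_JB_def jordan_subalgebra_def subspace_0)
  ultimately have "N = UNIV" by (metis UNIV_eq_I)
  then show ?thesis using True by (simp add: bounded_part_def bot_ereal_def)
next
  case ne: False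
  have sub: "jordan_subalgebra m e N" and JB: "JB_algebra (subalg m e N) p" and dense: "closure N = UNIV"
    using N by (auto simp: densely_included_JB_def)
  interpret N: complete_JB_family m e N "{p}" by (rule complete_family_of_JB[OF sub JB])
  interpret n: JB_seminorm m e N p using N.JB_seminorm by simp
  have JB\<Gamma>: "JB_seminorm m e UNIV g" if "g \<in> \<Gamma>" for g
    using \<Gamma> that
    by (intro JB_seminorm.intro JB_seminorm_axioms.intro jordan_product_axioms)
      (auto simp: JB_seminorm_family_def JB_seminorm_on_def subalg_UNIV jordan_subalgebra_def)
  have sm: "submult_seminorm m e UNIV g" if "g \<in> \<Gamma>" for g
  proof -
    interpret JB_seminorm m e UNIV g by (rule JB\<Gamma>[OF that])
    show ?thesis by (rule submult_seminorm_axioms)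
  qed
  have gen: "open U \<longleftrightarrow> generate_topology {{y. p (y - x) < r} | p x r. p \<in> \<Gamma> \<and> 0 < r} U" for U :: "'a set"
    using \<Gamma> by (simp add: JB_seminorm_family_def defines_topology_def)
  have sat: "saturated \<Gamma>" using \<Gamma> by (simp add: JB_seminorm_family_def)
  have open_\<Gamma>: "open {y. g (y - x) < r}" if "g \<in> \<Gamma>" "0 < r" for g x r
    unfolding gen using that by (intro generate_topology.Basis) blast
  have bound: "\<exists>C\<ge>0. \<forall>x\<in>N. g x \<le> C * p x" if g: "g \<in> \<Gamma>" for g
    using inclusion_bounded[OF N sm[OF g]] open_\<Gamma>[OF g, of 1 0] by simp
  show ?thesis
  proof
    show "N \<subseteq> bounded_part \<Gamma>"
    proof
      fix x assume x: "x \<in> N"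
      \<comment> \<open>Continuity gives \<open>g \<le> C * p\<close>; regularity of both sides removes \<open>C\<close>.\<close>
      have "g x \<le> p x" if g: "g \<in> \<Gamma>" for g
      proof -
        interpret g: JB_seminorm m e UNIV g by (rule JB\<Gamma>[OF g])
        interpret gp: fine_poly_seminorm "\<lambda>P. g (pev x P)" by (rule g.fine_poly_seminorm_pev) simp
        interpret np: fine_poly_seminorm "\<lambda>P. p (pev x P)" by (rule n.fine_poly_seminorm_pev[OF x])
        obtain C where C: "C \<ge> 0" "\<And>x. x \<in> N \<Longrightarrow> g x \<le> C * p x" using bound[OF g] by blast
        have px: "pev x [:0, 1:] = x" by simp
        show ?thesis
        proof (rule le_of_power_le_linear_mult_power)
          show "g x ^ (2 ^ k) \<le> (0 * 2 ^ k + C) * p x ^ (2 ^ k)" for k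
            using C(2)[OF n.B_pev[OF x], of "[:0, 1:] ^ (2 ^ k)"]
              gp.regular_power[of "[:0, 1:]" k] np.regular_power[of "[:0, 1:]" k] unfolding px by simp
        qed (use g.q_nonneg n.q_nonneg x in auto)
      qed
      then have "(SUP g\<in>\<Gamma>. ereal (g x)) \<le> ereal (p x)" by (intro SUP_least) simp
      then show "x \<in> bounded_part \<Gamma>" unfolding bounded_part_def
        by (auto intro: order_le_less_trans)
    qed
    show "bounded_part \<Gamma> \<subseteq> N"
    proof
      fix x assume "x \<in> bounded_part \<Gamma>"
      then have "(SUP g\<in>\<Gamma>. ereal (g x)) < \<infinity>" by (simp add: bounded_part_def)
      from ereal_dense2[OF this]
      obtain K' where K': "(SUP g\<in>\<Gamma>. ereal (g x)) < ereal K'" by blast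
      have le: "g x \<le> K'" if "g \<in> \<Gamma>" for g
        using SUP_upper[OF that, of "\<lambda>g. ereal (g x)"] K' by (meson ereal_less_eq(3) less_imp_le order_trans)
      define K where "K = max K' 0 + 1"
      have K: "K > 0" by (simp add: K_def)
      define x0 where "x0 = (1 / K) *\<^sub>R x"
      have x0: "g x0 < 1" if g: "g \<in> \<Gamma>" for g
      proof -
        interpret submult_seminorm m e UNIV g by (rule sm[OF g])
        have "g x < K" using le[OF g] by (simp add: K_def)
        then show ?thesis using q_scale[of x "1 / K"] K by (simp add: x0_def)
      qed
      have "x0 \<in> {x \<in> N. p x \<le> 1}"
      proof (rule ccontr)
        let ?S = "{x \<in> N. p x \<le> 1}"
        assume "x0 \<notin> ?S"
        moreover have "open (- ?S)" using cl by (simp add: open_Compl)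
        ultimately have "\<exists>g\<in>\<Gamma>. \<exists>r>0. \<forall>y. g (y - x0) < r \<longrightarrow> y \<in> - ?S"
          using submult_seminorm.q_dist[OF sm]
          by (intro saturated_seminorm_nhd[OF sat ne]) (auto simp: gen)
        then obtain g r where g: "g \<in> \<Gamma>" "r > 0" "\<And>y. g (y - x0) < r \<Longrightarrow> y \<in> - ?S" by blast
        interpret g: submult_seminorm m e UNIV g by (rule sm[OF g(1)])
        have gN: "submult_seminorm m e N g"
          using sub g.seminorm g.submultiplicative
          by (intro submult_seminorm.intro submult_seminorm_axioms.intro jordan_product_axioms)
            (auto simp: subalg_simps)
        \<comment> \<open>Within this distance of \<open>x0\<close> the value of \<open>g\<close> stays below \<open>1\<close>.\<close>
        define s where "s = min r (1 - g x0)"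
        have s: "s > 0" using g x0 by (simp add: s_def)
        have "x0 \<in> {y. g (y - x0) < s} \<inter> closure N" using s g.q_zero dense by simp
        then obtain z where z: "z \<in> N" "g (z - x0) < s"
          using open_Int_closure_eq_empty[OF open_\<Gamma>[OF g(1) s], of x0 N] by blast
        have "g z < 1" using g.q_le_dist[of z x0] z(2) by (simp add: s_def)
        obtain y where y: "N.fcalc (clamp_real 1) z y" using N.fcalc_ex[OF continuous_clamp_real z(1)] by blast
        obtain C where C: "C \<ge> 0" "\<And>x. x \<in> N \<Longrightarrow> g x \<le> C * p x" using bound[OF g(1)] by blast
        have "g (z - y) = 0"
          by (rule N.clamp_eq[OF y _ z(1) _ gN C \<open>g z < 1\<close>]) auto
        then have "g (y - x0) < r"
          using g.q_dist[of y z x0] g.q_sym[of y z] z(2) by (simp add: s_def)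
        then have "y \<in> - ?S" by (rule g(3))
        moreover have "y \<in> ?S" using N.fcalc_in[OF y] N.clamp_bound[OF y] by simp
        ultimately show False by blast
      qed
      then have "K *\<^sub>R x0 \<in> N" using n.B_scale by simp
      then show "x \<in> N" using K by (simp add: x0_def)
    qed
  qed
qed

section \<open>The characterisation\<close>

lemma presentation_of_projective_limit:
  fixes m :: "'a::{real_vector, topological_space} \<Rightarrow> 'a \<Rightarrow> 'a"
  assumes "topological_jordan_algebra m e" and "projective_limit_of TYPE('i) (P :: (real, 'e) module \<Rightarrow> _) m e"
  shows "\<exists>Q. seminorm_presentation m e Q"
proof -
  obtain I :: "'i set" and leq and E :: "'i \<Rightarrow> (real, 'e) module" and \<nu> g \<phi> where
    "projective_family I leq E \<nu> g" "\<phi> \<in> jordan_hom (type_algebra m e) (proj_lim I leq E g)"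
    "homeomorphic_map euclidean (proj_lim_topology I leq E \<nu> g) \<phi>"
    using assms(2) unfolding projective_limit_of_def by blast
  then have "projective_limit m e I leq E \<nu> g \<phi>"
    using assms(1) by (simp add: projective_limit_def topological_jordan_algebra_def)
  then interpret projective_limit m e I leq E \<nu> g \<phi> .
  show ?thesis using presentation by blast
qed

lemma JB_presentation_of_locally_JB:
  fixes m :: "'a::{real_vector, topological_space} \<Rightarrow> 'a \<Rightarrow> 'a"
  assumes "locally_JB_algebra TYPE('i) TYPE('e) m e"
  shows "\<exists>Q. JB_presentation m e Q"
proof -
  obtain I :: "'i set" and leq and E :: "'i \<Rightarrow> (real, 'e) module" and \<nu> g \<phi> where
    "projective_family I leq E \<nu> g" and JB: "\<forall>\<alpha>\<in>I. JB_algebra (E \<alpha>) (\<nu> \<alpha>)"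
    and "\<phi> \<in> jordan_hom (type_algebra m e) (proj_lim I leq E g)"
    "homeomorphic_map euclidean (proj_lim_topology I leq E \<nu> g) \<phi>"
    using assms unfolding locally_JB_algebra_def projective_limit_of_def by blast
  then have "projective_limit m e I leq E \<nu> g \<phi>"
    using assms by (simp add: projective_limit_def locally_JB_algebra_def topological_jordan_algebra_def)
  then interpret projective_limit m e I leq E \<nu> g \<phi> .
  have "JB_presentation m e (cnorm ` I)"
    by (intro JB_presentation.intro JB_presentation_axioms.intro presentation) (use cnorm_JB JB in auto)
  then show ?thesis ..
qed

theorem theorem3:
  fixes m :: "'a::{real_vector, topological_space} \<Rightarrow> 'a \<Rightarrow> 'a" and e :: 'a
  assumes "complete_fine_lmc_jordan_algebra TYPE('k) TYPE('d) m e"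
  shows "(locally_JB_algebra TYPE('i + ('a \<Rightarrow> real)) TYPE('e + (nat \<Rightarrow> 'a) set) m e
          \<longleftrightarrow> (\<exists>N p. densely_included_JB m e N p))
       \<and> (\<forall>N p. densely_included_JB m e N p \<and> closed {x \<in> N. p x \<le> 1}
          \<longrightarrow> (\<forall>\<Gamma>. JB_seminorm_family m e \<Gamma> \<longrightarrow> N = bounded_part \<Gamma>))"
proof -
  have top: "topological_jordan_algebra m e"
    using assms by (simp add: complete_fine_lmc_jordan_algebra_def)
  obtain Q where "seminorm_presentation m e Q"
    using presentation_of_projective_limit[OF top] assms
    unfolding complete_fine_lmc_jordan_algebra_def by blast
  then interpret seminorm_presentation m e Q .
  have "\<exists>N p. densely_included_JB m e N p"
    if "locally_JB_algebra TYPE('i + ('a \<Rightarrow> real)) TYPE('e + (nat \<Rightarrow> 'a) set) m e"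
    using JB_presentation_of_locally_JB[OF that] JB_presentation.densely_included_bounded by blast
  moreover have "locally_JB_algebra TYPE('i + ('a \<Rightarrow> real)) TYPE('e + (nat \<Rightarrow> 'a) set) m e"
    if N: "densely_included_JB m e N p" for N p
  proof -
    obtain Q' where "JB_presentation m e Q'" using JB_presentation_of_dense_JB[OF N] by blast
    then have "JB_presentation_limit m e Q'" by (rule JB_presentation_limit.intro)
    then have "projective_limit_of TYPE('i + ('a \<Rightarrow> real))
        (JB_algebra :: (real, 'e + (nat \<Rightarrow> 'a) set) module \<Rightarrow> _) m e"
      by (rule JB_presentation_limit.projective_limit_of_JB)
    then show ?thesis using top by (simp add: locally_JB_algebra_def)
  qed
  ultimately show ?thesis using dense_JB_eq_bounded_part by blast
qed

end
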